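(* Let $k$ be a field with $\operatorname{char} k\neq 2$, let $f(X)\in k[X]$ be a squarefree polynomial of degree $\ge 1$ that factors over $\bar k$ as $f(X)=c\prod_{r\in R}(X-r)$ with $R\subset \bar k$ a finite set, and let $C/k$ be the hyperelliptic curve $C: Y^2=f(X)$. Let $G\subset \operatorname{Aut}_k C$ be a finite affine group of automorphisms, so that each $g\in G$ acts as $g(X)=\alpha(g)X+\beta(g)$, $g(Y)=\gamma(g)Y$ for some $\alpha(g),\beta(g),\gamma(g)\in k$. Let $G$ act on $R$ through the $X$-coordinate and write $R/G$ for the set of orbits. Then: 1. If $G$ contains the hyperelliptic involution, then $C/G\simeq \mathbb P^1_k$. 2. If $G$ acts trivially on the $Y$-coordinate (that is, $\gamma(g)=1$ for all $g\in G$), then $$C/G:\quad y^2=c\,(-1)^{|R|-|R/G|}\prod_{O\in R/G}\Bigl(x-\prod_{r\in O}r\Bigr).$$ 3. Otherwise, $$C/G:\quad y^2=c\,(-1)^{(m-1)(|R/G|-1)}\,(x-\mu)\prod_{O\in R/G,\ O\neq U}\Bigl(x-\prod_{r\in O}r\Bigr),$$ where $U$ is the set of $a\in k$ that are fixed points of some non-trivial $g\in G$ acting on $k$ through the $X$-coordinate (that is, via $a\mapsto \alpha(g)a+\beta(g)$), $m=|G|/|U|$ and $\mu=\prod_{a\in U}a^m$.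
   Context: The curve $C$ given by $Y^2=f(X)$ means the smooth projective curve with this affine equation; genus $\le 1$ is allowed. The hyperelliptic involution is $(X,Y)\mapsto (X,-Y)$. The action of $G$ on $\bar k$ "through the $X$-coordinate" is $a\mapsto \alpha(g)a+\beta(g)$; it preserves $R$. An equation for $C/G$ means that $C/G$ is isomorphic over $k$ to the smooth projective curve with the given affine equation. *)

theory Defs
  imports
    "HOL-Algebra.Algebraic_Closure_Type"
    "HOL-Algebra.Subrings"
    "HOL-Analysis.Abstract_Topology"
    "HOL-Library.FuncSet"
begin

subsection \<open>Ringed spaces over a field\<close>

text \<open>
  The field \<open>const S V\<close> is the structure map from the base field to the ring of sections over
  \<open>V\<close>, and \<open>restr S V W\<close> is the restriction from \<open>V\<close> to \<open>W\<close>. Only open \<open>V\<close> and \<open>W\<close> matter.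
\<close>

record ('k, 'p, 'r) ringed_space =
  pts :: "'p topology"
  sect :: "'p set \<Rightarrow> 'r ring"
  restr :: "'p set \<Rightarrow> 'p set \<Rightarrow> 'r \<Rightarrow> 'r"
  const :: "'p set \<Rightarrow> 'k \<Rightarrow> 'r"

definition preim :: "('k, 'p, 'r) ringed_space \<Rightarrow> ('p \<Rightarrow> 'q) \<Rightarrow> 'q set \<Rightarrow> 'p set" where
  "preim S h V = {p \<in> topspace (pts S). h p \<in> V}"

text \<open>
  An isomorphism over the base field: a homeomorphism \<open>h\<close> from \<open>S\<close> to \<open>T\<close> together with the
  comorphisms \<open>\<phi> V\<close>, going from the sections of \<open>T\<close> over \<open>V\<close> to those of \<open>S\<close> over the preimage
  of \<open>V\<close>. Between locally ringed spaces these are the isomorphisms of locally ringed spaces, as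
  a ring isomorphism of stalks is automatically local.
\<close>

definition rs_iso ::
  "('k, 'p, 'r) ringed_space \<Rightarrow> ('k, 'q, 's) ringed_space \<Rightarrow>
    ('p \<Rightarrow> 'q) \<times> ('q set \<Rightarrow> 's \<Rightarrow> 'r) \<Rightarrow> bool" where
  "rs_iso S T g \<longleftrightarrow> (case g of (h, \<phi>) \<Rightarrow>
     homeomorphic_map (pts S) (pts T) h \<and>
     (\<forall>V. openin (pts T) V \<longrightarrow>
        \<phi> V \<in> ring_iso (sect T V) (sect S (preim S h V)) \<and>
        (\<forall>c. \<phi> V (const T V c) = const S (preim S h V) c)) \<and>
     (\<forall>V W. openin (pts T) V \<longrightarrow> openin (pts T) W \<longrightarrow> W \<subseteq> V \<longrightarrow>
        (\<forall>s \<in> carrier (sect T V).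
           \<phi> W (restr T V W s) = restr S (preim S h V) (preim S h W) (\<phi> V s))))"

definition isomorphic ::
  "('k, 'p, 'r) ringed_space \<Rightarrow> ('k, 'q, 's) ringed_space \<Rightarrow> bool" where
  "isomorphic S T \<longleftrightarrow> (\<exists>g. rs_iso S T g)"

type_synonym ('p, 'r) auto = "('p \<Rightarrow> 'p) \<times> ('p set \<Rightarrow> 'r \<Rightarrow> 'r)"

text \<open>
  The group of automorphisms over the base field. Its elements are taken to be \<open>undefined\<close>
  outside their mathematical domain, so that distinct elements are distinct automorphisms and
  the cardinality of a set of automorphisms is the intended one.
\<close>

definition aut_group :: "('k, 'p, 'r) ringed_space \<Rightarrow> ('p, 'r) auto monoid" where
  "aut_group S = \<lparr>
     carrier = {(h, \<phi>). rs_iso S S (h, \<phi>) \<and> h \<in> extensional (topspace (pts S)) \<and>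
       (\<forall>V. if openin (pts S) V then \<phi> V \<in> extensional (carrier (sect S V))
            else \<phi> V = undefined)},
     monoid.mult = (\<lambda>(h1, \<phi>1) (h2, \<phi>2).
       (compose (topspace (pts S)) h1 h2,
        \<lambda>V. if openin (pts S) V
            then compose (carrier (sect S V)) (\<phi>2 (preim S h1 V)) (\<phi>1 V) else undefined)),
     monoid.one = (restrict id (topspace (pts S)),
        \<lambda>V. if openin (pts S) V then restrict id (carrier (sect S V)) else undefined)\<rparr>"

text \<open>
  The pullback by \<open>g\<close> of the rational function represented by the section \<open>s\<close> is represented by
  the section \<open>t\<close>. This is meant for an \<open>S\<close> all of whose nonempty open sets are dense and whose
  restriction maps between nonempty open sets are inclusions, like the curves below.
\<close>

definition pulls_back ::
  "('k, 'p, 'r) ringed_space \<Rightarrow> ('p, 'r) auto \<Rightarrow> 'r \<Rightarrow> 'r \<Rightarrow> bool" where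
  "pulls_back S g s t \<longleftrightarrow>
     (\<exists>V. openin (pts S) V \<and> V \<noteq> {} \<and> s \<in> carrier (sect S V) \<and> snd g V s = t)"

text \<open>
  The quotient ringed space: the orbit space with the quotient topology, and as structure sheaf
  the \<open>G\<close>-invariants of the direct image of the structure sheaf. The preimage of a set \<open>V\<close> of
  orbits is \<open>saturation S G V\<close>.
\<close>

definition orbit_pt :: "('p, 'r) auto set \<Rightarrow> 'p \<Rightarrow> 'p set" where
  "orbit_pt G p = (\<lambda>g. fst g p) ` G"

definition saturation ::
  "('k, 'p, 'r) ringed_space \<Rightarrow> ('p, 'r) auto set \<Rightarrow> 'p set set \<Rightarrow> 'p set" where
  "saturation S G V = {p \<in> topspace (pts S). orbit_pt G p \<in> V}"

definition quotient_space :: "('k, 'p, 'r) ringed_space \<Rightarrow> ('p, 'r) auto set \<Rightarrow>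
    ('k, 'p set, 'r) ringed_space" where
  "quotient_space S G = \<lparr>
     pts = topology (\<lambda>V. V \<subseteq> orbit_pt G ` topspace (pts S) \<and> openin (pts S) (saturation S G V)),
     sect = (\<lambda>V. (sect S (saturation S G V))\<lparr>carrier :=
       {s \<in> carrier (sect S (saturation S G V)). \<forall>g\<in>G. snd g (saturation S G V) s = s}\<rparr>),
     restr = (\<lambda>V W. restr S (saturation S G V) (saturation S G W)),
     const = (\<lambda>V. const S (saturation S G V))\<rparr>"


subsection \<open>The smooth projective curve with a given function field\<close>

text \<open>
  Let \<open>K\<close> be a function field in one variable, with structure map \<open>\<kappa>\<close> from the base field \<open>k\<close>.
  The (regular) projective curve with function field \<open>K\<close> is constructed as the abstract curve of
  valuation rings: its points are the valuation rings of \<open>K\<close> containing \<open>k\<close> (\<open>K\<close> itself is the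
  generic point, the other ones are the discrete valuation rings of \<open>K/k\<close> and are the closed
  points), a nonempty set is open if it contains the generic point and has a finite complement,
  and the sections over a nonempty open set are the elements of \<open>K\<close> that lie in all the local
  rings of its points. The sections over the empty set form the zero ring.
\<close>

definition valuation_rings :: "'r ring \<Rightarrow> ('k \<Rightarrow> 'r) \<Rightarrow> 'r set set" where
  "valuation_rings K \<kappa> = {P. subring P K \<and> range \<kappa> \<subseteq> P \<and>
     (\<forall>z \<in> carrier K - {\<zero>\<^bsub>K\<^esub>}. z \<in> P \<or> inv\<^bsub>K\<^esub> z \<in> P)}"

definition curve_of :: "'r ring \<Rightarrow> ('k \<Rightarrow> 'r) \<Rightarrow> ('k, 'r set, 'r) ringed_space" where
  "curve_of K \<kappa> = \<lparr>
     pts = topology (\<lambda>V. V = {} \<or>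
       (V \<subseteq> valuation_rings K \<kappa> \<and> carrier K \<in> V \<and> finite (valuation_rings K \<kappa> - V))),
     sect = (\<lambda>V. if V = {} then K\<lparr>carrier := {\<zero>\<^bsub>K\<^esub>}, monoid.one := \<zero>\<^bsub>K\<^esub>\<rparr> else K\<lparr>carrier := \<Inter>V\<rparr>),
     restr = (\<lambda>V W s. if W = {} then \<zero>\<^bsub>K\<^esub> else s),
     const = (\<lambda>V c. if V = {} then \<zero>\<^bsub>K\<^esub> else \<kappa> c)\<rparr>"

definition proj_line :: "('k::field, 'k poly fract set, 'k poly fract) ringed_space" where
  "proj_line = curve_of ring_of_type_algebra (\<lambda>c. to_fract [:c:])"

text \<open>
  The field obtained from the rational function field in \<open>X\<close> by adjoining a square root \<open>Y\<close> of
  \<open>f\<close>. The pair \<open>(a, b)\<close> stands for \<open>a + b Y\<close>.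
\<close>

type_synonym 'k ffield = "'k poly fract \<times> 'k poly fract"

definition hyp_field :: "'k::field poly \<Rightarrow> 'k ffield ring" where
  "hyp_field f = \<lparr>
     carrier = UNIV,
     monoid.mult = (\<lambda>(a, b) (c, d). (a * c + b * d * to_fract f, a * d + b * c)),
     monoid.one = (1, 0),
     ring.zero = (0, 0),
     ring.add = (\<lambda>(a, b) (c, d). (a + c, b + d))\<rparr>"

text \<open>
  The projective curve with affine equation \<open>Y\<^sup>2 = f(X)\<close>. Over an imperfect field the abstract
  curve is in general only regular; this one is smooth if \<open>2 \<noteq> 0\<close> in the field and \<open>f\<close> is
  nonconstant with distinct roots in an algebraic closure.
\<close>

definition hyp_curve :: "'k::field poly \<Rightarrow> ('k, 'k ffield set, 'k ffield) ringed_space" where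
  "hyp_curve f = curve_of (hyp_field f) (\<lambda>c. (to_fract [:c:], 0))"

text \<open>The automorphism \<open>g\<close> acts on functions as \<open>g(X) = a X + b\<close>, \<open>g(Y) = c Y\<close>.\<close>

definition acts_affinely ::
  "'k::field poly \<Rightarrow> ('k ffield set, 'k ffield) auto \<Rightarrow> 'k \<Rightarrow> 'k \<Rightarrow> 'k \<Rightarrow> bool" where
  "acts_affinely f g a b c \<longleftrightarrow>
     pulls_back (hyp_curve f) g (to_fract [:0, 1:], 0) (to_fract [:b, a:], 0) \<and>
     pulls_back (hyp_curve f) g (0, 1) (0, to_fract [:c:])"

definition is_hyp_involution ::
  "'k::field poly \<Rightarrow> ('k ffield set, 'k ffield) auto \<Rightarrow> bool" where
  "is_hyp_involution f g \<longleftrightarrow> g \<in> carrier (aut_group (hyp_curve f)) \<and> acts_affinely f g 1 0 (-1)"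


subsection \<open>The open sets are as intended\<close>

lemma openin_curve_of:
  "openin (pts (curve_of K \<kappa>)) V \<longleftrightarrow> V = {} \<or>
     (V \<subseteq> valuation_rings K \<kappa> \<and> carrier K \<in> V \<and> finite (valuation_rings K \<kappa> - V))"
proof -
  let ?A = "valuation_rings K \<kappa>"
  let ?P = "\<lambda>V. V = {} \<or> (V \<subseteq> ?A \<and> carrier K \<in> V \<and> finite (?A - V))"
  have "?P (V \<inter> W)" if "?P V" "?P W" for V W
  proof -
    have "?A - V \<inter> W = (?A - V) \<union> (?A - W)" by blast
    with that show ?thesis by auto
  qed
  moreover have "?P (\<Union>\<V>)" if all: "\<forall>V\<in>\<V>. ?P V" for \<V>
  proof (cases "\<exists>V\<in>\<V>. V \<noteq> {}")
    case True
    then obtain V where V: "V \<in> \<V>" "V \<noteq> {}" by blast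
    have "?A - \<Union>\<V> \<subseteq> ?A - V" using V by blast
    moreover have "finite (?A - V)" "carrier K \<in> V" using all V by blast+
    ultimately have "finite (?A - \<Union>\<V>)" "carrier K \<in> \<Union>\<V>"
      using V finite_subset by blast+
    moreover have "\<Union>\<V> \<subseteq> ?A" using all by blast
    ultimately show ?thesis by blast
  qed auto
  ultimately have "istopology ?P" unfolding istopology_def by blast
  then show ?thesis by (simp add: curve_of_def topology_inverse')
qed

lemma openin_quotient_space:
  "openin (pts (quotient_space S G)) V \<longleftrightarrow>
     V \<subseteq> orbit_pt G ` topspace (pts S) \<and> openin (pts S) (saturation S G V)"
proof -
  have "saturation S G (V \<inter> W) = saturation S G V \<inter> saturation S G W" for V W
    by (auto simp: saturation_def)
  moreover have "saturation S G (\<Union>\<V>) = (\<Union>V\<in>\<V>. saturation S G V)" for \<V>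
    by (auto simp: saturation_def)
  ultimately have "istopology (\<lambda>V. V \<subseteq> orbit_pt G ` topspace (pts S) \<and>
      openin (pts S) (saturation S G V))"
    unfolding istopology_def by (auto intro!: openin_Union)
  then show ?thesis by (simp add: quotient_space_def topology_inverse')
qed

end

theory Submission
  imports Defs
begin

text \<open>
  Let \<open>H\<close> be the group of affine maps by which \<open>G\<close> acts on \<open>X\<close>, and let \<open>x\<close> be the product of all \<open>h(X)\<close>
  with \<open>h \<in> H\<close>. An invariant polynomial of degree less than \<open>|H|\<close> is constant, so division by \<open>x\<close> gives
  \<open>k[X]\<^sup>H = k[x]\<close>, hence \<open>k(X)\<^sup>H = k(x)\<close>. If the involution lies in \<open>G\<close>, the invariant field is \<open>k(x)\<close>.
  Otherwise choose \<open>s \<in> k[X]\<close> with \<open>\<gamma>(g) g(s) = s\<close> for all \<open>g\<close>: then \<open>s Y\<close> is invariant, the invariant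
  field is \<open>k(x, s Y)\<close>, and \<open>s\<^sup>2 f\<close> is a polynomial in \<open>x\<close>. Take \<open>s = 1\<close> if \<open>\<gamma>\<close> is trivial; otherwise
  \<open>U\<close> is a single orbit, and \<open>s\<close> is the power of \<open>\<Prod>\<^bsub>u\<in>U\<^esub> (X - u)\<close> with exponent \<open>m/2\<close> or \<open>(m - 1)/2\<close>,
  according to whether \<open>f\<close> vanishes on \<open>U\<close>. The factorization of \<open>s\<^sup>2 f\<close> follows from
  \<open>x - x(r) = (-1)\<^bsup>|H| - 1\<^esup> \<Prod>\<^bsub>h\<in>H\<^esub> (X - h(r))\<close> and the freeness of the action of \<open>H\<close> on \<open>R - U\<close>.

  An automorphism of a curve of valuation rings is the same as an automorphism of its function field, and
  the quotient by a finite group \<open>G\<close> is the curve of the invariant field \<open>L\<close>: the valuation rings lying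
  over a given one of \<open>L\<close> exist by Zorn's lemma and form a single \<open>G\<close>-orbit.
\<close>

text \<open>Three points shape the proof. (1) A nontrivial \<gamma> forces a fixed point: \<gamma>
  is trivial on the translations in H, so \<gamma>(g) \<noteq> 1 means that the multiplier of g is
  not 1, and g fixes some a in k. The multiplier \<chi> is faithful on the stabiliser of a, a group
  of order m. There \<gamma> = \<chi>^(m/2) if f(a) \<noteq> 0, whereas \<gamma>^2 = \<chi> with m
  odd if f(a) = 0; both relations extend to H. As the product of all X - u is multiplied by
  \<chi>(g) under g, this dictates the two exponents for s. (2) The roots lie in the closure of k,
  but the equation must be over k. The factorization is computed over the closure, and its
  coefficients turn out to lie in k because s^2 f is already a polynomial in x over k. Its signs
  come from the product of all multipliers, which is (-1)^(|H|-1). (3) The function fields are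
  records, while valuation theory is done for subsets of a field type. The algebraic closure of
  k(X), which contains a square root of f, hosts them.\<close>

section \<open>Subrings, subfields and valuation rings as subsets of a field\<close>

definition subring_set :: "'a::ring_1 set \<Rightarrow> bool" where
  "subring_set A \<longleftrightarrow> 1 \<in> A \<and> (\<forall>x\<in>A. \<forall>y\<in>A. x - y \<in> A \<and> x * y \<in> A)"

definition subfield_set :: "'a::field set \<Rightarrow> bool" where
  "subfield_set K \<longleftrightarrow> subring_set K \<and> (\<forall>x\<in>K. inverse x \<in> K)"

definition val_ring :: "'a::field set \<Rightarrow> 'a set \<Rightarrow> bool" where
  "val_ring K V \<longleftrightarrow> subring_set V \<and> V \<subseteq> K \<and> (\<forall>z\<in>K. z \<in> V \<or> inverse z \<in> V)"

text \<open>For a valuation ring this is the maximal ideal. Zero is listed separately because the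
  convention \<open>inverse 0 = 0\<close> would let it count as invertible.\<close>

definition nonunits :: "'a::field set \<Rightarrow> 'a set" where
  "nonunits V = {z \<in> V. z = 0 \<or> inverse z \<notin> V}"

lemma subring_setD:
  assumes "subring_set A"
  shows "1 \<in> A" "0 \<in> A" "x \<in> A \<Longrightarrow> y \<in> A \<Longrightarrow> x - y \<in> A" "x \<in> A \<Longrightarrow> - x \<in> A"
    "x \<in> A \<Longrightarrow> y \<in> A \<Longrightarrow> x + y \<in> A" "x \<in> A \<Longrightarrow> y \<in> A \<Longrightarrow> x * y \<in> A" "x \<in> A \<Longrightarrow> x ^ n \<in> A"
proof -
  show 1: "1 \<in> A" and d: "x \<in> A \<Longrightarrow> y \<in> A \<Longrightarrow> x - y \<in> A" and m: "x \<in> A \<Longrightarrow> y \<in> A \<Longrightarrow> x * y \<in> A" for x y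
    using assms by (auto simp: subring_set_def)
  show z: "0 \<in> A" using d[OF 1 1] by simp
  show n: "x \<in> A \<Longrightarrow> - x \<in> A" for x using d[OF z, of x] by simp
  show "x \<in> A \<Longrightarrow> y \<in> A \<Longrightarrow> x + y \<in> A" using d[of x "- y"] n[of y] by simp
  show "x \<in> A \<Longrightarrow> x ^ n \<in> A" by (induction n) (auto intro: 1 m)
qed

lemma subring_set_sum:
  assumes "subring_set A" "\<And>i. i \<in> I \<Longrightarrow> h i \<in> A"
  shows "sum h I \<in> A"
  using assms(2) by (induction I rule: infinite_finite_induct) (auto intro: subring_setD[OF assms(1)])

lemma subring_set_prod:
  fixes h :: "'b \<Rightarrow> 'a::comm_ring_1"
  assumes "subring_set A" "\<And>i. i \<in> I \<Longrightarrow> h i \<in> A"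
  shows "prod h I \<in> A"
  using assms(2) by (induction I rule: infinite_finite_induct) (auto intro: subring_setD[OF assms(1)])

lemma val_ring_inverse: "val_ring K V \<Longrightarrow> z \<in> K \<Longrightarrow> z \<notin> V \<Longrightarrow> inverse z \<in> V"
  by (auto simp: val_ring_def)

lemma val_ring_subring: "val_ring K V \<Longrightarrow> subring_set V"
  by (auto simp: val_ring_def)

lemma val_ring_subset: "val_ring K V \<Longrightarrow> V \<subseteq> K"
  by (auto simp: val_ring_def)

lemma nonunits_subset: "nonunits V \<subseteq> V"
  by (auto simp: nonunits_def)

lemma not_nonunit: "z \<in> V \<Longrightarrow> z \<notin> nonunits V \<Longrightarrow> z \<noteq> 0 \<and> inverse z \<in> V"
  by (auto simp: nonunits_def)

lemma zero_nonunit: "subring_set V \<Longrightarrow> 0 \<in> nonunits V"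
  by (auto simp: nonunits_def subring_setD)

lemma one_not_nonunit: "1 \<in> V \<Longrightarrow> 1 \<notin> nonunits V"
  by (auto simp: nonunits_def)

lemma nonunits_mult:
  assumes "subring_set V" "x \<in> V" "y \<in> nonunits V"
  shows "x * y \<in> nonunits V"
proof -
  have y: "y \<in> V" "y = 0 \<or> inverse y \<notin> V" using assms(3) by (auto simp: nonunits_def)
  have xy: "x * y \<in> V" using assms(1,2) y subring_setD(6) by blast
  have "inverse (x * y) \<notin> V" if nz: "x * y \<noteq> 0"
  proof
    assume "inverse (x * y) \<in> V"
    then have "x * inverse (x * y) \<in> V" using assms(1,2) subring_setD(6) by blast
    also have "x * inverse (x * y) = inverse y" using nz by (simp add: field_simps)
    finally show False using y nz by auto
  qed
  then show ?thesis using xy by (auto simp: nonunits_def)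
qed

lemma nonunits_prime:
  assumes "subring_set V" "x \<in> V" "y \<in> V" "x * y \<in> nonunits V"
  shows "x \<in> nonunits V \<or> y \<in> nonunits V"
  using assms subring_setD(6)[OF assms(1), of "inverse x" "inverse y"]
  by (auto simp: nonunits_def)

lemma nonunits_prod_prime:
  assumes "subring_set V" "finite I" "\<And>i. i \<in> I \<Longrightarrow> h i \<in> V" "prod h I \<in> nonunits V"
  shows "\<exists>i\<in>I. h i \<in> nonunits V"
  using assms(2-)
proof (induction I rule: finite_induct)
  case empty
  then show ?case using one_not_nonunit subring_setD(1)[OF assms(1)] by auto
next
  case (insert i I)
  have "prod h I \<in> V" using insert.prems by (intro subring_set_prod assms(1)) auto
  then show ?case using insert nonunits_prime[OF assms(1), of "h i" "prod h I"] by auto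
qed

text \<open>One of \<open>x / y\<close> and \<open>y / x\<close> lies in \<open>V\<close>, so
  \<open>x + y\<close> is a \<open>V\<close>-multiple of \<open>y\<close> or of
  \<open>x\<close>.\<close>

lemma nonunits_add:
  assumes V: "val_ring K V" "subfield_set K" and "x \<in> nonunits V" "y \<in> nonunits V"
  shows "x + y \<in> nonunits V"
proof -
  have sV: "subring_set V" and sK: "subring_set K" using V by (auto simp: val_ring_def subfield_set_def)
  have *: "x + y \<in> nonunits V" if "x \<in> nonunits V" "y \<in> nonunits V" "y \<noteq> 0" "x / y \<in> V" for x y
  proof -
    have "x + y = (x / y + 1) * y" using that by (simp add: field_simps)
    then show ?thesis using nonunits_mult[OF sV _ that(2)] subring_setD(5)[OF sV that(4)] subring_setD(1)[OF sV] by simp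
  qed
  consider "x = 0" | "y = 0" | "x \<noteq> 0" "y \<noteq> 0" by blast
  then show ?thesis
  proof cases
    case 3
    have "x \<in> K" "y \<in> K" using assms(3,4) V(1) nonunits_subset by (auto simp: val_ring_def)
    then have "x / y \<in> K" using V(2) subring_setD(6)[OF sK] by (auto simp: subfield_set_def divide_inverse)
    then have "x / y \<in> V \<or> y / x \<in> V" using V(1) 3 val_ring_inverse[OF V(1), of "x / y"] by auto
    then show ?thesis using *[of x y] *[of y x] assms(3,4) 3 by (auto simp: add.commute)
  qed (use assms in auto)
qed

lemma one_plus_nonunit:
  assumes V: "val_ring K V" "subfield_set K" and "x \<in> nonunits V"
  shows "1 + x \<in> V" "1 + x \<notin> nonunits V"
proof -
  have sV: "subring_set V" using V(1) by (rule val_ring_subring)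
  have xV: "x \<in> V" using assms(3) nonunits_subset by blast
  show "1 + x \<in> V" using subring_setD[OF sV] xV by auto
  show "1 + x \<notin> nonunits V"
  proof
    assume "1 + x \<in> nonunits V"
    moreover have "- x \<in> nonunits V"
      using nonunits_mult[OF sV _ assms(3), of "-1"] subring_setD(1,4)[OF sV] by auto
    ultimately have "1 + x + - x \<in> nonunits V" using nonunits_add[OF V] by blast
    then show False using one_not_nonunit subring_setD(1)[OF sV] by auto
  qed
qed

lemma outside_val_ring:
  assumes "val_ring K V" "z \<in> K" "z \<notin> V"
  shows "z \<noteq> 0" "inverse z \<in> nonunits V"
  using assms val_ring_inverse[OF assms] subring_setD(2)[OF val_ring_subring[OF assms(1)]]
  by (auto simp: nonunits_def)

lemma val_ring_Int:
  assumes "val_ring K V" "subfield_set L" "L \<subseteq> K"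
  shows "val_ring L (V \<inter> L)"
  using assms unfolding val_ring_def subfield_set_def subring_set_def by blast

lemma nonunits_Int:
  assumes "subfield_set L"
  shows "nonunits (V \<inter> L) = nonunits V \<inter> L"
  using assms by (auto simp: nonunits_def subfield_set_def)

subsection \<open>Extension of valuation rings\<close>

text \<open>Witnesses that an element of \<open>M\<close> becomes invertible in \<open>A[z]\<close>.
  The degree is recorded because the contradiction is reached by descent on it.\<close>

definition unital_expr :: "'a::field set \<Rightarrow> 'a set \<Rightarrow> 'a \<Rightarrow> nat \<Rightarrow> bool" where
  "unital_expr A M z n \<longleftrightarrow> (\<exists>m\<in>M. \<exists>p. (\<forall>i. coeff p i \<in> A) \<and> degree p \<le> n \<and> m * poly p z = 1)"

text \<open>Multiplied by \<open>z\<^sup>n\<close>, the relation for \<open>1/z\<close> expresses \<open>z\<^sup>n\<close> by lower powers of \<open>z\<close>, as \<open>1 - m b\<close> is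
  invertible.\<close>

lemma unital_expr_descent:
  assumes A: "subring_set A" and MA: "M \<subseteq> A" and units: "\<And>m b. m \<in> M \<Longrightarrow> b \<in> A \<Longrightarrow> inverse (1 - m * b) \<in> A"
    and nunit: "\<And>m b. m \<in> M \<Longrightarrow> b \<in> A \<Longrightarrow> 1 - m * b \<noteq> 0"
    and z: "z \<noteq> 0" "unital_expr A M z n" "unital_expr A M (inverse z) k" "k \<le> n" "0 < n"
  shows "unital_expr A M z (n - 1)"
proof -
  obtain m p where p: "m \<in> M" "\<forall>i. coeff p i \<in> A" "degree p \<le> n" "m * poly p z = 1"
    using z by (auto simp: unital_expr_def)
  obtain m' q where q: "m' \<in> M" "\<forall>i. coeff q i \<in> A" "degree q \<le> k" "m' * poly q (inverse z) = 1"
    using z by (auto simp: unital_expr_def)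
  define q0 where "q0 = coeff q 0"
  define u where "u = inverse (1 - m' * q0)"
  have uA: "u \<in> A" using units q by (simp add: u_def q0_def)
  have u0: "u * (1 - m' * q0) = 1" using nunit[OF q(1), of q0] q by (simp add: u_def q0_def)
  \<comment> \<open>The tail of \<open>q\<close>, reversed: the factor \<open>z^n\<close> turns
    \<open>inverse z ^ i\<close> into \<open>z^(n - i)\<close>, for which \<open>k \<le> n\<close>
    is used. Leaving out the index 0 keeps the degree below \<open>n\<close>.\<close>
  define q' where "q' = (\<Sum>i\<in>{1..n}. monom (u * m' * coeff q i) (n - i))"
  have "poly q (inverse z) = (\<Sum>i\<le>n. coeff q i * inverse z ^ i)"
    unfolding poly_altdef using q(3) z(4)
    by (intro sum.mono_neutral_left) (auto simp: coeff_eq_0)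
  also have "{..n} = insert 0 {1..n}" by auto
  also have "(\<Sum>i\<in>insert 0 {1..n}. coeff q i * inverse z ^ i) = q0 + (\<Sum>i\<in>{1..n}. coeff q i * inverse z ^ i)"
    by (simp add: q0_def)
  finally have e: "1 - m' * q0 = m' * (\<Sum>i\<in>{1..n}. coeff q i * inverse z ^ i)"
    using q(4) by (simp add: algebra_simps)
  have "z ^ n = z ^ n * (u * (1 - m' * q0))" using u0 by simp
  also have "\<dots> = (\<Sum>i\<in>{1..n}. u * m' * coeff q i * (z ^ n * inverse z ^ i))"
    unfolding e by (simp add: sum_distrib_left mult_ac)
  also have "\<dots> = (\<Sum>i\<in>{1..n}. u * m' * coeff q i * z ^ (n - i))"
    using z(1) by (intro sum.cong) (auto simp: field_simps power_diff)
  also have "\<dots> = poly q' z" by (simp add: q'_def poly_sum poly_monom)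
  finally have q'z: "poly q' z = z ^ n" ..
  have q'A: "coeff q' i \<in> A" for i
    unfolding q'_def coeff_sum
    using subring_setD[OF A] uA q(1,2) MA by (intro subring_set_sum A) (auto simp: coeff_monom)
  have q'd: "degree q' \<le> n - 1"
    unfolding q'_def by (intro degree_sum_le) (auto intro: order.trans[OF degree_monom_le])
  \<comment> \<open>The top term of \<open>p\<close> is traded for a multiple of \<open>q'\<close>,
    which has the same value at \<open>z\<close>.\<close>
  define p' where "p' = p - monom (coeff p n) n + smult (coeff p n) q'"
  have "poly p' z = poly p z" by (simp add: p'_def poly_monom q'z)
  moreover have "coeff p' i \<in> A" for i
    using subring_setD[OF A] p(2) q'A by (auto simp: p'_def coeff_monom)
  moreover have "degree p' \<le> n - 1"
  proof (rule degree_le, safe)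
    fix i assume "n - 1 < i"
    then show "coeff p' i = 0"
      using p(3) q'd z(5) by (cases "i = n") (auto simp: p'_def coeff_monom coeff_eq_0)
  qed
  ultimately show ?thesis unfolding unital_expr_def using p by (intro bexI[of _ m] exI[of _ p']) auto
qed

text \<open>Descent on \<open>n + k\<close>: the longer of the two expressions is shortened by means
  of the other, with \<open>z\<close> and \<open>inverse z\<close> exchanged if necessary. In degree
  0 the relation reads \<open>m * c = 1\<close>, which \<open>nunit\<close> forbids.\<close>

lemma not_both_unital_expr:
  assumes A: "subring_set A" and MA: "M \<subseteq> A" and units: "\<And>m b. m \<in> M \<Longrightarrow> b \<in> A \<Longrightarrow> inverse (1 - m * b) \<in> A"
    and nunit: "\<And>m b. m \<in> M \<Longrightarrow> b \<in> A \<Longrightarrow> 1 - m * b \<noteq> 0"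
    and z: "z \<noteq> 0"
  shows "\<not> (unital_expr A M z n \<and> unital_expr A M (inverse z) k)"
  using z
proof (induction "n + k" arbitrary: n k z rule: less_induct)
  case less
  have 0: False if "unital_expr A M w 0" for w
  proof -
    obtain m p where p: "m \<in> M" "\<forall>i. coeff p i \<in> A" "degree p = 0" "m * poly p w = 1"
      using \<open>unital_expr A M w 0\<close> by (auto simp: unital_expr_def)
    then obtain c where "p = [:c:]" by (metis degree_eq_zeroE)
    then show False using p nunit[of m c] by (auto dest: spec[of _ 0])
  qed
  show ?case
  proof safe
    assume e: "unital_expr A M z n" "unital_expr A M (inverse z) k"
    have n0: "0 < n" "0 < k" using 0 e by (cases n; cases k; auto)+
    show False
    proof (cases "k \<le> n")
      case True
      then show False using unital_expr_descent[OF A MA units nunit less.prems e True n0(1)]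
        less.hyps[of "n - 1" k z] e n0 less.prems by auto
    next
      case False
      then show False
        using unital_expr_descent[OF A MA units nunit _ e(2), of n] e(1)
        less.hyps[of n "k - 1" z] e n0 less.prems by auto
    qed
  qed
qed

lemma adjoin_subring_set:
  fixes z :: "'a::comm_ring_1"
  assumes A: "subring_set A"
  shows "subring_set {poly p z | p. \<forall>i. coeff p i \<in> A}"
  unfolding subring_set_def
proof safe
  show "\<exists>p. 1 = poly p z \<and> (\<forall>i. coeff p i \<in> A)"
    using subring_setD[OF A] by (intro exI[of _ 1]) (auto simp: coeff_1)
next
  fix p q assume p: "\<forall>i. coeff p i \<in> A" and q: "\<forall>i. coeff q i \<in> A"
  show "\<exists>r. poly p z - poly q z = poly r z \<and> (\<forall>i. coeff r i \<in> A)"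
    using p q subring_setD[OF A] by (intro exI[of _ "p - q"]) auto
  show "\<exists>r. poly p z * poly q z = poly r z \<and> (\<forall>i. coeff r i \<in> A)"
    using p q subring_setD[OF A] by (intro exI[of _ "p * q"]) (auto simp: coeff_mult intro!: subring_set_sum[OF A])
qed

text \<open>Chevalley's argument. Let \<open>A\<close> be maximal among the subrings meeting
  \<open>L\<close> in \<open>Q\<close>. Maximality makes every \<open>1 - m * b\<close> invertible
  in \<open>A\<close>, by localising, and makes some element of \<open>M\<close> invertible in
  \<open>A[z]\<close> for each \<open>z\<close> outside \<open>A\<close>. If \<open>z\<close> and
  \<open>inverse z\<close> were both outside, \<open>not_both_unital_expr\<close> would be
  violated.\<close>

lemma val_ring_extend:
  fixes L :: "'a::field set"
  assumes L: "subfield_set L" and Q: "val_ring L Q"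
  shows "\<exists>P. val_ring UNIV P \<and> P \<inter> L = Q"
proof -
  define FF where "FF = {A. subring_set A \<and> A \<inter> L = Q}"
  have sQ: "subring_set Q" and QL: "Q \<subseteq> L" using Q by (auto simp: val_ring_def)
  have sL: "subring_set L" using L by (auto simp: subfield_set_def)
  have "\<exists>A\<in>FF. \<forall>W\<in>FF. A \<subseteq> W \<longrightarrow> W = A"
  proof (rule subset_Zorn_nonempty)
    show "FF \<noteq> {}" using sQ QL by (auto simp: FF_def)
  next
    fix C assume C: "C \<noteq> {}" "subset.chain FF C"
    have CA: "C \<subseteq> FF" and lin: "\<And>W Y. W \<in> C \<Longrightarrow> Y \<in> C \<Longrightarrow> W \<subseteq> Y \<or> Y \<subseteq> W"
      using C by (auto simp: subset_chain_def)
    have "subring_set (\<Union>C)"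
      unfolding subring_set_def
    proof safe
      show "1 \<in> \<Union>C" using C(1) CA by (auto simp: FF_def subring_set_def)
    next
      fix x y W Y assume *: "x \<in> W" "W \<in> C" "y \<in> Y" "Y \<in> C"
      then obtain Z where Z: "Z \<in> C" "x \<in> Z" "y \<in> Z" using lin[of W Y] by blast
      then have "subring_set Z" using CA by (auto simp: FF_def)
      then show "x - y \<in> \<Union>C" "x * y \<in> \<Union>C" using Z by (auto simp: subring_set_def)
    qed
    moreover have "\<Union>C \<inter> L = Q" using C(1) CA by (auto simp: FF_def)
    ultimately show "\<Union>C \<in> FF" by (simp add: FF_def)
  qed
  then obtain A where A: "subring_set A" "A \<inter> L = Q" and max: "\<And>W. subring_set W \<Longrightarrow> W \<inter> L = Q \<Longrightarrow> A \<subseteq> W \<Longrightarrow> W = A"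
    by (auto simp: FF_def)
  define M where "M = nonunits Q"
  have MQ: "M \<subseteq> Q" by (simp add: M_def nonunits_subset)
  have MA: "M \<subseteq> A" using MQ A(2) by blast
  \<comment> \<open>for \<open>W \<supseteq> Q\<close> the condition \<open>W \<inter> L = Q\<close> means that no nonunit of \<open>Q\<close> becomes a unit in \<open>W\<close>\<close>
  have ext: "\<exists>m\<in>M. m \<noteq> 0 \<and> inverse m \<in> W" if W: "Q \<subseteq> W" "W \<inter> L \<noteq> Q" for W
  proof -
    obtain x where x: "x \<in> W" "x \<in> L" "x \<notin> Q" using W QL by blast
    then have "x \<noteq> 0" "inverse x \<in> M" using outside_val_ring[OF Q x(2,3)] by (auto simp: M_def)
    then show ?thesis using x by (intro bexI[of _ "inverse x"]) auto
  qed
  have noA: "m * b \<noteq> 1" if "m \<in> M" "b \<in> A" for m b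
  proof
    assume e: "m * b = 1"
    then have m: "m \<noteq> 0" "b = inverse m" using inverse_unique by auto
    then have "b \<in> L" using that MQ QL L by (auto simp: subfield_set_def)
    then have "b \<in> Q" using A(2) that by blast
    then show False using that m by (auto simp: M_def nonunits_def)
  qed
  have cmp: "x / y \<in> Q \<or> y / x \<in> Q" if "x \<in> Q" "y \<in> Q" for x y
  proof -
    have "x \<in> L" "inverse y \<in> L" using that QL L by (auto simp: subfield_set_def)
    then have "x / y \<in> L" using subring_setD(6)[OF sL] by (simp add: divide_inverse)
    then show ?thesis using Q val_ring_inverse[OF Q, of "x / y"] by auto
  qed
  \<comment> \<open>Of two elements of \<open>M\<close> one divides the other in \<open>Q\<close>,
    so a sum of multiples of both is a multiple of a single one.\<close>
  have common: "\<exists>m\<in>M. \<exists>c\<in>Q. \<exists>d\<in>Q. m1 = m * c \<and> m2 = m * d" if "m1 \<in> M" "m2 \<in> M" for m1 m2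
  proof (cases "m1 = 0 \<or> m2 = 0")
    case True
    then show ?thesis using that subring_setD(1,2)[OF sQ] by (metis mult.right_neutral mult_zero_right)
  next
    case False
    have Q1: "1 \<in> Q" using subring_setD(1)[OF sQ] .
    from cmp[of m1 m2] show ?thesis
    proof
      assume "m1 / m2 \<in> Q"
      then show ?thesis using that False Q1 by (intro bexI[of _ m2] bexI[of _ "m1/m2"] bexI[of _ 1]) auto
    next
      assume "m2 / m1 \<in> Q"
      then show ?thesis using that False Q1 by (intro bexI[of _ m1] bexI[of _ 1] bexI[of _ "m2/m1"]) auto
    qed (use that MQ in auto)
  qed
  \<comment> \<open>The localisation of \<open>A\<close> at the elements \<open>1 - m * b\<close>.
    It again meets \<open>L\<close> in \<open>Q\<close>, hence equals \<open>A\<close>.\<close>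
  define S where "S = {a / (1 - m * b) | a m b. a \<in> A \<and> m \<in> M \<and> b \<in> A}"
  have QA: "Q \<subseteq> A" using A(2) by blast
  note AD = subring_setD[OF A(1)]
  have M0: "0 \<in> M" using zero_nonunit[OF sQ] by (simp add: M_def)
  have nz: "1 - m * b \<noteq> 0" if "m \<in> M" "b \<in> A" for m b using noA[OF that] by auto
  have dmul: "\<exists>m\<in>M. \<exists>b\<in>A. (1 - m1 * b1) * (1 - m2 * b2) = 1 - m * b" if mb: "m1 \<in> M" "m2 \<in> M" "b1 \<in> A" "b2 \<in> A" for m1 m2 b1 b2
  proof -
    obtain m c d where m: "m \<in> M" "c \<in> Q" "d \<in> Q" "m1 = m * c" "m2 = m * d" using common[OF mb(1,2)] by blast
    have "(1 - m1 * b1) * (1 - m2 * b2) = 1 - m * (c * b1 + d * b2 - m1 * b1 * d * b2)"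
      using m by (simp add: algebra_simps)
    moreover have "c * b1 + d * b2 - m1 * b1 * d * b2 \<in> A"
      using mb m QA MA AD by (meson subsetD)
    ultimately show ?thesis using m by blast
  qed
  have "S = A"
  proof (rule max)
    show AS: "A \<subseteq> S"
    proof
      fix a assume "a \<in> A"
      moreover have "a = a / (1 - 0 * 0)" by simp
      ultimately show "a \<in> S" unfolding S_def using M0 AD(2) by blast
    qed
    show "subring_set S"
      unfolding subring_set_def
    proof safe
      show "1 \<in> S" using AS AD(1) by auto
    next
      fix x y assume "x \<in> S" "y \<in> S"
      then obtain a m b a' m' b' where x: "x = a / (1 - m * b)" "a \<in> A" "m \<in> M" "b \<in> A"
        and y: "y = a' / (1 - m' * b')" "a' \<in> A" "m' \<in> M" "b' \<in> A" unfolding S_def by blast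
      obtain m'' b'' where d: "m'' \<in> M" "b'' \<in> A" "(1 - m * b) * (1 - m' * b') = 1 - m'' * b''"
        using dmul[of m m' b b'] x y by blast
      have "x - y = (a * (1 - m' * b') - a' * (1 - m * b)) / (1 - m'' * b'')"
        unfolding x(1) y(1) d(3)[symmetric]
        using nz[of m b] nz[of m' b'] x y by (subst diff_frac_eq) auto
      moreover have "a * (1 - m' * b') - a' * (1 - m * b) \<in> A" using x y AD MA by (meson subsetD)
      ultimately show "x - y \<in> S" using d(1,2) unfolding S_def by blast
      have "x * y = (a * a') / (1 - m'' * b'')"
        unfolding x(1) y(1) d(3)[symmetric] by simp
      moreover have "a * a' \<in> A" using x(2) y(2) AD(6) by blast
      ultimately show "x * y \<in> S" using d(1,2) unfolding S_def by blast
    qed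
    show "S \<inter> L = Q"
    proof (rule ccontr)
      assume "S \<inter> L \<noteq> Q"
      then obtain m where m: "m \<in> M" "m \<noteq> 0" "inverse m \<in> S" using ext[of S] AS QA by blast
      then obtain a m' b where *: "inverse m = a / (1 - m' * b)" "a \<in> A" "m' \<in> M" "b \<in> A" unfolding S_def by blast
      \<comment> \<open>An inverse of \<open>m\<close> in \<open>S\<close> exhibits 1 as
        \<open>m' * b + m * a\<close>, a multiple of one element of \<open>M\<close>, against
        \<open>noA\<close>.\<close>
      have "1 - m' * b = m * a" using * m nz[of m' b] by (simp add: field_simps)
      then have e: "m' * b + m * a = 1" by (metis add.commute diff_add_cancel)
      obtain n c d where n: "n \<in> M" "c \<in> Q" "d \<in> Q" "m' = n * c" "m = n * d" using common[of m' m] * m by blast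
      have "n * (c * b + d * a) = 1" using e n by (simp add: algebra_simps)
      moreover have "c * b + d * a \<in> A" using n * QA AD by (meson subsetD)
      ultimately show False using noA n by blast
    qed
  qed
  then have units: "inverse (1 - m * b) \<in> A" if "m \<in> M" "b \<in> A" for m b
    using that AD(1) by (auto simp: S_def inverse_eq_divide)
  \<comment> \<open>Adjoining \<open>z\<close> enlarges \<open>A\<close>, so by maximality
    \<open>A[z]\<close> no longer meets \<open>L\<close> in \<open>Q\<close>, and \<open>ext\<close>
    provides an element of \<open>M\<close> that has become a unit.\<close>
  have adj: "\<exists>n. unital_expr A M z n" if z: "z \<notin> A" for z
  proof -
    define W where "W = {poly p z | p. \<forall>i. coeff p i \<in> A}"
    have "subring_set W" unfolding W_def by (rule adjoin_subring_set[OF A(1)])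
    moreover have AX: "A \<subseteq> W"
    proof
      fix a assume "a \<in> A"
      then show "a \<in> W" unfolding W_def using AD(2) by (auto intro!: exI[of _ "[:a:]"] simp: coeff_pCons split: nat.splits)
    qed
    moreover have "z \<in> W" unfolding W_def using AD(1,2) by (auto intro!: exI[of _ "[:0,1:]"] simp: coeff_pCons split: nat.splits)
    ultimately have "W \<inter> L \<noteq> Q" using max[of W] z by blast
    then obtain m where m: "m \<in> M" "m \<noteq> 0" "inverse m \<in> W" using ext[of W] AX QA by blast
    then obtain p where "inverse m = poly p z" "\<forall>i. coeff p i \<in> A" unfolding W_def by blast
    then have "unital_expr A M z (degree p)" unfolding unital_expr_def using m
      by (intro bexI[of _ m] exI[of _ p]) (auto simp: field_simps)
    then show ?thesis ..
  qed
  have "val_ring UNIV A"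
    unfolding val_ring_def
  proof safe
    fix z assume z: "inverse z \<notin> A"
    show "z \<in> A"
    proof (rule ccontr)
      assume "z \<notin> A"
      then show False using z adj[of z] adj[of "inverse z"] not_both_unital_expr[OF A(1) MA units nz, of z] AD(2)
        by (metis)
    qed
  qed (use A in auto)
  then show ?thesis using A by blast
qed

subsection \<open>Conjugacy of the extensions under a finite group\<close>

text \<open>Given finitely many valuation rings, some \<open>e\<close> below avoids the maximal ideal of each of them that
  contains \<open>x\<close>, and \<open>e\<^sup>-\<^sup>1\<close> lies in each of the others. This makes \<open>(1 + x e)\<^sup>-\<^sup>1\<close> the common denominator
  in \<open>val_rings_common_denominator\<close>.\<close>

inductive_set unit_exprs :: "'a::comm_ring_1 \<Rightarrow> 'a set" for x where
  one: "1 \<in> unit_exprs x"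
| mult: "e \<in> unit_exprs x \<Longrightarrow> e' \<in> unit_exprs x \<Longrightarrow> e * e' \<in> unit_exprs x"
| step: "e \<in> unit_exprs x \<Longrightarrow> 1 + x * e \<in> unit_exprs x"

lemma unit_exprs_subset: "e \<in> unit_exprs x \<Longrightarrow> subring_set A \<Longrightarrow> x \<in> A \<Longrightarrow> e \<in> A"
  by (induction rule: unit_exprs.induct) (auto intro: subring_setD)

text \<open>As \<open>inverse x\<close> is a nonunit, so is \<open>inverse e * inverse x\<close>,
  and \<open>1 + x * e\<close> is \<open>x * e\<close> times the unit
  \<open>1 + inverse e * inverse x\<close>.\<close>

lemma unit_exprs_outside_step:
  assumes V: "val_ring K V" "subfield_set K" and x: "x \<in> K" "x \<notin> V"
    and e: "e \<noteq> 0" "inverse e \<in> V"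
  shows "1 + x * e \<noteq> 0" "inverse (1 + x * e) \<in> V" "inverse (1 + x * e) * x \<in> V"
proof -
  have sV: "subring_set V" using V by (auto simp: val_ring_def)
  have w: "x \<noteq> 0" "inverse x \<in> nonunits V" using outside_val_ring[OF V(1) x] by auto
  have n: "inverse e * inverse x \<in> nonunits V" using nonunits_mult[OF sV e(2) w(2)] .
  have u: "1 + inverse e * inverse x \<noteq> 0" "inverse (1 + inverse e * inverse x) \<in> V"
    using not_nonunit one_plus_nonunit[OF V n] by auto
  have eq: "1 + x * e = x * e * (1 + inverse e * inverse x)"
    using w e by (simp add: field_simps)
  show "1 + x * e \<noteq> 0" using w(1) e(1) u(1) by (simp add: eq)
  have v: "inverse e * inverse (1 + inverse e * inverse x) \<in> V"
    using e u subring_setD(6)[OF sV] by blast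
  also have "inverse e * inverse (1 + inverse e * inverse x) = inverse (1 + x * e) * x"
    using w(1) by (simp add: eq)
  finally show *: "inverse (1 + x * e) * x \<in> V" .
  have "inverse x \<in> V" using w(2) nonunits_subset by auto
  then have "inverse (1 + x * e) * x * inverse x \<in> V" using * subring_setD(6)[OF sV] by blast
  then show "inverse (1 + x * e) \<in> V" using w(1) by (simp add: mult.assoc del: inverse_mult_distrib)
qed

lemma unit_exprs_outside:
  assumes V: "val_ring K V" "subfield_set K" and x: "x \<in> K" "x \<notin> V" and "e \<in> unit_exprs x"
  shows "e \<noteq> 0 \<and> inverse e \<in> V"
  using assms(5)
proof (induction rule: unit_exprs.induct)
  case (step e)
  then show ?case using unit_exprs_outside_step[OF V x] by blast
qed (use V subring_setD[OF val_ring_subring[OF V(1)]] in auto)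

lemma val_rings_common_denominator:
  assumes K: "subfield_set K" and fin: "finite VV" and VV: "\<And>V. V \<in> VV \<Longrightarrow> val_ring K V" and x: "x \<in> K"
  shows "\<exists>s\<in>K. \<forall>V\<in>VV. s \<in> V \<and> s * x \<in> V \<and> (x \<in> V \<longrightarrow> s \<notin> nonunits V)"
proof -
  define h where "h V = (if \<exists>e\<in>unit_exprs x. e \<in> nonunits V then SOME e. e \<in> unit_exprs x \<and> e \<in> nonunits V else 1)" for V
  have h: "h V \<in> unit_exprs x" "(\<exists>e\<in>unit_exprs x. e \<in> nonunits V) \<Longrightarrow> h V \<in> nonunits V" for V
  proof -
    show 1: "h V \<in> nonunits V" if "\<exists>e\<in>unit_exprs x. e \<in> nonunits V"
      using someI_ex[of "\<lambda>e. e \<in> unit_exprs x \<and> e \<in> nonunits V"] that by (auto simp: h_def)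
    show "h V \<in> unit_exprs x"
      using someI_ex[of "\<lambda>e. e \<in> unit_exprs x \<and> e \<in> nonunits V"] by (auto simp: h_def intro: unit_exprs.one)
  qed
  \<comment> \<open>If \<open>V\<close> contains \<open>x\<close> and some expression is a nonunit
    of \<open>V\<close>, the product \<open>e\<close> is a nonunit, so \<open>1 + x * e\<close> is a
    unit. For the other \<open>V\<close> containing \<open>x\<close> no expression is a nonunit, in
    particular not \<open>1 + x * e\<close>.\<close>
  define e where "e = prod h VV"
  have eU: "e \<in> unit_exprs x" unfolding e_def using fin
    by (induction VV rule: finite_induct) (auto intro: unit_exprs.intros h)
  define s where "s = inverse (1 + x * e)"
  have sK: "s \<in> K" unfolding s_def
    using K x unit_exprs_subset[OF unit_exprs.step[OF eU]] by (auto simp: subfield_set_def)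
  moreover have "s \<in> V \<and> s * x \<in> V \<and> (x \<in> V \<longrightarrow> s \<notin> nonunits V)" if V: "V \<in> VV" for V
  proof (cases "x \<in> V")
    case False
    then show ?thesis
      using unit_exprs_outside_step[OF VV[OF V] K x False] unit_exprs_outside[OF VV[OF V] K x False eU]
      unfolding s_def by auto
  next
    case True
    have vV: "val_ring K V" using VV V by auto
    have sV: "subring_set V" using VV[OF V] by (rule val_ring_subring)
    have fV: "1 + x * e \<in> V" using unit_exprs_subset[OF unit_exprs.step[OF eU] sV True] .
    have "1 + x * e \<notin> nonunits V"
    proof (cases "\<exists>e\<in>unit_exprs x. e \<in> nonunits V")
      case ex: True
      have "(\<Prod>W\<in>VV - {V}. h W) \<in> V"
        using h unit_exprs_subset sV True by (intro subring_set_prod sV) blast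
      then have "x * (\<Prod>W\<in>VV - {V}. h W) * h V \<in> nonunits V"
        using nonunits_mult[OF sV] h(2)[OF ex] True subring_setD(6)[OF sV] by blast
      also have "x * (\<Prod>W\<in>VV - {V}. h W) * h V = x * e"
        unfolding e_def using fin V by (subst prod.remove[of VV V]) (auto simp: mult_ac)
      finally show ?thesis using one_plus_nonunit[OF vV K] by blast
    next
      case False
      then show ?thesis using unit_exprs.step[OF eU] by blast
    qed
    then have "1 + x * e \<noteq> 0" "s \<in> V" using fV not_nonunit unfolding s_def by auto
    then show ?thesis using True fV subring_setD(6)[OF sV] by (auto simp: s_def nonunits_def)
  qed
  ultimately show ?thesis by blast
qed

section \<open>Prime ideals and prime avoidance\<close>

definition prime_in :: "'a::comm_ring_1 set \<Rightarrow> 'a set \<Rightarrow> bool" where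
  "prime_in B p \<longleftrightarrow> p \<subseteq> B \<and> 0 \<in> p \<and> (\<forall>x\<in>p. \<forall>y\<in>p. x - y \<in> p) \<and> (\<forall>b\<in>B. \<forall>x\<in>p. b * x \<in> p) \<and>
     1 \<notin> p \<and> (\<forall>x\<in>B. \<forall>y\<in>B. x * y \<in> p \<longrightarrow> x \<in> p \<or> y \<in> p)"

lemma prime_in_prod:
  assumes "prime_in B p" "subring_set B" "finite J" "\<And>j. j \<in> J \<Longrightarrow> h j \<in> B - p"
  shows "prod h J \<in> B - p"
  using assms(3,4)
proof (induction J rule: finite_induct)
  case empty
  then show ?case using assms(1,2) by (auto simp: prime_in_def subring_set_def)
next
  case (insert j J)
  have "h j \<in> B - p" "prod h J \<in> B - p" using insert by auto
  then show ?case using insert.hyps assms(1,2) by (auto simp: prime_in_def subring_set_def)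
qed

text \<open>Induction on the set of primes. A prime contained in another one may be dropped.
  Otherwise an element \<open>z\<close> that avoids all primes but \<open>p\<close> is corrected, if
  it lies in \<open>p\<close>, by some \<open>w\<close> of \<open>I\<close> that lies in all the
  other primes but not in \<open>p\<close>.\<close>

lemma prime_avoidance:
  assumes B: "subring_set B" and I: "I \<subseteq> B" "0 \<in> I" "\<And>x y. x \<in> I \<Longrightarrow> y \<in> I \<Longrightarrow> x + y \<in> I"
      "\<And>b x. b \<in> B \<Longrightarrow> x \<in> I \<Longrightarrow> b * x \<in> I"
    and "finite PP" "\<And>p. p \<in> PP \<Longrightarrow> prime_in B p" "\<And>p. p \<in> PP \<Longrightarrow> \<not> I \<subseteq> p"
  shows "\<exists>z\<in>I. \<forall>p\<in>PP. z \<notin> p"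
  using assms(6-)
proof (induction PP rule: finite_psubset_induct)
  case (psubset PP)
  show ?case
  proof (cases "\<exists>p\<in>PP. \<exists>q\<in>PP. q \<noteq> p \<and> q \<subseteq> p")
    case True
    then obtain p q where pq: "p \<in> PP" "q \<in> PP" "q \<noteq> p" "q \<subseteq> p" by blast
    have "\<exists>z\<in>I. \<forall>p\<in>PP - {q}. z \<notin> p"
      using pq psubset.prems by (intro psubset.IH) auto
    then show ?thesis using pq by blast
  next
    case inc: False
    show ?thesis
    proof (cases "PP = {}")
      case True
      then show ?thesis using I by auto
    next
      case False
      then obtain p where p: "p \<in> PP" by blast
      have "\<exists>z\<in>I. \<forall>q\<in>PP - {p}. z \<notin> q"
        using p psubset.prems by (intro psubset.IH) auto
      then obtain z where z: "z \<in> I" "\<And>q. q \<in> PP - {p} \<Longrightarrow> z \<notin> q" by blast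
      show ?thesis
      proof (cases "z \<in> p")
        case True
        have "\<forall>q\<in>PP - {p}. \<exists>t. t \<in> q - p" using inc p by blast
        then obtain t where t: "\<And>q. q \<in> PP - {p} \<Longrightarrow> t q \<in> q - p" by metis
        have tB: "t q \<in> B - p" if "q \<in> PP - {p}" for q
          using t[OF that] psubset.prems(1)[of q] that by (auto simp: prime_in_def)
        obtain b where b: "b \<in> I" "b \<notin> p" using psubset.prems(2)[OF p] by blast
        have pp: "prime_in B p" using psubset.prems(1) p by blast
        define w where "w = b * prod t (PP - {p})"
        have tp: "prod t (PP - {p}) \<in> B - p"
          using psubset.hyps tB by (intro prime_in_prod[OF pp B]) auto
        have wI: "w \<in> I" using I(4)[of "prod t (PP - {p})" b] tp b by (auto simp: w_def mult.commute)
        have wp: "w \<notin> p" unfolding w_def using tp b I(1) pp by (auto simp: prime_in_def)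
        have wq: "w \<in> q" if q: "q \<in> PP - {p}" for q
        proof -
          have "prod t (PP - {p} - {q}) \<in> B" using tB B by (intro subring_set_prod) auto
          moreover have "w = (b * prod t (PP - {p} - {q})) * t q"
            unfolding w_def using q psubset.hyps by (subst prod.remove[of _ q]) (auto simp: mult_ac)
          moreover have "b \<in> B" using b I(1) by blast
          moreover have "prime_in B q" using psubset.prems(1)[of q] q by blast
          moreover have "t q \<in> q" using t[OF q] by blast
          ultimately show ?thesis using subring_setD(6)[OF B] unfolding prime_in_def by metis
        qed
        have "z + w \<in> I" using z wI I by blast
        moreover have "z + w \<notin> p"
        proof
          assume "z + w \<in> p"
          then have "z + w - z \<in> p" using True pp unfolding prime_in_def by blast
          then show False using wp by simp
        qed
        moreover have "z + w \<notin> q" if q: "q \<in> PP - {p}" for q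
        proof
          assume "z + w \<in> q"
          then have "z + w - w \<in> q" using wq[OF q] psubset.prems(1)[of q] q unfolding prime_in_def by blast
          then show False using z q by simp
        qed
        ultimately show ?thesis by blast
      next
        case False
        then show ?thesis using z by blast
      qed
    qed
  qed
qed

section \<open>Finite groups acting on a field\<close>

locale finite_action =
  fixes K :: "'a::field set" and S :: "('a \<Rightarrow> 'a) set"
  assumes K: "subfield_set K" and finite_S: "finite S" and ext: "\<sigma> \<in> S \<Longrightarrow> \<sigma> \<in> extensional K"
    and closed: "\<sigma> \<in> S \<Longrightarrow> x \<in> K \<Longrightarrow> \<sigma> x \<in> K"
    and add: "\<sigma> \<in> S \<Longrightarrow> x \<in> K \<Longrightarrow> y \<in> K \<Longrightarrow> \<sigma> (x + y) = \<sigma> x + \<sigma> y"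
    and mult: "\<sigma> \<in> S \<Longrightarrow> x \<in> K \<Longrightarrow> y \<in> K \<Longrightarrow> \<sigma> (x * y) = \<sigma> x * \<sigma> y"
    and one: "\<sigma> \<in> S \<Longrightarrow> \<sigma> 1 = 1"
    and comp: "\<sigma> \<in> S \<Longrightarrow> \<tau> \<in> S \<Longrightarrow> compose K \<sigma> \<tau> \<in> S"
    and ident: "restrict id K \<in> S"
begin

lemma sK: "subring_set K"
  using K by (simp add: subfield_set_def)

lemmas KD = subring_setD[OF sK]

lemma inv_closed: "x \<in> K \<Longrightarrow> inverse x \<in> K"
  using K by (auto simp: subfield_set_def)

lemma zero: "\<sigma> \<in> S \<Longrightarrow> \<sigma> 0 = 0"
  using add[of \<sigma> 0 0] KD(2) by (metis add.right_neutral add_left_cancel)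

lemma diff: "\<sigma> \<in> S \<Longrightarrow> x \<in> K \<Longrightarrow> y \<in> K \<Longrightarrow> \<sigma> (x - y) = \<sigma> x - \<sigma> y"
  using add[of \<sigma> "x - y" y] KD(3)[of x y] by (auto simp: algebra_simps)

lemma inverse: "\<sigma> \<in> S \<Longrightarrow> x \<in> K \<Longrightarrow> \<sigma> (inverse x) = inverse (\<sigma> x)"
  by (metis inv_closed inverse_unique inverse_zero mult one right_inverse zero)

lemma eq_0: "\<sigma> \<in> S \<Longrightarrow> x \<in> K \<Longrightarrow> \<sigma> x = 0 \<longleftrightarrow> x = 0"
  by (metis inv_closed mult mult_zero_left one right_inverse zero zero_neq_one)

lemma inj: "\<sigma> \<in> S \<Longrightarrow> inj_on \<sigma> K"
proof (rule inj_onI)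
  fix x y assume *: "\<sigma> \<in> S" "x \<in> K" "y \<in> K" "\<sigma> x = \<sigma> y"
  then have "\<sigma> (x - y) = 0" by (subst diff) auto
  then show "x = y" using eq_0[OF *(1) KD(3)[OF *(2,3)]] by simp
qed

lemma prod: "\<sigma> \<in> S \<Longrightarrow> (\<And>i. i \<in> J \<Longrightarrow> h i \<in> K) \<Longrightarrow> \<sigma> (prod h J) = (\<Prod>i\<in>J. \<sigma> (h i))"
  by (induction J rule: infinite_finite_induct) (auto simp: one mult subring_set_prod[OF sK])

text \<open>Extensionality turns agreement on \<open>K\<close> into equality of maps. Together with
  the finiteness of \<open>S\<close> this yields inverses within \<open>S\<close>.\<close>

lemma translation_inj: "\<sigma> \<in> S \<Longrightarrow> inj_on (compose K \<sigma>) S"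
proof (rule inj_onI, rule extensionalityI[of _ K])
  fix \<tau> \<rho> x assume *: "\<sigma> \<in> S" "\<tau> \<in> S" "\<rho> \<in> S" "compose K \<sigma> \<tau> = compose K \<sigma> \<rho>" "x \<in> K"
  then have "\<sigma> (\<tau> x) = \<sigma> (\<rho> x)" by (metis compose_eq)
  then show "\<tau> x = \<rho> x" using * inj[of \<sigma>] closed by (auto simp: inj_on_def)
qed (auto intro: ext)

lemma translation_bij: "\<sigma> \<in> S \<Longrightarrow> bij_betw (compose K \<sigma>) S S"
  using translation_inj finite_S comp
  by (metis bij_betw_def endo_inj_surj image_subsetI)

lemma ex_inverse: "\<sigma> \<in> S \<Longrightarrow> \<exists>\<tau>\<in>S. \<forall>x\<in>K. \<sigma> (\<tau> x) = x"
proof -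
  assume s: "\<sigma> \<in> S"
  then have "restrict id K \<in> compose K \<sigma> ` S" using translation_bij ident by (auto simp: bij_betw_def)
  then obtain \<tau> where "\<tau> \<in> S" "restrict id K = compose K \<sigma> \<tau>" by blast
  then have "\<forall>x\<in>K. \<sigma> (\<tau> x) = x" by (metis compose_eq id_apply restrict_apply')
  then show ?thesis using \<open>\<tau> \<in> S\<close> by blast
qed

definition fixed :: "'a set" where "fixed = {z \<in> K. \<forall>\<sigma>\<in>S. \<sigma> z = z}"

text \<open>An inverse image, hence a right action on valuation rings; automorphisms of a curve move
  its points in the same way.\<close>

definition pull :: "('a \<Rightarrow> 'a) \<Rightarrow> 'a set \<Rightarrow> 'a set" where "pull \<sigma> V = {z \<in> K. \<sigma> z \<in> V}"

lemma fixed_subfield: "subfield_set fixed"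
  unfolding subfield_set_def subring_set_def fixed_def
  by (auto simp: one KD diff mult inverse inv_closed)

lemma norm_fixed:
  assumes "z \<in> K" shows "(\<Prod>\<sigma>\<in>S. \<sigma> z) \<in> fixed"
proof -
  have "\<tau> (\<Prod>\<sigma>\<in>S. \<sigma> z) = (\<Prod>\<sigma>\<in>S. \<sigma> z)" if t: "\<tau> \<in> S" for \<tau>
  proof -
    have "\<tau> (\<Prod>\<sigma>\<in>S. \<sigma> z) = (\<Prod>\<sigma>\<in>S. compose K \<tau> \<sigma> z)"
      using assms t by (subst prod) (auto simp: closed compose_eq)
    also have "\<dots> = (\<Prod>\<sigma>\<in>S. \<sigma> z)"
      using prod.reindex_bij_betw[OF translation_bij[OF t], of "\<lambda>\<sigma>. \<sigma> z"] .
    finally show ?thesis .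
  qed
  moreover have "(\<Prod>\<sigma>\<in>S. \<sigma> z) \<in> K" by (rule subring_set_prod[OF sK]) (rule closed[OF _ assms])
  ultimately show ?thesis by (auto simp: fixed_def)
qed

lemma pull_val_ring: "\<sigma> \<in> S \<Longrightarrow> val_ring K V \<Longrightarrow> val_ring K (pull \<sigma> V)"
  unfolding val_ring_def subring_set_def pull_def
  by (auto simp: one KD diff mult inverse inv_closed closed)

lemma nonunits_pull: "\<sigma> \<in> S \<Longrightarrow> nonunits (pull \<sigma> V) = pull \<sigma> (nonunits V)"
  by (auto simp: nonunits_def pull_def inverse inv_closed eq_0)

lemma pull_pull: "pull \<sigma> (pull \<tau> V) = pull (compose K \<tau> \<sigma>) V" if "\<sigma> \<in> S"
  using that by (auto simp: pull_def closed compose_eq)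

lemma pull_restrict_id: "V \<subseteq> K \<Longrightarrow> pull (restrict id K) V = V"
  by (auto simp: pull_def)

lemma pull_mono: "V \<subseteq> W \<Longrightarrow> pull \<sigma> V \<subseteq> pull \<sigma> W"
  by (auto simp: pull_def)

text \<open>The norm of a nonunit of \<open>W\<close> lies in the fixed field, hence is a nonunit of \<open>V\<close>; so a conjugate of
  the element is one, and prime avoidance makes the conjugation uniform.\<close>

lemma pull_contained:
  assumes V: "val_ring K V" and W: "val_ring K W" and same: "V \<inter> fixed = W \<inter> fixed"
  shows "\<exists>\<sigma>\<in>S. pull \<sigma> V \<subseteq> W"
proof -
  \<comment> \<open>The intersection \<open>B\<close> of all conjugates of \<open>V\<close> and
    \<open>W\<close> is a common ground: each of their maximal ideals cuts out a prime of
    \<open>B\<close>.\<close>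
  define VV where "VV = (\<lambda>\<sigma>. pull \<sigma> V) ` S \<union> (\<lambda>\<sigma>. pull \<sigma> W) ` S"
  define B where "B = \<Inter>VV"
  have VVv: "val_ring K U" if "U \<in> VV" for U using that V W pull_val_ring by (auto simp: VV_def)
  have finVV: "finite VV" using finite_S by (auto simp: VV_def)
  have WVV: "W \<in> VV" using ident pull_restrict_id[OF val_ring_subset[OF W]] unfolding VV_def by (metis UnI2 image_eqI)
  have BK: "B \<subseteq> K" using val_ring_subset[OF W] WVV by (auto simp: B_def)
  have sB: "subring_set B" unfolding B_def subring_set_def
    using VVv val_ring_subring unfolding subring_set_def by blast
  have prim: "prime_in B (B \<inter> nonunits U)" if U: "U \<in> VV" for U
  proof -
    have vU: "val_ring K U" using VVv[OF U] .
    have sU: "subring_set U" using vU by (rule val_ring_subring)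
    have BU: "B \<subseteq> U" using U by (auto simp: B_def)
    have "x - y \<in> nonunits U" if "x \<in> nonunits U" "y \<in> nonunits U" for x y
      using nonunits_add[OF vU K that(1), of "- y"] nonunits_mult[OF sU _ that(2), of "-1"] subring_setD(1,4)[OF sU] by auto
    then show ?thesis unfolding prime_in_def
      using subring_setD[OF sB] zero_nonunit[OF sU] one_not_nonunit[OF subring_setD(1)[OF sU]] nonunits_mult[OF sU] nonunits_prime[OF sU] BU
      by (auto simp: subset_iff)
  qed
  define PP where "PP = (\<lambda>\<sigma>. B \<inter> nonunits (pull \<sigma> V)) ` S"
  define I where "I = B \<inter> nonunits W"
  have "\<exists>p\<in>PP. I \<subseteq> p"
  proof (rule ccontr)
    assume "\<not> (\<exists>p\<in>PP. I \<subseteq> p)"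
    moreover have "0 \<in> I" "I \<subseteq> B" "\<And>b x. b \<in> B \<Longrightarrow> x \<in> I \<Longrightarrow> b * x \<in> I" 
      using prim[OF WVV] by (auto simp: I_def prime_in_def)
    moreover have "x + y \<in> I" if "x \<in> I" "y \<in> I" for x y
      using that nonunits_add[OF W K] subring_setD(5)[OF sB] by (auto simp: I_def)
    moreover have "finite PP" using finite_S by (auto simp: PP_def)
    moreover have "prime_in B p" if "p \<in> PP" for p using that prim by (auto simp: PP_def VV_def)
    ultimately obtain z where z: "z \<in> I" "\<forall>p\<in>PP. z \<notin> p" using prime_avoidance[OF sB, of I PP] by blast
    have zB: "z \<in> B" "z \<in> K" using z BK by (auto simp: I_def)
    define N where "N = (\<Prod>\<sigma>\<in>S. \<sigma> z)"
    have NF: "N \<in> fixed" unfolding N_def by (rule norm_fixed[OF zB(2)])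
    have zs: "\<sigma> z \<in> V" "\<sigma> z \<in> W" if "\<sigma> \<in> S" for \<sigma>
    proof -
      have "z \<in> pull \<sigma> V" "z \<in> pull \<sigma> W" using zB(1) that by (auto simp: B_def VV_def)
      then show "\<sigma> z \<in> V" "\<sigma> z \<in> W" by (auto simp: pull_def)
    qed
    have "N \<in> nonunits W"
    proof -
      have "(\<Prod>\<sigma>\<in>S - {restrict id K}. \<sigma> z) \<in> W"
        using zs by (intro subring_set_prod val_ring_subring[OF W]) auto
      moreover have "N = (\<Prod>\<sigma>\<in>S - {restrict id K}. \<sigma> z) * z"
        unfolding N_def using finite_S ident zB(2) by (subst prod.remove[of _ "restrict id K"]) (auto simp: mult.commute)
      ultimately show ?thesis using nonunits_mult[OF val_ring_subring[OF W]] z(1) by (auto simp: I_def)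
    qed
    then have "N \<in> nonunits (W \<inter> fixed)" using NF nonunits_Int[OF fixed_subfield] by blast
    then have "N \<in> nonunits V" using same nonunits_Int[OF fixed_subfield] by (metis IntE)
    then obtain \<sigma> where s: "\<sigma> \<in> S" "\<sigma> z \<in> nonunits V"
      using nonunits_prod_prime[OF val_ring_subring[OF V] finite_S, of "\<lambda>\<sigma>. \<sigma> z"] zs by (auto simp: N_def)
    then have "z \<in> B \<inter> nonunits (pull \<sigma> V)" using zB nonunits_pull by (auto simp: pull_def)
    then show False using z(2) s by (auto simp: PP_def)
  qed
  then obtain \<sigma> where s: "\<sigma> \<in> S" "I \<subseteq> nonunits (pull \<sigma> V)" by (auto simp: PP_def)
  \<comment> \<open>Inclusion of the primes of \<open>B\<close> becomes inclusion of the rings: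
    \<open>x\<close> is \<open>s * x\<close> divided by \<open>s\<close>, and since \<open>s\<close>
    is not a nonunit of \<open>pull \<sigma> V\<close>, it is a unit of \<open>W\<close>.\<close>
  have "pull \<sigma> V \<subseteq> W"
  proof
    fix x assume x: "x \<in> pull \<sigma> V"
    then have "x \<in> K" by (auto simp: pull_def)
    then obtain s where s': "s \<in> K" "\<And>U. U \<in> VV \<Longrightarrow> s \<in> U \<and> s * x \<in> U \<and> (x \<in> U \<longrightarrow> s \<notin> nonunits U)"
      using val_rings_common_denominator[OF K finVV VVv, of x] by blast
    have "pull \<sigma> V \<in> VV" using s by (auto simp: VV_def)
    then have "s \<notin> nonunits (pull \<sigma> V)" using s'(2) x by blast
    moreover have "s \<in> B" using s' by (auto simp: B_def)
    ultimately have "s \<notin> nonunits W" using s(2) by (auto simp: I_def)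
    moreover have "s \<in> W" "s * x \<in> W" using s'(2)[OF WVV] by auto
    ultimately have "s \<noteq> 0" "inverse s \<in> W" using not_nonunit by auto
    then have "inverse s * (s * x) \<in> W" using \<open>s * x \<in> W\<close> subring_setD(6)[OF val_ring_subring[OF W]] by blast
    then show "x \<in> W" using \<open>s \<noteq> 0\<close> by (simp flip: mult.assoc)
  qed
  then show ?thesis using s by blast
qed

text \<open>The inclusion says that \<open>\<rho> x \<in> V\<close> implies
  \<open>x \<in> V\<close>. As \<open>\<rho>\<close> has finite order, one can start from
  \<open>\<rho>^(n+1) z = z\<close> and come down to \<open>\<rho> z\<close>.\<close>

lemma pull_eq_of_subset:
  assumes "V \<subseteq> K" "\<rho> \<in> S" "pull \<rho> V \<subseteq> V"
  shows "pull \<rho> V = V"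
proof
  show "V \<subseteq> pull \<rho> V"
  proof
    fix z assume z: "z \<in> V"
    then have zK: "z \<in> K" using assms by blast
    define q where "q n = (compose K \<rho> ^^ n) (restrict id K)" for n
    have qS: "q n \<in> S" for n 
    proof (induction n)
      case 0
      then show ?case using ident by (simp only: q_def funpow.simps id_apply)
    next
      case (Suc n)
      then show ?case using comp[OF assms(2)] by (simp add: q_def)
    qed
    have "\<not> inj q"
      using finite_S qS by (meson finite_imageD finite_subset image_subsetI infinite_UNIV_nat)
    then obtain i j where ij: "i < j" "q i = q j"
      by (metis injI linorder_neqE_nat)
    \<comment> \<open>Two powers of \<open>\<rho>\<close> coincide by finiteness; cancelling on the
      left makes one power the identity.\<close>
    have sh: "q (i + n) = q i \<Longrightarrow> q n = q 0" for i n
    proof (induction i)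
      case (Suc i)
      then have "compose K \<rho> (q (i + n)) = compose K \<rho> (q i)" by (simp add: q_def)
      then have "q (i + n) = q i" using translation_inj[OF assms(2)] qS by (auto simp: inj_on_def)
      then show ?case using Suc by auto
    qed simp
    obtain n where n: "q (Suc n) = q 0" using sh[of i "j - i"] ij
      by (metis Suc_diff_Suc add_diff_inverse_nat less_imp_le_nat linorder_not_less)
    have qz: "q n z \<in> K" for n using qS closed zK by blast
    have down: "q k z \<in> V" if "q (k + m) z \<in> V" for k m
      using that
    proof (induction m)
      case (Suc m)
      have "q (Suc (k + m)) z = \<rho> (q (k + m) z)" using zK by (simp add: q_def compose_eq)
      then have "q (k + m) z \<in> pull \<rho> V" using Suc.prems qz by (auto simp: pull_def)
      then show ?case using Suc.IH assms(3) by blast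
    qed simp
    have "q (1 + n) z \<in> V" using n z zK by (simp add: q_def)
    then have "q 1 z \<in> V" by (rule down)
    then show "z \<in> pull \<rho> V" using zK by (auto simp: q_def pull_def compose_eq)
  qed
qed (use assms in auto)

text \<open>Using \<open>pull_contained\<close> in both directions gives \<open>pull (compose K
  \<tau> \<sigma>) W \<subseteq> pull \<sigma> V \<subseteq> W\<close>, and
  \<open>pull_eq_of_subset\<close> collapses the chain.\<close>

theorem val_rings_conjugate:
  assumes V: "val_ring K V" and W: "val_ring K W" and same: "V \<inter> fixed = W \<inter> fixed"
  shows "\<exists>\<sigma>\<in>S. pull \<sigma> V = W"
proof -
  obtain \<sigma> where s: "\<sigma> \<in> S" "pull \<sigma> V \<subseteq> W" using pull_contained[OF assms] by blast
  obtain \<tau> where t: "\<tau> \<in> S" "pull \<tau> W \<subseteq> V" using pull_contained[OF W V same[symmetric]] by blast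
  have "pull \<sigma> (pull \<tau> W) \<subseteq> pull \<sigma> V" using t(2) by (rule pull_mono)
  then have *: "pull (compose K \<tau> \<sigma>) W \<subseteq> pull \<sigma> V" using pull_pull s by auto
  have "pull (compose K \<tau> \<sigma>) W = W"
    using * s comp[OF t(1) s(1)] val_ring_subset[OF W] by (intro pull_eq_of_subset) auto
  then show ?thesis using * s by blast
qed

end

section \<open>Finite groups of affine maps\<close>

definition aff_app :: "'a::field \<times> 'a \<Rightarrow> 'a \<Rightarrow> 'a" where
  "aff_app g r = fst g * r + snd g"

definition aff_poly :: "'a::field \<times> 'a \<Rightarrow> 'a poly" where
  "aff_poly g = [:snd g, fst g:]"

definition aff_mult :: "'a::field \<times> 'a \<Rightarrow> 'a \<times> 'a \<Rightarrow> 'a \<times> 'a" where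
  "aff_mult g h = (fst g * fst h, fst g * snd h + snd g)"

lemma poly_aff_poly: "poly (aff_poly g) r = aff_app g r"
  by (simp add: aff_poly_def aff_app_def)

lemma pcompose_aff_poly: "pcompose (aff_poly g) (aff_poly h) = aff_poly (aff_mult g h)"
  by (simp add: aff_poly_def aff_mult_def pcompose_pCons)

lemma aff_app_mult: "aff_app (aff_mult g h) r = aff_app g (aff_app h r)"
  by (simp add: aff_app_def aff_mult_def algebra_simps)

lemma degree_aff_poly: "fst g \<noteq> 0 \<Longrightarrow> degree (aff_poly g) = 1"
  by (simp add: aff_poly_def)

lemma aff_app_1 [simp]: "aff_app (1, 0) r = r"
  by (simp add: aff_app_def)

lemma aff_mult_1 [simp]: "aff_mult g (1, 0) = g" "aff_mult (1, 0) g = g"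
  by (simp_all add: aff_mult_def)

lemma linear_factor_aff:
  "pcompose [:- aff_app g r, 1:] (aff_poly g) = smult (fst g) [:- r, 1:]"
  by (simp add: aff_poly_def aff_app_def pcompose_pCons)

lemma pcompose_power: "pcompose (p ^ n) q = pcompose p q ^ n"
  by (induction n) (simp_all add: pcompose_mult pcompose_1)

lemma pcompose_cancel:
  fixes p q x :: "'a::idom poly"
  assumes "degree x > 0" "pcompose p x = pcompose q x"
  shows "p = q"
proof -
  have "pcompose (p - q) x = 0" using assms by (simp add: pcompose_diff)
  then show ?thesis using pcompose_eq_0 assms(1) by (metis right_minus_eq)
qed

lemma card_roots_of_unity_le:
  assumes "n > 0" shows "finite {x::'a::idom. x ^ n = 1}" "card {x::'a::idom. x ^ n = 1} \<le> n"
proof -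
  let ?p = "monom (1::'a) n - 1"
  have "coeff ?p n = 1" using assms by simp
  then have nz: "?p \<noteq> 0" by (metis coeff_0 zero_neq_one)
  have eq: "{x. poly ?p x = 0} = {x. x ^ n = 1}" by (simp add: poly_monom)
  show "finite {x::'a. x ^ n = 1}" using poly_roots_finite[OF nz] eq by simp
  have "degree ?p \<le> n"
    by (intro degree_diff_le degree_monom_le) simp
  then show "card {x::'a. x ^ n = 1} \<le> n"
    using card_poly_roots_bound[OF nz] eq by simp
qed

locale affine_group =
  fixes H :: "('a::field \<times> 'a) set"
  assumes fin: "finite H" and one: "(1, 0) \<in> H"
    and mult: "g \<in> H \<Longrightarrow> h \<in> H \<Longrightarrow> aff_mult g h \<in> H"
    and nz: "g \<in> H \<Longrightarrow> fst g \<noteq> 0"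
begin

lemma card_pos: "card H > 0"
  using fin one by (auto simp: card_gt_0_iff)

lemma left_bij: "g \<in> H \<Longrightarrow> bij_betw (aff_mult g) H H"
proof -
  assume g: "g \<in> H"
  have "inj_on (aff_mult g) H" using nz[OF g] by (auto simp: inj_on_def aff_mult_def)
  then show ?thesis using mult g fin by (metis bij_betw_def endo_inj_surj image_subsetI)
qed

lemma right_bij: "g \<in> H \<Longrightarrow> bij_betw (\<lambda>h. aff_mult h g) H H"
proof -
  assume g: "g \<in> H"
  have "inj_on (\<lambda>h. aff_mult h g) H" using nz[OF g] by (auto simp: inj_on_def aff_mult_def)
  then show ?thesis using mult g fin by (metis (no_types, lifting) bij_betw_def endo_inj_surj image_subsetI)
qed

lemma right_cancel:
  assumes "aff_mult t g \<in> H" "g \<in> H" shows "t \<in> H"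
proof -
  obtain h where h: "h \<in> H" "aff_mult h g = aff_mult t g"
    using right_bij[OF assms(2)] assms(1) unfolding bij_betw_def by (metis (no_types, lifting) imageE)
  then have "h = t" using nz[OF assms(2)] by (auto simp: aff_mult_def prod_eq_iff)
  then show ?thesis using h by simp
qed

definition xpoly :: "'a poly" where "xpoly = (\<Prod>g\<in>H. aff_poly g)"

definition orbit :: "'a \<Rightarrow> 'a set" where "orbit r = (\<lambda>g. aff_app g r) ` H"

definition stab :: "'a \<Rightarrow> ('a \<times> 'a) set" where "stab r = {g \<in> H. aff_app g r = r}"

lemma xpoly_nz: "xpoly \<noteq> 0"
  unfolding xpoly_def using fin nz by (simp add: aff_poly_def)

lemma degree_xpoly: "degree xpoly = card H"
  unfolding xpoly_def using nz degree_aff_poly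
  by (subst degree_prod_eq_sum_degree) (auto simp: aff_poly_def)

lemma lead_coeff_xpoly: "lead_coeff xpoly = (\<Prod>g\<in>H. fst g)"
  unfolding xpoly_def lead_coeff_prod using nz by (intro prod.cong) (auto simp: aff_poly_def)

lemma xpoly_invariant: "g \<in> H \<Longrightarrow> pcompose xpoly (aff_poly g) = xpoly"
  unfolding xpoly_def pcompose_prod
  using prod.reindex_bij_betw[OF right_bij, of g aff_poly] by (simp add: pcompose_aff_poly)

lemma poly_xpoly: "poly xpoly r = (\<Prod>g\<in>H. aff_app g r)"
  by (simp add: xpoly_def poly_prod poly_aff_poly)

text \<open>Considered as a polynomial in \<open>T\<close> over \<open>k[X]\<close>, the difference \<open>p(T) - p(X)\<close> vanishes at the
  distinct elements \<open>g(X)\<close>.\<close>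

lemma invariant_small_degree:
  assumes inv: "\<And>g. g \<in> H \<Longrightarrow> pcompose p (aff_poly g) = p" and deg: "degree p < card H"
  shows "\<exists>c. p = [:c:]"
proof -
  define Q where "Q = map_poly (\<lambda>x. [:x:]) p - [:p:]"
  have root: "poly Q (aff_poly g) = 0" if "g \<in> H" for g
    using inv[OF that] by (simp add: Q_def flip: pcompose_altdef)
  have "degree Q \<le> degree p"
    unfolding Q_def by (intro degree_diff_le map_poly_degree_leq) auto
  moreover have "inj_on aff_poly H" by (auto simp: inj_on_def aff_poly_def)
  moreover have "card (aff_poly ` H) \<le> degree Q" if "Q \<noteq> 0"
  proof -
    have "aff_poly ` H \<subseteq> {x. poly Q x = 0}" using root by blast
    then show ?thesis using card_poly_roots_bound[OF that] poly_roots_finite[OF that] card_mono by (meson le_trans)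
  qed
  ultimately have "Q = 0" using deg by (auto simp: card_image)
  then have "coeff Q 0 = 0" by simp
  then have "p = [:coeff p 0:]" by (simp add: Q_def coeff_map_poly)
  then show ?thesis by blast
qed

lemma degree_pcompose_aff: "g \<in> H \<Longrightarrow> degree (pcompose p (aff_poly g)) = degree p"
  using nz[of g] by (simp add: degree_aff_poly degree_pcompose)

lemma invariant_imp_pcompose:
  assumes "\<And>g. g \<in> H \<Longrightarrow> pcompose p (aff_poly g) = p"
  shows "\<exists>q. p = pcompose q xpoly"
  using assms
proof (induction "degree p" arbitrary: p rule: less_induct)
  case less
  define d r where "d = p div xpoly" and "r = p mod xpoly"
  have p: "p = d * xpoly + r" by (simp add: d_def r_def)
  have degr: "degree r < card H"
    unfolding r_def using degree_mod_less'[OF xpoly_nz] degree_xpoly card_pos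
    by (cases "p mod xpoly = 0") auto
  \<comment> \<open>Substitution of \<open>g\<close> turns the division of \<open>p\<close> by
    \<open>xpoly\<close> into another one, so by uniqueness quotient and remainder are
    invariant.\<close>
  have inv: "pcompose d (aff_poly g) = d \<and> pcompose r (aff_poly g) = r" if g: "g \<in> H" for g
  proof -
    have "d * xpoly + r = pcompose d (aff_poly g) * xpoly + pcompose r (aff_poly g)"
      using less.prems[OF g] p xpoly_invariant[OF g] by (metis pcompose_add pcompose_mult)
    then have e: "(pcompose d (aff_poly g) - d) * xpoly = r - pcompose r (aff_poly g)"
      by (simp add: algebra_simps)
    have "degree (r - pcompose r (aff_poly g)) < card H"
      using degr degree_pcompose_aff[OF g, of r] by (intro degree_diff_less) auto
    then have "pcompose d (aff_poly g) - d = 0"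
      using e degree_mult_eq[of "pcompose d (aff_poly g) - d" xpoly] xpoly_nz degree_xpoly
      by (cases "pcompose d (aff_poly g) - d = 0") auto
    then show ?thesis using e by simp
  qed
  obtain c where c: "r = [:c:]" using invariant_small_degree[of r] inv degr by blast
  show ?case
  proof (cases "d = 0")
    case True
    then have "p = pcompose [:c:] xpoly" using p c by simp
    then show ?thesis by blast
  next
    case False
    have "degree (d * xpoly) = degree d + card H"
      using False xpoly_nz degree_xpoly by (simp add: degree_mult_eq)
    then have "degree p = degree d + card H"
      unfolding p using degr by (subst degree_add_eq_left) auto
    then have "degree d < degree p" using card_pos by simp
    then obtain q where q: "d = pcompose q xpoly" using less.hyps[of d] inv by blast
    have "p = pcompose (pCons c q) xpoly"
      using p q c by (simp add: pcompose_pCons mult.commute add.commute)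
    then show ?thesis by blast
  qed
qed

text \<open>The product \<open>D\<close> of all \<open>X - g(r)\<close> is invariant, as composing
  with \<open>h\<close> multiplies it by \<open>fst h ^ card H = 1\<close>. Scaled to the same
  leading coefficient it differs from \<open>xpoly\<close> by an invariant of degree below
  \<open>card H\<close>, hence by a constant, which is found by evaluating at
  \<open>r\<close>.\<close>

lemma xpoly_minus_value:
  "smult (\<Prod>g\<in>H. fst g) (\<Prod>g\<in>H. [:- aff_app g r, 1:]) = xpoly - [:poly xpoly r:]"
proof -
  define A where "A = (\<Prod>g\<in>H. fst g)"
  have A0: "A \<noteq> 0" using fin nz by (auto simp: A_def)
  define D where "D = (\<Prod>g\<in>H. [:- aff_app g r, 1:])"
  have degD: "degree D = card H" unfolding D_def
    by (subst degree_prod_eq_sum_degree) auto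
  have lcD: "lead_coeff D = 1" by (simp add: D_def lead_coeff_prod)
  have Dh: "pcompose D (aff_poly h) = smult (fst h ^ card H) D" if h: "h \<in> H" for h
  proof -
    have "D = (\<Prod>g\<in>H. [:- aff_app (aff_mult h g) r, 1:])"
      unfolding D_def using prod.reindex_bij_betw[OF left_bij[OF h], of "\<lambda>g. [:- aff_app g r, 1:]"] by simp
    then have "pcompose D (aff_poly h) = (\<Prod>g\<in>H. smult (fst h) [:- aff_app g r, 1:])"
      by (simp add: pcompose_prod aff_app_mult linear_factor_aff del: smult_pCons)
    also have "\<dots> = smult (fst h ^ card H) D" by (simp add: D_def prod_smult del: smult_pCons)
    finally show ?thesis .
  qed
  have pow1: "fst h ^ card H = 1" if h: "h \<in> H" for h
  proof -
    have "(\<Prod>g\<in>H. fst g) = (\<Prod>g\<in>H. fst (aff_mult h g))"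
      using prod.reindex_bij_betw[OF left_bij[OF h], of fst] by simp
    then have "A = fst h ^ card H * A" by (simp add: A_def aff_mult_def prod.distrib)
    then show ?thesis using A0 by simp
  qed
  define E where "E = xpoly - smult A D"
  have "degree E \<le> card H"
    unfolding E_def using degree_xpoly degD by (intro degree_diff_le) auto
  moreover have "coeff E (card H) = 0"
    using lead_coeff_xpoly lcD degD degree_xpoly by (simp add: E_def A_def)
  ultimately have "degree E < card H"
    using card_pos eq_zero_or_degree_less[of E "card H"] by auto
  moreover have "pcompose E (aff_poly g) = E" if "g \<in> H" for g
    unfolding E_def using that Dh pow1 by (simp add: pcompose_diff pcompose_smult xpoly_invariant)
  ultimately obtain c where c: "E = [:c:]" using invariant_small_degree[of E] by blast
  have "poly D r = 0" unfolding D_def poly_prod using fin one by (auto intro!: bexI[of _ "(1,0)"])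
  then have "c = poly xpoly r" using arg_cong[OF c, of "\<lambda>p. poly p r"] by (simp add: E_def)
  then show ?thesis using c by (simp add: E_def A_def D_def algebra_simps)
qed

text \<open>The fibre over \<open>aff_app h r\<close> is the coset of \<open>stab r\<close> by
  \<open>h\<close>.\<close>

lemma card_fibre:
  assumes s: "s \<in> orbit r" shows "card {g \<in> H. aff_app g r = s} = card (stab r)"
proof -
  obtain h where h: "h \<in> H" "s = aff_app h r" using s by (auto simp: orbit_def)
  have "{g \<in> H. aff_app g r = s} = aff_mult h ` stab r"
  proof safe
    fix a b assume g: "(a, b) \<in> H" "s = aff_app (a, b) r"
    obtain k where k: "k \<in> H" "aff_mult h k = (a, b)"
      using left_bij[OF h(1)] g(1) unfolding bij_betw_def by (metis (no_types, lifting) imageE)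
    then have "aff_app h (aff_app k r) = aff_app h r" using g h by (metis aff_app_mult)
    then have "aff_app k r = r" using nz[OF h(1)] by (simp add: aff_app_def)
    then show "(a, b) \<in> aff_mult h ` stab r" using k by (intro image_eqI[of _ _ k]) (simp_all add: stab_def)
  qed (use h mult in \<open>auto simp: stab_def aff_app_mult\<close>)
  moreover have "inj_on (aff_mult h) (stab r)"
    using left_bij[OF h(1)] by (auto simp: bij_betw_def stab_def inj_on_def)
  ultimately show ?thesis by (simp add: card_image)
qed

lemma prod_orbit: "(\<Prod>g\<in>H. \<phi> (aff_app g r)) = (\<Prod>s\<in>orbit r. \<phi> s ^ card (stab r))"
  unfolding prod.image_gen[OF fin, of "\<lambda>g. \<phi> (aff_app g r)" "\<lambda>g. aff_app g r"] orbit_def[symmetric]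
proof (rule prod.cong)
  fix s assume s: "s \<in> orbit r"
  have "(\<Prod>g\<in>{g \<in> H. aff_app g r = s}. \<phi> (aff_app g r)) = (\<Prod>g\<in>{g \<in> H. aff_app g r = s}. \<phi> s)"
    by (intro prod.cong) auto
  then show "(\<Prod>g\<in>{g \<in> H. aff_app g r = s}. \<phi> (aff_app g r)) = \<phi> s ^ card (stab r)"
    using card_fibre[OF s] by simp
qed simp

lemma card_orbit: "card H = card (orbit r) * card (stab r)"
proof -
  have "card H = (\<Sum>s\<in>orbit r. card {g \<in> H. aff_app g r = s})"
    unfolding orbit_def using sum.image_gen[OF fin, of "\<lambda>_. 1::nat" "\<lambda>g. aff_app g r"] by simp
  then show ?thesis using card_fibre by simp
qed

lemma stab_group: "affine_group (stab r)"
  using fin one mult nz by unfold_locales (auto simp: stab_def aff_app_mult)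

lemma orbit_eq: "s \<in> orbit r \<Longrightarrow> orbit s = orbit r"
proof -
  assume "s \<in> orbit r"
  then obtain h where h: "h \<in> H" "s = aff_app h r" by (auto simp: orbit_def)
  have "orbit s = (\<lambda>g. aff_app g r) ` ((\<lambda>g. aff_mult g h) ` H)"
    by (simp add: orbit_def h image_image aff_app_mult)
  then show ?thesis using right_bij[OF h(1)] by (simp add: bij_betw_def orbit_def)
qed

lemma orbit_self: "r \<in> orbit r"
  unfolding orbit_def by (rule image_eqI[OF _ one]) simp

lemma finite_orbit: "finite (orbit r)"
  using fin by (simp add: orbit_def)

lemma xpoly_minus_orbit:
  "smult (\<Prod>g\<in>H. fst g) ((\<Prod>s\<in>orbit r. [:- s, 1:]) ^ card (stab r)) = xpoly - [:(\<Prod>s\<in>orbit r. s) ^ card (stab r):]"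
  using xpoly_minus_value[of r] prod_orbit[of "\<lambda>s. [:- s, 1:]" r] prod_orbit[of "\<lambda>s. s" r]
  by (simp add: poly_xpoly prod_power_distrib)

end

text \<open>Let \<open>A\<close> be the product. Evaluate \<open>xpoly_minus_value\<close> at 0,
  where \<open>xpoly\<close> vanishes because the identity contributes the factor X: this gives
  \<open>A * (-1) ^ card H * x(r) = - x(r)\<close> for all \<open>r\<close>. Over an algebraically
  closed field some \<open>r\<close> has \<open>x(r) = 1\<close>.\<close>

lemma affine_group_sign:
  fixes H :: "('a::alg_closed_field \<times> 'a) set"
  assumes "affine_group H"
  shows "(\<Prod>g\<in>H. fst g) = (-1) ^ (card H - 1)"
proof -
  interpret affine_group H by fact
  define A where "A = (\<Prod>g\<in>H. fst g)"
  define e where "e = A * (-1) ^ card H + 1"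
  have val: "poly xpoly r * e = 0" for r
  proof -
    have "poly (smult A (\<Prod>g\<in>H. [:- aff_app g r, 1:])) 0 = A * (-1) ^ card H * poly xpoly r"
      by (simp add: poly_prod poly_xpoly prod_uminus mult_ac)
    moreover have "poly (smult A (\<Prod>g\<in>H. [:- aff_app g r, 1:])) 0 = poly xpoly 0 - poly xpoly r"
      unfolding A_def xpoly_minus_value by simp
    ultimately have "A * (-1) ^ card H * poly xpoly r = poly xpoly 0 - poly xpoly r" by metis
    moreover have "poly xpoly 0 = 0"
      using fin one by (auto simp: poly_xpoly intro!: bexI[of _ "(1, 0)"])
    ultimately show ?thesis by (simp add: e_def algebra_simps)
  qed
  have "degree (xpoly - 1) > 0"
  proof -
    have "degree (xpoly - 1) = degree xpoly"
      using degree_add_eq_left[of "-1" xpoly] degree_xpoly card_pos by simp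
    then show ?thesis using degree_xpoly card_pos by simp
  qed
  then obtain r where "poly (xpoly - 1) r = 0" using alg_closed_imp_poly_has_root by blast
  then have "e = 0" using val[of r] by simp
  moreover obtain n where n: "card H = Suc n" using card_pos by (cases "card H") auto
  ultimately have "A * (-1) ^ n = 1" by (simp add: e_def)
  then have "A * (-1) ^ n * (-1) ^ n = (-1) ^ n" by simp
  then show ?thesis using n by (simp add: A_def mult.assoc flip: power_add mult_2)
qed

section \<open>Semi-invariant polynomials\<close>

lemma map_poly_to_ac_add: "map_poly to_ac (p + q) = map_poly to_ac p + map_poly to_ac q"
  by (rule poly_eqI) (simp add: coeff_map_poly)

lemma map_poly_to_ac_mult: "map_poly to_ac (p * q) = map_poly to_ac p * map_poly to_ac q"
  by (rule poly_eqI) (simp add: coeff_map_poly coeff_mult to_ac_sum)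

lemma map_poly_to_ac_smult: "map_poly to_ac (smult c p) = smult (to_ac c) (map_poly to_ac p)"
  by (rule poly_eqI) (simp add: coeff_map_poly)

lemma map_poly_to_ac_prod: "map_poly to_ac (prod h I) = (\<Prod>i\<in>I. map_poly to_ac (h i))"
  by (induction I rule: infinite_finite_induct) (simp_all add: map_poly_to_ac_mult)

lemma map_poly_to_ac_power: "map_poly to_ac (p ^ n) = map_poly to_ac p ^ n"
  by (induction n) (simp_all add: map_poly_to_ac_mult)

lemma map_poly_to_ac_pcompose:
  "map_poly to_ac (pcompose p q) = pcompose (map_poly to_ac p) (map_poly to_ac q)"
  by (induction p) (simp_all add: pcompose_pCons map_poly_to_ac_add map_poly_to_ac_mult map_poly_pCons)

lemma poly_map_poly_to_ac: "poly (map_poly to_ac p) (to_ac a) = to_ac (poly p a)"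
  by (induction p) (simp_all add: map_poly_pCons)

lemma map_poly_to_ac_eq_iff: "map_poly to_ac p = map_poly to_ac q \<longleftrightarrow> p = q"
  by (metis coeff_map_poly poly_eq_iff to_ac_0 to_ac_eq_iff)

definition ac_pair :: "'a::field \<times> 'a \<Rightarrow> 'a alg_closure \<times> 'a alg_closure" where
  "ac_pair g = (to_ac (fst g), to_ac (snd g))"

lemma inj_ac_pair: "inj_on ac_pair H"
  by (auto simp: inj_on_def ac_pair_def prod_eq_iff)

lemma ac_pair_mult: "ac_pair (aff_mult g h) = aff_mult (ac_pair g) (ac_pair h)"
  by (simp add: ac_pair_def aff_mult_def)

lemma affine_group_ac_pair:
  assumes "affine_group H" shows "affine_group (ac_pair ` H)"
proof -
  interpret affine_group H by fact
  show ?thesis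
  proof
    show "(1, 0) \<in> ac_pair ` H" using one by (force simp: ac_pair_def)
    show "aff_mult g h \<in> ac_pair ` H" if "g \<in> ac_pair ` H" "h \<in> ac_pair ` H" for g h
      using that mult by (auto simp flip: ac_pair_mult)
  qed (use fin nz in \<open>auto simp: ac_pair_def\<close>)
qed

lemma xpoly_ac_pair: "affine_group.xpoly (ac_pair ` H) = map_poly to_ac (affine_group.xpoly H)"
  if H: "affine_group H"
proof -
  interpret affine_group H by fact
  interpret ac: affine_group "ac_pair ` H" by (rule affine_group_ac_pair[OF H])
  have "map_poly to_ac (aff_poly g) = aff_poly (ac_pair g)" for g :: "'a \<times> 'a"
    by (simp add: aff_poly_def ac_pair_def map_poly_pCons)
  then show ?thesis
    by (simp add: ac.xpoly_def xpoly_def map_poly_to_ac_prod prod.reindex[OF inj_ac_pair])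
qed

text \<open>Here the character lives on affine maps instead of automorphisms. This is justified if
  it is trivial or if distinct elements of \<open>G\<close> have distinct affine maps. The condition
  \<open>semi\<close> is what \<open>Y^2 = f(X)\<close> becomes under an automorphism.\<close>

locale semi_invariant = affine_group H for H :: "('k::field \<times> 'k) set" +
  fixes f :: "'k poly" and \<gamma> :: "'k \<times> 'k \<Rightarrow> 'k" and R :: "'k alg_closure set" and c :: 'k
  assumes two: "(2::'k) \<noteq> 0"
    and \<gamma>_nz: "g \<in> H \<Longrightarrow> \<gamma> g \<noteq> 0"
    and \<gamma>_mult: "g \<in> H \<Longrightarrow> h \<in> H \<Longrightarrow> \<gamma> (aff_mult g h) = \<gamma> g * \<gamma> h"
    and semi: "g \<in> H \<Longrightarrow> pcompose f (aff_poly g) = smult (\<gamma> g ^ 2) f"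
    and sqf: "squarefree f" and deg: "degree f \<ge> 1"
    and R: "finite R" "map_poly to_ac f = smult (to_ac c) (\<Prod>r\<in>R. [:- r, 1:])"
begin

sublocale ac: affine_group "ac_pair ` H"
  by (rule affine_group_ac_pair) unfold_locales

lemma card_ac: "card (ac_pair ` H) = card H"
  by (rule card_image[OF inj_ac_pair])

lemma f_nz: "f \<noteq> 0"
  using deg by auto

lemma c_nz: "c \<noteq> 0"
  using R(2) f_nz map_poly_to_ac_eq_iff[of f 0] by auto

lemma R_iff: "r \<in> R \<longleftrightarrow> poly (map_poly to_ac f) r = 0"
  using R(1) c_nz by (auto simp: R(2) poly_prod)

lemma to_ac_R_iff: "to_ac a \<in> R \<longleftrightarrow> poly f a = 0"
  by (simp add: R_iff poly_map_poly_to_ac)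

lemma R_nonempty: "R \<noteq> {}"
proof
  assume "R = {}"
  then have "map_poly to_ac f = map_poly to_ac [:c:]" using R(2) by (simp add: map_poly_pCons)
  then show False using deg by (auto simp: map_poly_to_ac_eq_iff)
qed

lemma \<gamma>_one: "\<gamma> (1, 0) = 1"
  using \<gamma>_mult[OF one one] \<gamma>_nz[OF one] by simp

lemma orbit_subset: "r \<in> R \<Longrightarrow> ac.orbit r \<subseteq> R"
proof -
  assume r: "r \<in> R"
  have "poly (map_poly to_ac f) (aff_app (ac_pair g) r) = 0" if g: "g \<in> H" for g
  proof -
    have "map_poly to_ac (aff_poly g) = aff_poly (ac_pair g)"
      by (simp add: aff_poly_def ac_pair_def map_poly_pCons)
    then have "poly (map_poly to_ac f) (aff_app (ac_pair g) r) = poly (map_poly to_ac (pcompose f (aff_poly g))) r"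
      by (simp add: map_poly_to_ac_pcompose poly_pcompose poly_aff_poly)
    then show ?thesis using r by (simp add: semi[OF g] map_poly_to_ac_smult R_iff)
  qed
  then show ?thesis by (auto simp: ac.orbit_def R_iff)
qed

text \<open>Compare linear terms at \<open>a\<close>: in \<open>f = (X - a) q\<close>, composing
  with \<open>g\<close> multiplies \<open>X - a\<close> by \<open>fst g\<close>, and
  \<open>q(a)\<close> is nonzero because \<open>f\<close> is squarefree.\<close>

lemma stab_root:
  assumes g: "g \<in> H" "aff_app g a = a" and a: "poly f a = 0"
  shows "fst g = \<gamma> g ^ 2"
proof -
  obtain q where q: "f = [:- a, 1:] * q" using a by (auto simp: poly_eq_0_iff_dvd)
  have qa: "poly q a \<noteq> 0"
  proof
    assume "poly q a = 0"
    then have "[:- a, 1:] ^ 2 dvd f" 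
      unfolding q power2_eq_square poly_eq_0_iff_dvd by (rule mult_dvd_mono[OF dvd_refl])
    then have "is_unit [:- a, 1:]" using sqf unfolding squarefree_def by blast
    then show False by (simp add: is_unit_iff_degree)
  qed
  have "pcompose f (aff_poly g) = smult (fst g) [:- a, 1:] * pcompose q (aff_poly g)"
    using linear_factor_aff[of g a] unfolding q pcompose_mult g(2) by (rule arg_cong)
  then have "[:- a, 1:] * (smult (fst g) (pcompose q (aff_poly g))) = pcompose f (aff_poly g)"
    by (simp only: mult_smult_left mult_smult_right)
  also have "\<dots> = [:- a, 1:] * (smult (\<gamma> g ^ 2) q)"
    unfolding semi[OF g(1)] by (subst q) (simp only: mult_smult_right)
  finally have "smult (fst g) (pcompose q (aff_poly g)) = smult (\<gamma> g ^ 2) q"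
    by (subst (asm) mult_cancel_left) auto
  then have "fst g * poly q (aff_app g a) = \<gamma> g ^ 2 * poly q a"
    by (metis poly_pcompose poly_aff_poly poly_smult)
  then show ?thesis using qa g by simp
qed

lemma stab_nonroot:
  assumes "g \<in> H" "aff_app g a = a" "poly f a \<noteq> 0"
  shows "\<gamma> g ^ 2 = 1"
  using arg_cong[OF semi[OF assms(1)], of "\<lambda>p. poly p a"] assms(2,3)
  by (simp add: poly_pcompose poly_aff_poly)

lemma ac_stab_card:
  assumes "\<And>g. g \<in> H \<Longrightarrow> aff_app (ac_pair g) r = r \<Longrightarrow> g = (1, 0)"
  shows "card (ac.stab r) = 1"
proof -
  have "ac.stab r = {(1, 0)}"
  proof (intro equalityI subsetI)
    fix g assume "g \<in> ac.stab r"
    then obtain h where "h \<in> H" "g = ac_pair h" "aff_app (ac_pair h) r = r" by (auto simp: ac.stab_def)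
    then show "g \<in> {(1, 0)}" using assms[of h] by (simp add: ac_pair_def)
  qed (use ac.one in \<open>auto simp: ac.stab_def\<close>)
  then show ?thesis by simp
qed

text \<open>A nontrivial map with a fixed point is no translation, so its fixed point solves a
  linear equation over \<open>k\<close>. Stabilisers of points of the closure are thereby controlled
  by points of \<open>k\<close>.\<close>

lemma ac_fixed_rational:
  assumes "aff_app (ac_pair g) r = r" "g \<noteq> (1, 0)"
  shows "fst g \<noteq> 1" "r = to_ac (snd g / (1 - fst g))" "aff_app g (snd g / (1 - fst g)) = snd g / (1 - fst g)"
proof -
  have e: "to_ac (snd g) = (1 - to_ac (fst g)) * r"
    using assms(1) by (simp add: aff_app_def ac_pair_def algebra_simps)
  show n: "fst g \<noteq> 1"
  proof
    assume "fst g = 1"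
    then show False using e assms(2) by (cases g) simp
  qed
  have n': "1 - to_ac (fst g) \<noteq> 0" using n by (metis right_minus_eq to_ac_eq_1_iff')
  show "r = to_ac (snd g / (1 - fst g))" using e n' by (simp add: field_simps)
  show "aff_app g (snd g / (1 - fst g)) = snd g / (1 - fst g)" using n by (simp add: aff_app_def field_simps)
qed

lemma sign: "(\<Prod>g\<in>ac_pair ` H. fst g) = (-1) ^ (card H - 1)"
  using affine_group_sign[OF ac.affine_group_axioms] by (simp add: card_ac)

lemma minus_one_power_sq: "((-1) ^ n) * ((-1) ^ n) = (1 :: 'a :: ring_1)"
  by (simp flip: power_add mult_2)

lemma free_orbit:
  assumes "card (ac.stab r) = 1"
  shows "(\<Prod>s\<in>ac.orbit r. [:- s, 1:]) =
    smult ((-1) ^ (card H - 1)) (pcompose [:- (\<Prod>s\<in>ac.orbit r. s), 1:] ac.xpoly)"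
proof -
  have "pcompose [:- (\<Prod>s\<in>ac.orbit r. s), 1:] ac.xpoly = smult ((-1) ^ (card H - 1)) (\<Prod>s\<in>ac.orbit r. [:- s, 1:])"
    using ac.xpoly_minus_orbit[of r] assms by (simp add: sign pcompose_pCons)
  then show ?thesis by (simp add: minus_one_power_sq)
qed

lemma ac_orbits_disjoint: "disjoint (ac.orbit ` R)"
  unfolding disjoint_def using ac.orbit_eq by blast

lemma Union_orbits: "\<Union> (ac.orbit ` R) = R"
  using orbit_subset ac.orbit_self by blast

lemma prod_orbits: "finite (ac.orbit ` R) \<and> (\<Prod>r\<in>R. \<phi> r) = (\<Prod>Q\<in>ac.orbit ` R. \<Prod>r\<in>Q. \<phi> r)"
  using R(1) ac_orbits_disjoint ac.finite_orbit
  by (subst Union_orbits[symmetric], subst prod.Union_disjoint) (auto simp: disjoint_def)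

lemma prod_free_orbits:
  assumes "finite QQ" "\<And>Q. Q \<in> QQ \<Longrightarrow> \<exists>r. Q = ac.orbit r \<and> card (ac.stab r) = 1"
  shows "(\<Prod>Q\<in>QQ. \<Prod>s\<in>Q. [:- s, 1:]) =
    smult ((-1) ^ ((card H - 1) * card QQ)) (pcompose (\<Prod>Q\<in>QQ. [:- (\<Prod>s\<in>Q. s), 1:]) ac.xpoly)"
proof -
  have "(\<Prod>Q\<in>QQ. \<Prod>s\<in>Q. [:- s, 1:]) = (\<Prod>Q\<in>QQ. smult ((-1) ^ (card H - 1)) (pcompose [:- (\<Prod>s\<in>Q. s), 1:] ac.xpoly))"
    using assms(2) free_orbit by (intro prod.cong) auto
  also have "\<dots> = smult (((-1) ^ (card H - 1)) ^ card QQ) (pcompose (\<Prod>Q\<in>QQ. [:- (\<Prod>s\<in>Q. s), 1:]) ac.xpoly)"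
    by (simp only: prod_smult pcompose_prod prod_constant)
  finally show ?thesis by (simp add: power_mult)
qed

text \<open>The polynomial \<open>F\<close> is found over the closure, but the invariant
  \<open>f * s ^ 2\<close> is \<open>h(xpoly)\<close> with \<open>h\<close> over \<open>k\<close>.
  Substitution of \<open>xpoly\<close> is injective, so \<open>F\<close> is the image of
  \<open>h\<close>; no Galois action is involved.\<close>

lemma descend:
  assumes s: "\<And>g. g \<in> H \<Longrightarrow> smult (\<gamma> g) (pcompose s (aff_poly g)) = s"
    and F: "map_poly to_ac (f * s ^ 2) = pcompose F ac.xpoly"
  shows "\<exists>h. map_poly to_ac h = F \<and> f * s ^ 2 = pcompose h xpoly"
proof -
  have inv: "pcompose (f * s ^ 2) (aff_poly g) = f * s ^ 2" if g: "g \<in> H" for g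
  proof -
    have "f * s ^ 2 = f * (smult (\<gamma> g) (pcompose s (aff_poly g))) ^ 2" using s[OF g] by simp
    also have "\<dots> = pcompose (f * s ^ 2) (aff_poly g)"
      by (simp add: pcompose_mult pcompose_power semi[OF g] smult_power)
    finally show ?thesis ..
  qed
  obtain h where h: "f * s ^ 2 = pcompose h xpoly" using invariant_imp_pcompose[OF inv] by blast
  have "pcompose (map_poly to_ac h) ac.xpoly = pcompose F ac.xpoly"
    using F unfolding h xpoly_ac_pair[OF affine_group_axioms] map_poly_to_ac_pcompose by simp
  moreover have "degree ac.xpoly > 0" by (simp only: ac.degree_xpoly ac.card_pos)
  ultimately have "map_poly to_ac h = F" by (metis pcompose_cancel)
  then show ?thesis using h by blast
qed

text \<open>A root with nontrivial stabiliser would be fixed by some \<open>g\<close> of multiplier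
  \<open>\<gamma> g ^ 2 = 1\<close>, impossible by \<open>ac_fixed_rational\<close>. So every orbit
  in \<open>R\<close> has \<open>card H\<close> elements, and \<open>(card H - 1) * |R/G|\<close> is
  \<open>|R| - |R/G|\<close>.\<close>

lemma trivial_character:
  assumes triv: "\<And>g. g \<in> H \<Longrightarrow> \<gamma> g = 1"
  shows "\<exists>h. map_poly to_ac h = smult (to_ac c * (-1) ^ (card R - card (ac.orbit ` R)))
      (\<Prod>Q\<in>ac.orbit ` R. [:- (\<Prod>r\<in>Q. r), 1:]) \<and> f = pcompose h xpoly"
proof -
  have free: "card (ac.stab r) = 1" if "r \<in> R" for r
  proof (rule ac_stab_card, rule ccontr)
    fix g assume g: "g \<in> H" "aff_app (ac_pair g) r = r" "g \<noteq> (1, 0)"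
    show False
      using ac_fixed_rational[OF g(2,3)] stab_root[OF g(1)] triv[OF g(1)] that to_ac_R_iff by (metis one_power2)
  qed
  have "card R = (\<Sum>Q\<in>ac.orbit ` R. card Q)"
    using card_Union_disjoint[OF ac_orbits_disjoint] ac.finite_orbit unfolding Union_orbits by blast
  also have "\<dots> = (\<Sum>Q\<in>ac.orbit ` R. card H)"
  proof (rule sum.cong)
    fix Q assume "Q \<in> ac.orbit ` R"
    then obtain r where "r \<in> R" "Q = ac.orbit r" by blast
    then show "card Q = card H" using ac.card_orbit[of r] free[of r] by (simp add: card_ac)
  qed simp
  finally have cR: "card R - card (ac.orbit ` R) = (card H - 1) * card (ac.orbit ` R)"
    by (simp add: diff_mult_distrib mult.commute)
  have "map_poly to_ac (f * 1 ^ 2) = pcompose (smult (to_ac c * (-1) ^ (card R - card (ac.orbit ` R)))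
      (\<Prod>Q\<in>ac.orbit ` R. [:- (\<Prod>r\<in>Q. r), 1:])) ac.xpoly"
  proof -
    have "(\<Prod>r\<in>R. [:- r, 1:]) = smult ((-1) ^ ((card H - 1) * card (ac.orbit ` R)))
      (pcompose (\<Prod>Q\<in>ac.orbit ` R. [:- (\<Prod>s\<in>Q. s), 1:]) ac.xpoly)"
      using prod_orbits[of "\<lambda>s. [:- s, 1:]"] prod_free_orbits[of "ac.orbit ` R"] free by auto
    then show ?thesis by (simp add: R(2) cR pcompose_smult)
  qed
  then show ?thesis using descend[of 1] triv by (auto simp: pcompose_1)
qed

lemma same_multiplier_diff:
  assumes "(a, b) \<in> H" "(a, b') \<in> H" shows "(1, b' - b) \<in> H"
  using assms right_cancel[of "(1, b' - b)" "(a, b)"] by (simp add: aff_mult_def)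

end

section \<open>Nontrivial characters: translations, fixed points and the stabiliser\<close>

locale nontrivial_character = semi_invariant H f \<gamma> R c
  for H :: "('k::field \<times> 'k) set" and f \<gamma> R c +
  fixes g\<^sub>0 assumes g\<^sub>0: "g\<^sub>0 \<in> H" "\<gamma> g\<^sub>0 \<noteq> 1"
begin

definition N :: "'k set" where "N = {b. (1, b) \<in> H}"

lemma N_0: "0 \<in> N" and N_diff: "x \<in> N \<Longrightarrow> y \<in> N \<Longrightarrow> x - y \<in> N"
  using one same_multiplier_diff[of 1 y x] by (auto simp: N_def)

lemma N_add: "x \<in> N \<Longrightarrow> y \<in> N \<Longrightarrow> x + y \<in> N"
  using N_diff[OF N_0, of y] N_diff[of x "- y"] by simp

lemma finite_N: "finite N"
  using finite_subset[of "Pair 1 ` N" H] fin by (auto simp: N_def finite_image_iff inj_on_def)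

lemma N_mult: "g \<in> H \<Longrightarrow> n \<in> N \<Longrightarrow> fst g * n \<in> N"
  using mult[of g "(1, n)"] same_multiplier_diff[of "fst g" "snd g" "fst g * n + snd g"]
  by (auto simp: N_def aff_mult_def)

text \<open>Multiplication by \<open>z\<close> is an injective self-map of a finite set, hence onto.
  It is applied with \<open>z = 2\<close> and with \<open>z = 1 - fst g\<close>.\<close>

lemma N_divide:
  assumes "n \<in> N" "\<And>x. x \<in> N \<Longrightarrow> z * x \<in> N" "z \<noteq> 0"
  shows "n / z \<in> N"
proof -
  have "(*) z ` N = N"
    using assms(2,3) finite_N by (intro endo_inj_surj) (auto simp: inj_on_def)
  then obtain x where "x \<in> N" "n = z * x" using assms(1) by blast
  then show ?thesis using assms(3) by simp
qed

lemma N_divide_fixed: "g \<in> H \<Longrightarrow> fst g \<noteq> 1 \<Longrightarrow> n \<in> N \<Longrightarrow> n / (1 - fst g) \<in> N"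
  using N_divide[of n "1 - fst g"] N_mult[of g] N_diff by (simp add: left_diff_distrib)

lemma \<gamma>_square: "g \<in> H \<Longrightarrow> \<gamma> g ^ 2 = fst g ^ degree f"
proof -
  assume g: "g \<in> H"
  have "lead_coeff (pcompose f (aff_poly g)) = lead_coeff f * fst g ^ degree f"
    using nz[OF g] by (subst lead_coeff_comp) (simp_all add: aff_poly_def)
  then show ?thesis using semi[OF g] f_nz \<gamma>_nz[OF g] by simp
qed

text \<open>The finite group \<open>N\<close> is uniquely \<open>2\<close>-divisible.\<close>

lemma \<gamma>_translation: "b \<in> N \<Longrightarrow> \<gamma> (1, b) = 1"
proof -
  assume b: "b \<in> N"
  have "2 * x \<in> N" if "x \<in> N" for x using N_add[OF that that] by (simp only: mult_2)
  then have "b / 2 \<in> N" using N_divide[OF b _ two] by blast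
  then have h: "(1, b / 2) \<in> H" by (simp add: N_def)
  have "aff_mult (1, b / 2) (1, b / 2) = (1, b)" using two by (simp add: aff_mult_def flip: mult_2)
  then have "\<gamma> (1, b) = \<gamma> (1, b / 2) ^ 2" using \<gamma>_mult[OF h h] by (simp add: power2_eq_square)
  then show ?thesis using \<gamma>_square[OF h] by simp
qed

lemma \<gamma>_same_multiplier:
  assumes "g \<in> H" "h \<in> H" "fst g = fst h" shows "\<gamma> g = \<gamma> h"
proof -
  have "snd h - snd g \<in> N" using same_multiplier_diff[of "fst g" "snd g" "snd h"] assms unfolding N_def
    by (metis mem_Collect_eq prod.collapse)
  then have "(1, snd h - snd g) \<in> H" "\<gamma> (1, snd h - snd g) = 1" using \<gamma>_translation by (auto simp: N_def)
  moreover have "aff_mult (1, snd h - snd g) g = h" using assms(3) by (auto simp: aff_mult_def prod_eq_iff)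
  ultimately show ?thesis using \<gamma>_mult[of "(1, snd h - snd g)" g] assms by simp
qed

lemma fst_g\<^sub>0: "fst g\<^sub>0 \<noteq> 1"
  using g\<^sub>0 \<gamma>_same_multiplier[OF g\<^sub>0(1) one] \<gamma>_one by auto

text \<open>The fixed point of \<open>g\<^sub>0\<close>. It exists because \<gamma> depends only on
  the multiplier, so that \<open>\<gamma> g\<^sub>0 \<noteq> 1\<close> excludes multiplier
  1.\<close>

definition a :: 'k where "a = snd g\<^sub>0 / (1 - fst g\<^sub>0)"

lemma a: "snd g\<^sub>0 = (1 - fst g\<^sub>0) * a"
  using fst_g\<^sub>0 by (simp add: a_def)

text \<open>The commutator with \<open>g\<^sub>0\<close> is the translation by \<open>(fst g\<^sub>0 - 1) * (h(a) - a)\<close>.\<close>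

lemma app_a_diff: "h \<in> H \<Longrightarrow> aff_app h a - a \<in> N"
proof -
  assume h: "h \<in> H"
  let ?d = "aff_app h a - a"
  have "(fst g\<^sub>0 * fst h, fst g\<^sub>0 * snd h + snd g\<^sub>0) \<in> H" "(fst g\<^sub>0 * fst h, fst h * snd g\<^sub>0 + snd h) \<in> H"
    using mult[OF g\<^sub>0(1) h] mult[OF h g\<^sub>0(1)] by (simp_all add: aff_mult_def mult.commute)
  then have "(fst h * snd g\<^sub>0 + snd h) - (fst g\<^sub>0 * snd h + snd g\<^sub>0) \<in> N"
    using same_multiplier_diff by (simp add: N_def)
  also have "(fst h * snd g\<^sub>0 + snd h) - (fst g\<^sub>0 * snd h + snd g\<^sub>0) = (1 - fst g\<^sub>0) * ?d"
    by (simp add: a aff_app_def algebra_simps)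
  finally show ?thesis using N_divide_fixed[OF g\<^sub>0(1) fst_g\<^sub>0] fst_g\<^sub>0 by fastforce
qed

definition U :: "'k set" where "U = {u. \<exists>g\<in>H. g \<noteq> (1, 0) \<and> aff_app g u = u}"

text \<open>If \<open>g\<close> fixes \<open>u\<close>, then
  \<open>g(a) - a = (1 - fst g) (u - a)\<close> is in \<open>N\<close>, and division by
  \<open>1 - fst g\<close> stays in \<open>N\<close>. Conversely \<open>a + n\<close> is fixed by a
  conjugate of \<open>g\<^sub>0\<close>.\<close>

lemma U_eq: "U = (+) a ` N"
proof (intro equalityI subsetI)
  fix u assume "u \<in> U"
  then obtain g where g: "g \<in> H" "g \<noteq> (1, 0)" "fst g * u + snd g = u" by (auto simp: U_def aff_app_def)
  have f1: "fst g \<noteq> 1" using g by (cases g) auto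
  have "aff_app g a - a = (1 - fst g) * (u - a)"
    using g(3) by (simp add: aff_app_def algebra_simps)
  then have "u - a \<in> N" using N_divide_fixed[OF g(1) f1 app_a_diff[OF g(1)]] f1 by simp
  then show "u \<in> (+) a ` N" by (intro image_eqI[of _ _ "u - a"]) auto
next
  fix u assume "u \<in> (+) a ` N"
  then obtain n where n: "n \<in> N" "u = a + n" by blast
  \<comment> \<open>Chosen so that translation by \<open>n'\<close> after \<open>g\<^sub>0\<close>
    is the conjugate of \<open>g\<^sub>0\<close> by translation by \<open>n\<close>.\<close>
  define n' where "n' = n - fst g\<^sub>0 * n"
  have "n' \<in> N" using N_mult[OF g\<^sub>0(1)] N_diff n by (simp add: n'_def)
  then have "aff_mult (1, n') g\<^sub>0 \<in> H" using mult g\<^sub>0 by (simp add: N_def)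
  moreover have "aff_app (aff_mult (1, n') g\<^sub>0) u = u"
    by (simp add: aff_app_mult) (simp add: aff_app_def a n n'_def algebra_simps)
  moreover have "aff_mult (1, n') g\<^sub>0 \<noteq> (1, 0)" using fst_g\<^sub>0 by (simp add: aff_mult_def)
  ultimately show "u \<in> U" unfolding U_def by blast
qed

lemma orbit_a: "orbit a = U"
proof (intro equalityI subsetI)
  fix u assume "u \<in> orbit a"
  then obtain h where "h \<in> H" "u = aff_app h a" by (auto simp: orbit_def)
  then show "u \<in> U" using app_a_diff[of h] by (intro subsetD[OF equalityD2[OF U_eq]] image_eqI[of _ _ "u - a"]) auto
next
  fix u assume "u \<in> U"
  then obtain n where "n \<in> N" "u = a + n" using U_eq by blast
  then show "u \<in> orbit a" unfolding orbit_def
    by (intro image_eqI[of _ _ "(1, n)"]) (auto simp: N_def aff_app_def)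
qed

lemma finite_U: "finite U"
  using finite_orbit orbit_a by metis

lemma card_U_pos: "card U > 0"
  using finite_U orbit_self orbit_a by (metis card_gt_0_iff empty_iff)

definition m :: nat where "m = card H div card U"

lemma m_stab: "m = card (stab a)"
  using card_orbit[of a] card_U_pos orbit_a by (simp add: m_def)

lemma m_pos: "m > 0"
  using affine_group.card_pos[OF stab_group] m_stab by metis

lemma inj_stab: "inj_on fst (stab a)"
  by (auto simp: inj_on_def stab_def aff_app_def) (metis add_left_cancel)

text \<open>Moving \<open>g(a)\<close> back to \<open>a\<close> by a translation keeps the
  multiplier. With \<open>inj_stab\<close>, the stabiliser of \<open>a\<close> represents each
  multiplier exactly once.\<close>

lemma ex_stab: "g \<in> H \<Longrightarrow> \<exists>h\<in>stab a. fst h = fst g"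
proof -
  assume g: "g \<in> H"
  have "(1, - (aff_app g a - a)) \<in> H" using N_diff[OF N_0 app_a_diff[OF g]] by (simp add: N_def)
  then have "aff_mult (1, - (aff_app g a - a)) g \<in> H" using mult g by blast
  moreover have "aff_app (aff_mult (1, - (aff_app g a - a)) g) a = a"
    by (simp add: aff_app_mult) (simp add: aff_app_def)
  ultimately have "aff_mult (1, - (aff_app g a - a)) g \<in> stab a" by (simp add: stab_def)
  then show ?thesis by (intro bexI) (auto simp: aff_mult_def)
qed

text \<open>Reindexing the product of all values of \<chi> by \<open>g\<close> produces the factor
  \<open>\<chi> g ^ card S\<close>.\<close>

lemma prod_character:
  assumes S: "affine_group S" and \<chi>: "\<And>g h. g \<in> S \<Longrightarrow> h \<in> S \<Longrightarrow> \<chi> (aff_mult g h) = \<chi> g * \<chi> h"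
    and "\<And>g. g \<in> S \<Longrightarrow> \<chi> g \<noteq> (0::'k)" and g: "g \<in> S"
  shows "\<chi> g ^ card S = 1"
proof -
  have "(\<Prod>h\<in>S. \<chi> h) = (\<Prod>h\<in>S. \<chi> (aff_mult g h))"
    using prod.reindex_bij_betw[OF affine_group.left_bij[OF S g], of \<chi>] by simp
  also have "\<dots> = \<chi> g ^ card S * (\<Prod>h\<in>S. \<chi> h)" using \<chi>[OF g] by (simp add: prod.distrib)
  finally show ?thesis using assms(3) affine_group.fin[OF S] by simp
qed

definition w :: "'k poly" where "w = (\<Prod>u\<in>U. [:- u, 1:])"

lemma w_nz: "w \<noteq> 0"
  using finite_U by (simp add: w_def)

text \<open>Multiplication by \<open>fst g\<close> permutes the nonzero elements of
  \<open>N\<close>, so its power with exponent \<open>card N - 1\<close> is 1, and \<open>U\<close>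
  has as many elements as \<open>N\<close>. Hence \<open>w\<close> is multiplied by the multiplier
  itself.\<close>

lemma pow_card_U: "g \<in> H \<Longrightarrow> fst g ^ card U = fst g"
proof -
  assume g: "g \<in> H"
  have cU: "card U = Suc (card (N - {0}))"
    using card_Suc_Diff1[OF finite_N N_0] by (simp add: U_eq card_image del: card_Diff_singleton)
  have "bij_betw ((*) (fst g)) (N - {0}) (N - {0})"
  proof -
    have "inj_on ((*) (fst g)) (N - {0})" using nz[OF g] by (auto simp: inj_on_def)
    moreover have "(*) (fst g) ` (N - {0}) \<subseteq> N - {0}" using N_mult[OF g] nz[OF g] by auto
    ultimately show ?thesis using finite_N by (simp add: bij_betw_def endo_inj_surj)
  qed
  then have "(\<Prod>n\<in>N - {0}. n) = (\<Prod>n\<in>N - {0}. fst g * n)" by (rule prod.reindex_bij_betw[symmetric])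
  then have "fst g ^ card (N - {0}) = 1" using finite_N by (simp add: prod.distrib)
  then show ?thesis using cU by simp
qed

lemma w_semi: "g \<in> H \<Longrightarrow> pcompose w (aff_poly g) = smult (fst g) w"
proof -
  assume g: "g \<in> H"
  have "bij_betw (aff_app g) U U"
  proof -
    have "inj_on (aff_app g) U" using nz[OF g] by (auto simp: inj_on_def aff_app_def)
    moreover have "aff_app g ` U \<subseteq> U"
      using mult[OF g] unfolding orbit_a[symmetric] orbit_def by (auto simp flip: aff_app_mult)
    ultimately show ?thesis using finite_U by (simp add: bij_betw_def endo_inj_surj)
  qed
  then have "w = (\<Prod>u\<in>U. [:- aff_app g u, 1:])" unfolding w_def by (rule prod.reindex_bij_betw[symmetric])
  then have "pcompose w (aff_poly g) = (\<Prod>u\<in>U. smult (fst g) [:- u, 1:])"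
    by (simp add: pcompose_prod linear_factor_aff del: smult_pCons)
  then show ?thesis by (simp add: prod_smult w_def pow_card_U[OF g] del: smult_pCons)
qed

definition \<mu> :: 'k where "\<mu> = (\<Prod>u\<in>U. u ^ m)"

lemma ac_orbit_a: "ac.orbit (to_ac a) = to_ac ` U"
  by (simp add: ac.orbit_def orbit_def flip: orbit_a)
     (simp add: image_image aff_app_def ac_pair_def)

lemma ac_stab_a: "card (ac.stab (to_ac a)) = m"
proof -
  have "card H = card U * card (ac.stab (to_ac a))"
    using ac.card_orbit[of "to_ac a"] by (simp add: ac_orbit_a card_ac card_image inj_on_def)
  then show ?thesis using card_U_pos by (simp add: m_def)
qed

text \<open>The case of \<open>xpoly_minus_orbit\<close> for the orbit \<open>U\<close>, whose
  stabilisers have order \<open>m\<close>; so \<mu> is the value of \<open>xpoly\<close> on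
  \<open>U\<close>.\<close>

lemma w_power: "map_poly to_ac w ^ m = smult ((-1) ^ (card H - 1)) (pcompose [:- to_ac \<mu>, 1:] ac.xpoly)"
proof -
  have "map_poly to_ac w = (\<Prod>s\<in>to_ac ` U. [:- s, 1:])"
    by (simp add: w_def map_poly_to_ac_prod prod.reindex inj_on_def map_poly_pCons)
  moreover have "to_ac \<mu> = (\<Prod>s\<in>to_ac ` U. s) ^ m"
    by (simp add: \<mu>_def to_ac_prod prod.reindex inj_on_def prod_power_distrib)
  ultimately have "pcompose [:- to_ac \<mu>, 1:] ac.xpoly = smult ((-1) ^ (card H - 1)) (map_poly to_ac w ^ m)"
    using ac.xpoly_minus_orbit[of "to_ac a"] by (simp add: sign ac_orbit_a ac_stab_a pcompose_pCons)
  then show ?thesis by (simp add: minus_one_power_sq)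
qed

text \<open>On \<open>stab a\<close> the character is 1 or -1, with a kernel \<open>K\<close> of
  index two. The multipliers embed \<open>stab a\<close> in the multiplicative group of
  \<open>k\<close>, where \<open>x ^ card K = 1\<close> has at most \<open>card K\<close> solutions.
  So this power of the multiplier is 1 exactly on \<open>K\<close> and -1 elsewhere, like \<gamma>;
  \<open>ex_stab\<close> carries the equality to \<open>H\<close>.\<close>

lemma \<gamma>_eq_multiplier_power:
  assumes "poly f a \<noteq> 0"
  shows "\<exists>t. m = 2 * t \<and> (\<forall>g\<in>H. \<gamma> g = fst g ^ t)"
proof -
  interpret S: affine_group "stab a" by (rule stab_group)
  have SH: "g \<in> H" "aff_app g a = a" if "g \<in> stab a" for g using that by (auto simp: stab_def)
  have pm: "\<gamma> g = 1 \<or> \<gamma> g = -1" if "g \<in> stab a" for g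
    using stab_nonroot[OF SH[OF that] assms] by (simp add: power2_eq_1_iff)
  have m1: "- 1 \<noteq> (1::'k)" using two by (metis add.right_inverse one_add_one)
  define K where "K = {g \<in> stab a. \<gamma> g = 1}"
  obtain g\<^sub>1 where g1: "g\<^sub>1 \<in> stab a" "\<gamma> g\<^sub>1 = -1"
    using ex_stab[OF g\<^sub>0(1)] \<gamma>_same_multiplier[OF _ g\<^sub>0(1)] g\<^sub>0(2) SH pm by metis
  have K_group: "affine_group K"
    using S.fin S.one S.mult S.nz \<gamma>_one SH by unfold_locales (auto simp: K_def \<gamma>_mult)
  \<comment> \<open>Multiplication by \<open>g\<^sub>1\<close>, where \<gamma> is -1, maps the
    kernel onto its complement, whence \<open>m = 2 * card K\<close>.\<close>
  have "bij_betw (aff_mult g\<^sub>1) K (stab a - K)"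
  proof (rule bij_betw_imageI)
    show "inj_on (aff_mult g\<^sub>1) K"
      using S.left_bij[OF g1(1)] by (auto simp: bij_betw_def K_def inj_on_def)
    show "aff_mult g\<^sub>1 ` K = stab a - K"
    proof (intro equalityI subsetI)
      fix g assume "g \<in> aff_mult g\<^sub>1 ` K"
      then obtain k where k: "k \<in> stab a" "\<gamma> k = 1" "g = aff_mult g\<^sub>1 k" by (auto simp: K_def)
      have "\<gamma> g = -1" using \<gamma>_mult[of g\<^sub>1 k] k g1 SH by simp
      then show "g \<in> stab a - K" using S.mult[OF g1(1) k(1)] k(3) m1 by (simp add: K_def)
    next
      fix g assume g: "g \<in> stab a - K"
      then obtain k where k: "k \<in> stab a" "aff_mult g\<^sub>1 k = g"
        using S.left_bij[OF g1(1)] unfolding bij_betw_def by (metis (no_types, lifting) DiffD1 imageE)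
      have "\<gamma> g = -1" using g pm[of g] by (auto simp: K_def)
      then have "\<gamma> k = 1" using \<gamma>_mult[of g\<^sub>1 k] g1 k SH by simp
      then show "g \<in> aff_mult g\<^sub>1 ` K" using k by (auto simp: K_def)
    qed
  qed
  then have "card K = card (stab a - K)" by (rule bij_betw_same_card)
  also have "\<dots> = m - card K" using S.fin by (subst card_Diff_subset) (auto simp: K_def m_stab)
  finally have mK: "m = 2 * card K" using card_mono[OF S.fin, of K] by (auto simp: K_def m_stab)
  have K1: "fst g ^ card K = 1" if "g \<in> K" for g
    using prod_character[OF K_group, where \<chi> = fst] that nz SH by (auto simp: K_def aff_mult_def)
  have K2: "g \<in> K" if g: "g \<in> stab a" "fst g ^ card K = 1" for g
  proof -
    have cK: "card K > 0" using affine_group.card_pos[OF K_group] .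
    have "card (fst ` K) = card K" using inj_stab by (intro card_image) (auto simp: K_def inj_on_def)
    then have "fst ` K = {x. x ^ card K = 1}"
      using K1 card_roots_of_unity_le[where ?'a = 'k, OF cK] by (intro card_seteq) auto
    then have "fst g \<in> fst ` K" using g by auto
    then show ?thesis using inj_stab g(1) by (auto simp: inj_on_def K_def)
  qed
  have "\<gamma> g = fst g ^ card K" if g: "g \<in> stab a" for g
  proof (cases "g \<in> K")
    case True
    then show ?thesis using K1 by (simp add: K_def)
  next
    case False
    have "fst g ^ m = 1" using prod_character[OF stab_group, where \<chi> = fst] g S.nz by (auto simp: m_stab aff_mult_def)
    then have "(fst g ^ card K) ^ 2 = 1" by (simp add: mK mult.commute flip: power_mult)
    then have "fst g ^ card K = -1" using K2[OF g] False by (auto simp: power2_eq_1_iff)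
    then show ?thesis using False pm[OF g] g by (auto simp: K_def)
  qed
  then have "\<forall>g\<in>H. \<gamma> g = fst g ^ card K"
    using ex_stab \<gamma>_same_multiplier SH by metis
  then show ?thesis using mK by blast
qed

text \<open>Here \<open>a\<close> is a root, so \<open>stab_root\<close> applies. If
  \<open>m = 2 * t\<close>, all multipliers of \<open>stab a\<close> would satisfy
  \<open>x ^ t = 1\<close>, being squares of \<gamma>; but these are \<open>m\<close> distinct
  elements, and there are at most \<open>t\<close> solutions.\<close>

lemma multiplier_eq_\<gamma>_square:
  assumes "poly f a = 0"
  shows "odd m" "g \<in> H \<Longrightarrow> fst g = \<gamma> g ^ 2" "g \<in> H \<Longrightarrow> \<gamma> g ^ m = 1"
proof -
  have SH: "g \<in> H" "aff_app g a = a" if "g \<in> stab a" for g using that by (auto simp: stab_def)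
  show sq: "fst g = \<gamma> g ^ 2" if g: "g \<in> H" for g
    using ex_stab[OF g] stab_root[OF SH assms] \<gamma>_same_multiplier[OF _ g] SH by metis
  have g1: "\<gamma> g ^ m = 1" if g: "g \<in> stab a" for g
    using prod_character[OF stab_group, where \<chi> = \<gamma>] g \<gamma>_mult \<gamma>_nz SH by (auto simp: m_stab)
  show "\<gamma> g ^ m = 1" if g: "g \<in> H" for g
    using ex_stab[OF g] g1 \<gamma>_same_multiplier[OF _ g] SH by metis
  show "odd m"
  proof
    assume "even m"
    then obtain t where t: "m = 2 * t" by blast
    have t0: "t > 0" using m_pos t by simp
    have "fst g ^ t = 1" if "g \<in> stab a" for g
      using g1[OF that] sq[of g] SH[OF that] by (simp add: t power_mult)
    then have "card (fst ` stab a) \<le> t"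
      using card_roots_of_unity_le[where ?'a = 'k, OF t0] card_mono[of "{x::'k. x ^ t = 1}" "fst ` stab a"] by force
    then show False using t t0 m_stab card_image[OF inj_stab] by simp
  qed
qed

text \<open>A root with nontrivial stabiliser is a point of \<open>U\<close>, and its orbit is
  \<open>U\<close>; the remaining orbits are free.\<close>

lemma prod_other_orbits:
  "(\<Prod>Q\<in>ac.orbit ` R - {to_ac ` U}. \<Prod>s\<in>Q. [:- s, 1:]) =
    smult ((-1) ^ ((card H - 1) * card (ac.orbit ` R - {to_ac ` U})))
      (pcompose (\<Prod>Q\<in>ac.orbit ` R - {to_ac ` U}. [:- (\<Prod>s\<in>Q. s), 1:]) ac.xpoly)"
proof (rule prod_free_orbits)
  fix Q assume "Q \<in> ac.orbit ` R - {to_ac ` U}"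
  then obtain r where r: "r \<in> R" "Q = ac.orbit r" "ac.orbit r \<noteq> to_ac ` U" by blast
  have "card (ac.stab r) = 1"
  proof (rule ac_stab_card, rule ccontr)
    fix g assume g: "g \<in> H" "aff_app (ac_pair g) r = r" "g \<noteq> (1, 0)"
    define u where "u = snd g / (1 - fst g)"
    have "r = to_ac u" "u \<in> U" using ac_fixed_rational[OF g(2,3)] g by (auto simp: u_def U_def)
    then have "r \<in> ac.orbit (to_ac a)" by (simp add: ac_orbit_a)
    then show False using ac.orbit_eq r(3) ac_orbit_a by metis
  qed
  then show "\<exists>r. Q = ac.orbit r \<and> card (ac.stab r) = 1" using r by blast
qed (use R(1) in simp)

lemma U_orbit_iff: "to_ac ` U \<in> ac.orbit ` R \<longleftrightarrow> poly f a = 0"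
proof
  assume "to_ac ` U \<in> ac.orbit ` R"
  then have "to_ac ` U \<subseteq> R" using Union_orbits by blast
  moreover have "a \<in> U" using orbit_self orbit_a by metis
  ultimately show "poly f a = 0" using to_ac_R_iff by blast
next
  assume "poly f a = 0"
  then show "to_ac ` U \<in> ac.orbit ` R" using to_ac_R_iff ac_orbit_a by blast
qed

text \<open>In both cases \<open>s = w ^ t\<close>. If \<open>f\<close> does not vanish on
  \<open>U\<close>, then \<open>m = 2 * t\<close> and \<open>s ^ 2 = w ^ m\<close>. Otherwise
  \<open>m = 2 * t + 1\<close>, and the missing factor \<open>w\<close> is contributed by the roots
  in \<open>U\<close>. Up to the sign \<open>A\<close>, \<open>w ^ m\<close> is \<open>xpoly\<close>
  minus \<mu>.\<close>

lemma nontrivial_character: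
  defines "QQ \<equiv> ac.orbit ` R"
  shows "\<exists>h s. map_poly to_ac h = smult (to_ac c * (-1) ^ ((m - 1) * (card QQ - 1)))
      ([:- to_ac \<mu>, 1:] * (\<Prod>Q\<in>QQ - {to_ac ` U}. [:- (\<Prod>r\<in>Q. r), 1:])) \<and>
    f * s ^ 2 = pcompose h xpoly \<and> s \<noteq> 0 \<and> (\<forall>g\<in>H. smult (\<gamma> g) (pcompose s (aff_poly g)) = s)"
proof -
  define F where "F = (\<Prod>Q\<in>QQ - {to_ac ` U}. [:- (\<Prod>r\<in>Q. r), 1:])"
  define A where "A = ((-1)::'k alg_closure) ^ (card H - 1)"
  have fQ: "finite QQ" "QQ \<noteq> {}" using R(1) R_nonempty by (auto simp: QQ_def)
  have AA: "A * A = 1" by (simp add: A_def minus_one_power_sq)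
  have other: "(\<Prod>Q\<in>QQ - {to_ac ` U}. \<Prod>s\<in>Q. [:- s, 1:]) = smult (A ^ card (QQ - {to_ac ` U})) (pcompose F ac.xpoly)"
    using prod_other_orbits by (simp add: QQ_def F_def A_def power_mult)
  have wm: "map_poly to_ac w ^ m = smult A (pcompose [:- to_ac \<mu>, 1:] ac.xpoly)"
    using w_power by (simp add: A_def)
  have "\<exists>s. map_poly to_ac (f * s ^ 2) = pcompose (smult (to_ac c * (-1) ^ ((m - 1) * (card QQ - 1))) ([:- to_ac \<mu>, 1:] * F)) ac.xpoly
    \<and> s \<noteq> 0 \<and> (\<forall>g\<in>H. smult (\<gamma> g) (pcompose s (aff_poly g)) = s)"
  proof (cases "poly f a = 0")
    case False
    then have nU: "to_ac ` U \<notin> QQ" using U_orbit_iff by (simp add: QQ_def)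
    obtain t where t: "m = 2 * t" "\<forall>g\<in>H. \<gamma> g = fst g ^ t" using \<gamma>_eq_multiplier_power[OF False] by blast
    \<comment> \<open>Now \<open>A = -1\<close>, once for each orbit and once for
      \<open>w ^ m\<close>. As \<open>m\<close> is even, \<open>|R/G| + 1\<close> has the parity of
      \<open>(m - 1) * (|R/G| - 1)\<close>.\<close>
    have "even (card H)" using card_orbit[of a] t(1) by (simp flip: m_stab)
    then have A1: "A = -1" using card_pos by (simp add: A_def)
    have "map_poly to_ac (f * (w ^ t) ^ 2) = smult (to_ac c) (\<Prod>r\<in>R. [:- r, 1:]) * map_poly to_ac w ^ m"
      by (simp add: map_poly_to_ac_mult map_poly_to_ac_power R(2) t(1) mult.commute flip: power_mult)
    also have "(\<Prod>r\<in>R. [:- r, 1:]) = smult (A ^ card QQ) (pcompose F ac.xpoly)"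
      using prod_orbits[of "\<lambda>r. [:- r, 1:]"] other nU by (simp add: QQ_def)
    also have "smult (to_ac c) (smult (A ^ card QQ) (pcompose F ac.xpoly)) * map_poly to_ac w ^ m
       = smult (to_ac c * (A * A ^ card QQ)) (pcompose ([:- to_ac \<mu>, 1:] * F) ac.xpoly)"
      unfolding wm pcompose_mult by (simp only: mult_smult_left mult_smult_right smult_smult mult_ac)
    also have "A * A ^ card QQ = (-1) ^ ((m - 1) * (card QQ - 1))"
    proof -
      obtain n where n: "card QQ = Suc n" using fQ by (cases "card QQ") auto
      have "odd (m - 1)" using t(1) m_pos by auto
      then show ?thesis by (simp add: n A1 power_mult)
    qed
    finally have "map_poly to_ac (f * (w ^ t) ^ 2) = pcompose (smult (to_ac c * (-1) ^ ((m - 1) * (card QQ - 1))) ([:- to_ac \<mu>, 1:] * F)) ac.xpoly"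
      by (simp only: pcompose_smult)
    moreover have "smult (\<gamma> g) (pcompose (w ^ t) (aff_poly g)) = w ^ t" if g: "g \<in> H" for g
    proof -
      obtain h where h: "h \<in> stab a" "fst h = fst g" using ex_stab[OF g] by blast
      then have "\<gamma> g ^ 2 = 1"
        using stab_nonroot[OF _ _ False, of h] \<gamma>_same_multiplier[OF _ g, of h] by (auto simp: stab_def)
      then show ?thesis using t(2) g
        by (simp add: pcompose_power w_semi smult_power power2_eq_square)
    qed
    ultimately show ?thesis using w_nz by (intro exI[of _ "w ^ t"]) auto
  next
    case True
    then have U: "to_ac ` U \<in> QQ" using U_orbit_iff by (simp add: QQ_def)
    obtain t where t: "m = 2 * t + 1" using multiplier_eq_\<gamma>_square(1)[OF True] oddE by blast
    \<comment> \<open>\<open>A\<close> is the product of all multipliers, so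
      \<open>A ^ m = 1\<close>; being a sign with \<open>m\<close> odd, it is 1. The sign in the
      claim is 1 as well, \<open>m - 1\<close> being even.\<close>
    have pow_m: "fst g ^ m = 1" if "g \<in> H" for g
      using multiplier_eq_\<gamma>_square(2,3)[OF True that] by (metis power_mult mult.commute power_one)
    have "(\<Prod>g\<in>H. fst g) ^ m = 1" using pow_m by (simp add: prod_power_distrib)
    then have "to_ac (\<Prod>g\<in>H. fst g) ^ m = 1" by (metis to_ac_power to_ac_1)
    moreover have "to_ac (\<Prod>g\<in>H. fst g) = A"
    proof -
      have "(\<Prod>g\<in>ac_pair ` H. fst g) = (\<Prod>g\<in>H. fst (ac_pair g))" by (simp add: prod.reindex[OF inj_ac_pair])
      then show ?thesis using sign by (simp add: A_def to_ac_prod ac_pair_def)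
    qed
    ultimately have A1: "A = 1" using AA by (simp add: t power_mult power2_eq_square)
    have wU: "map_poly to_ac w = (\<Prod>s\<in>to_ac ` U. [:- s, 1:])"
      by (simp add: w_def map_poly_to_ac_prod prod.reindex inj_on_def map_poly_pCons)
    have "(\<Prod>r\<in>R. [:- r, 1:]) = map_poly to_ac w * pcompose F ac.xpoly"
      using prod_orbits[of "\<lambda>r. [:- r, 1:]"] other A1 wU prod.remove[OF fQ(1) U, of "\<lambda>Q. \<Prod>s\<in>Q. [:- s, 1:]"]
      by (simp add: QQ_def)
    moreover have "(w ^ t) ^ 2 = w ^ (2 * t)" by (metis power_mult mult.commute)
    ultimately have "map_poly to_ac (f * (w ^ t) ^ 2) = smult (to_ac c) (map_poly to_ac w * pcompose F ac.xpoly) * map_poly to_ac w ^ (2 * t)"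
      by (simp only: map_poly_to_ac_mult map_poly_to_ac_power R(2))
    also have "\<dots> = smult (to_ac c) (map_poly to_ac w ^ m * pcompose F ac.xpoly)"
      by (simp add: t mult_ac)
    also have "\<dots> = pcompose (smult (to_ac c * (-1) ^ ((m - 1) * (card QQ - 1))) ([:- to_ac \<mu>, 1:] * F)) ac.xpoly"
    proof -
      have "((-1)::'k alg_closure) ^ ((m - 1) * (card QQ - 1)) = 1" by (simp add: t power_mult)
      moreover have "map_poly to_ac w ^ m = pcompose [:- to_ac \<mu>, 1:] ac.xpoly" using wm by (simp add: A1)
      ultimately show ?thesis by (simp only: pcompose_mult pcompose_smult mult_1_right)
    qed
    finally have "map_poly to_ac (f * (w ^ t) ^ 2) = pcompose (smult (to_ac c * (-1) ^ ((m - 1) * (card QQ - 1))) ([:- to_ac \<mu>, 1:] * F)) ac.xpoly" .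
    moreover have "smult (\<gamma> g) (pcompose (w ^ t) (aff_poly g)) = w ^ t" if g: "g \<in> H" for g
    proof -
      have "\<gamma> g * fst g ^ t = \<gamma> g ^ m"
        using multiplier_eq_\<gamma>_square(2)[OF True g] by (simp add: t power_mult)
      then show ?thesis using multiplier_eq_\<gamma>_square(3)[OF True g] g
        by (simp add: pcompose_power w_semi smult_power)
    qed
    ultimately show ?thesis using w_nz by (intro exI[of _ "w ^ t"]) auto
  qed
  then obtain s where s: "map_poly to_ac (f * s ^ 2) = pcompose (smult (to_ac c * (-1) ^ ((m - 1) * (card QQ - 1))) ([:- to_ac \<mu>, 1:] * F)) ac.xpoly"
    "s \<noteq> 0" "\<forall>g\<in>H. smult (\<gamma> g) (pcompose s (aff_poly g)) = s" by blast
  then show ?thesis using descend[of s] unfolding F_def by blast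
qed

end

section \<open>Curves as spaces of valuation rings\<close>

lemma topspace_curve_of:
  assumes "carrier K \<in> valuation_rings K \<kappa>"
  shows "topspace (pts (curve_of K \<kappa>)) = valuation_rings K \<kappa>"
proof
  have "openin (pts (curve_of K \<kappa>)) (valuation_rings K \<kappa>)"
    using assms by (simp add: openin_curve_of)
  then show "valuation_rings K \<kappa> \<subseteq> topspace (pts (curve_of K \<kappa>))" by (rule openin_subset)
  show "topspace (pts (curve_of K \<kappa>)) \<subseteq> valuation_rings K \<kappa>"
    using openin_topspace[of "pts (curve_of K \<kappa>)"] unfolding openin_curve_of by auto
qed

text \<open>Abstract fields without a type-class structure are treated through an embedding in a field type.\<close>

locale embedded_field =
  fixes K :: "'r ring" (structure) and \<iota> :: "'r \<Rightarrow> 'a::field"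
  assumes carrier: "carrier K = UNIV" and inj: "inj \<iota>"
    and add: "\<iota> (x \<oplus> y) = \<iota> x + \<iota> y" and mult: "\<iota> (x \<otimes> y) = \<iota> x * \<iota> y"
    and one: "\<iota> \<one> = 1" and zero: "\<iota> \<zero> = 0"
    and ex_uminus: "\<exists>y. \<iota> y = - \<iota> x" and ex_inverse: "\<exists>y. \<iota> y = inverse (\<iota> x)"
begin

lemma eq_iff: "x = y \<longleftrightarrow> \<iota> x = \<iota> y"
  using inj by (auto simp: inj_def)

lemma ring_K: "ring K"
proof (rule ringI)
  show "abelian_group K"
  proof (rule abelian_groupI)
    fix x show "\<exists>y\<in>carrier K. y \<oplus> x = \<zero>"
    proof -
      obtain y where "\<iota> y = - \<iota> x" using ex_uminus by blast
      then have "y \<oplus> x = \<zero>" by (simp add: eq_iff add zero)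
      then show ?thesis by (auto simp: carrier)
    qed
  qed (auto simp: carrier eq_iff add zero)
  show "Group.monoid K" by (rule monoidI) (auto simp: carrier eq_iff mult one)
qed (auto simp: carrier eq_iff add mult algebra_simps)

lemma uminus: "\<iota> (\<ominus> x) = - \<iota> x"
proof -
  have "\<ominus> x \<oplus> x = \<zero>"
    by (rule abelian_group.l_neg) (use ring_K ring.is_abelian_group carrier in auto)
  then have "\<iota> (\<ominus> x) + \<iota> x = 0" by (simp flip: add add: zero)
  then show ?thesis by (rule eq_neg_iff_add_eq_0[THEN iffD2])
qed

lemma inverse: "z \<noteq> \<zero> \<Longrightarrow> \<iota> (inv z) = inverse (\<iota> z)"
proof -
  assume z: "z \<noteq> \<zero>"
  then have z0: "\<iota> z \<noteq> 0" using eq_iff zero by metis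
  obtain y where y: "\<iota> y = inverse (\<iota> z)" using ex_inverse by blast
  have "z \<otimes> y = \<one>" "y \<otimes> z = \<one>" using z0 by (auto simp: eq_iff mult one y)
  then have "inv z = y"
    by (intro monoid.inv_unique'[symmetric] ring.is_monoid ring_K) (auto simp: carrier)
  then show ?thesis using y by simp
qed

lemma mem_image_iff: "\<iota> x \<in> \<iota> ` V \<longleftrightarrow> x \<in> V"
  using inj by (auto simp: inj_def)

lemma subring_iff_image: "subring P K \<longleftrightarrow> subring_set (\<iota> ` P)"
proof
  assume P: "subring P K"
  show "subring_set (\<iota> ` P)"
    unfolding subring_set_def
  proof (intro conjI ballI)
    show "1 \<in> \<iota> ` P" using subringE(3)[OF P] one by (metis imageI)
    fix x y assume "x \<in> \<iota> ` P" "y \<in> \<iota> ` P"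
    then obtain x' y' where xy: "x = \<iota> x'" "y = \<iota> y'" "x' \<in> P" "y' \<in> P" by blast
    have "x - y = \<iota> (x' \<oplus> (\<ominus> y'))" by (simp add: xy add uminus)
    then show "x - y \<in> \<iota> ` P" using subringE(5,7)[OF P] xy by blast
    have "x * y = \<iota> (x' \<otimes> y')" by (simp add: xy mult)
    then show "x * y \<in> \<iota> ` P" using subringE(6)[OF P] xy by blast
  qed
next
  assume P: "subring_set (\<iota> ` P)"
  note D = subring_setD[OF P]
  show "subring P K"
  proof (rule ring.subringI[OF ring_K])
    show "\<one> \<in> P" using D(1) by (simp only: mem_image_iff flip: one)
    show "\<ominus> h \<in> P" if "h \<in> P" for h using D(4)[of "\<iota> h"] that by (simp only: mem_image_iff flip: uminus)
    show "h1 \<otimes> h2 \<in> P" if "h1 \<in> P" "h2 \<in> P" for h1 h2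
      using D(6)[of "\<iota> h1" "\<iota> h2"] that by (simp only: mem_image_iff flip: mult)
    show "h1 \<oplus> h2 \<in> P" if "h1 \<in> P" "h2 \<in> P" for h1 h2
      using D(5)[of "\<iota> h1" "\<iota> h2"] that by (simp only: mem_image_iff flip: add)
  qed (simp add: carrier)
qed

lemma range_subfield: "subfield_set (range \<iota>)"
  unfolding subfield_set_def subring_set_def
proof (intro conjI ballI)
  show "1 \<in> range \<iota>" using one by (metis rangeI)
  fix x y assume "x \<in> range \<iota>" "y \<in> range \<iota>"
  then obtain x' y' where xy: "x = \<iota> x'" "y = \<iota> y'" by blast
  have "x - y = \<iota> (x' \<oplus> (\<ominus> y'))" by (simp add: xy add uminus)
  then show "x - y \<in> range \<iota>" by simp
  show "x * y \<in> range \<iota>" by (simp add: xy flip: mult)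
next
  fix x assume "x \<in> range \<iota>"
  then show "inverse x \<in> range \<iota>" using ex_inverse by (metis imageE rangeI)
qed

lemma valuation_rings_iff:
  "P \<in> valuation_rings K \<kappa> \<longleftrightarrow> val_ring (range \<iota>) (\<iota> ` P) \<and> range \<kappa> \<subseteq> P"
proof -
  note mem = mem_image_iff[symmetric]
  have "(\<forall>z\<in>carrier K - {\<zero>}. z \<in> P \<or> inv z \<in> P) \<longleftrightarrow> (\<forall>z\<in>range \<iota>. z \<in> \<iota> ` P \<or> inverse z \<in> \<iota> ` P)"
    if "subring_set (\<iota> ` P)"
  proof -
    have "0 \<in> \<iota> ` P" using subring_setD(2)[OF that] .
    then have "(\<forall>z\<in>range \<iota>. z \<in> \<iota> ` P \<or> inverse z \<in> \<iota> ` P) \<longleftrightarrow> (\<forall>z\<in>UNIV - {\<zero>}. \<iota> z \<in> \<iota> ` P \<or> inverse (\<iota> z) \<in> \<iota> ` P)"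
      using zero by auto
    also have "\<dots> \<longleftrightarrow> (\<forall>z\<in>UNIV - {\<zero>}. z \<in> P \<or> inv z \<in> P)"
    proof (rule ball_cong[OF refl])
      fix z assume "z \<in> UNIV - {\<zero>}"
      then have "inverse (\<iota> z) = \<iota> (inv z)" using inverse[of z] by simp
      then show "\<iota> z \<in> \<iota> ` P \<or> inverse (\<iota> z) \<in> \<iota> ` P \<longleftrightarrow> z \<in> P \<or> inv z \<in> P"
        by (simp only: mem_image_iff)
    qed
    finally show ?thesis by (simp add: carrier)
  qed
  then show ?thesis unfolding valuation_rings_def val_ring_def subring_iff_image by auto
qed

lemma UNIV_valuation_ring: "UNIV \<in> valuation_rings K \<kappa>"
  using range_subfield by (auto simp: valuation_rings_iff val_ring_def subfield_set_def)

text \<open>The extension is made in the whole field type and then cut down to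
  \<open>range \<iota>\<close>, which preserves valuation rings.\<close>

lemma valuation_ring_extend:
  assumes "subfield_set (\<iota> ` L)" "val_ring (\<iota> ` L) (\<iota> ` Q)" "range \<kappa> \<subseteq> Q"
  shows "\<exists>P\<in>valuation_rings K \<kappa>. P \<inter> L = Q"
proof -
  obtain A where A: "val_ring UNIV A" "A \<inter> \<iota> ` L = \<iota> ` Q" using val_ring_extend[OF assms(1,2)] by blast
  define P where "P = \<iota> -` A"
  have "\<iota> ` P = A \<inter> range \<iota>" by (auto simp: P_def)
  then have "val_ring (range \<iota>) (\<iota> ` P)" using val_ring_Int[OF A(1) range_subfield] by simp
  moreover have "P \<inter> L = Q"
  proof -
    have "x \<in> P \<inter> L \<longleftrightarrow> \<iota> x \<in> A \<inter> \<iota> ` L" for x by (simp add: P_def mem_image_iff)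
    then show ?thesis by (simp add: A(2) mem_image_iff set_eq_iff)
  qed
  moreover from this have "range \<kappa> \<subseteq> P" using assms(3) by blast
  ultimately show ?thesis using valuation_rings_iff by blast
qed

lemma valuation_rings_conjugate:
  fixes S :: "('r \<Rightarrow> 'r) set"
  assumes fin: "finite S" and ident: "id \<in> S" and comp: "\<And>\<sigma> \<tau>. \<sigma> \<in> S \<Longrightarrow> \<tau> \<in> S \<Longrightarrow> \<sigma> \<circ> \<tau> \<in> S"
    and S: "\<And>\<sigma> x y. \<sigma> \<in> S \<Longrightarrow> \<sigma> (x \<oplus> y) = \<sigma> x \<oplus> \<sigma> y" "\<And>\<sigma> x y. \<sigma> \<in> S \<Longrightarrow> \<sigma> (x \<otimes> y) = \<sigma> x \<otimes> \<sigma> y"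
      "\<And>\<sigma>. \<sigma> \<in> S \<Longrightarrow> \<sigma> \<one> = \<one>"
    and P: "P \<in> valuation_rings K \<kappa>" and P': "P' \<in> valuation_rings K \<kappa>'"
    and same: "\<And>z. (\<And>\<sigma>. \<sigma> \<in> S \<Longrightarrow> \<sigma> z = z) \<Longrightarrow> z \<in> P \<longleftrightarrow> z \<in> P'"
  shows "\<exists>\<sigma>\<in>S. {z. \<sigma> z \<in> P} = P'"
proof -
  \<comment> \<open>The action transported along \<iota>, made extensional to fit
    \<open>finite_action\<close>.\<close>
  define T where "T \<sigma> = restrict (\<iota> \<circ> \<sigma> \<circ> inv_into UNIV \<iota>) (range \<iota>)" for \<sigma>
  have T: "T \<sigma> (\<iota> x) = \<iota> (\<sigma> x)" for \<sigma> x using inj by (simp add: T_def)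
  have T_comp: "compose (range \<iota>) (T \<sigma>) (T \<tau>) = T (\<sigma> \<circ> \<tau>)" for \<sigma> \<tau>
    by (rule extensionalityI[of _ "range \<iota>"]) (auto simp: compose_eq T, auto simp: T_def)
  have T_id: "T id = restrict id (range \<iota>)"
    using inj by (auto simp: T_def fun_eq_iff)
  interpret finite_action "range \<iota>" "T ` S"
  proof
    show "subfield_set (range \<iota>)" by (rule range_subfield)
    show "finite (T ` S)" using fin by simp
    show "restrict id (range \<iota>) \<in> T ` S" using ident T_id by (metis image_eqI)
    fix \<sigma> assume "\<sigma> \<in> T ` S"
    then obtain s where s: "s \<in> S" "\<sigma> = T s" by blast
    show "\<sigma> \<in> extensional (range \<iota>)" by (simp add: s T_def)
    show "\<sigma> 1 = 1" using T[of s \<one>] S(3)[OF s(1)] by (simp add: s one)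
    show "\<sigma> x \<in> range \<iota>" if "x \<in> range \<iota>" for x using that by (auto simp: s T)
    fix x y assume "x \<in> range \<iota>" "y \<in> range \<iota>"
    then obtain x' y' where xy: "x = \<iota> x'" "y = \<iota> y'" by blast
    show "\<sigma> (x + y) = \<sigma> x + \<sigma> y" using T[of s "x' \<oplus> y'"] S(1)[OF s(1)] by (simp add: s xy T add)
    show "\<sigma> (x * y) = \<sigma> x * \<sigma> y" using T[of s "x' \<otimes> y'"] S(2)[OF s(1)] by (simp add: s xy T mult)
  next
    fix \<sigma> \<tau> assume "\<sigma> \<in> T ` S" "\<tau> \<in> T ` S"
    then show "compose (range \<iota>) \<sigma> \<tau> \<in> T ` S" using comp by (auto simp: T_comp)
  qed
  note mem = mem_image_iff
  have "\<iota> ` P \<inter> fixed = \<iota> ` P' \<inter> fixed"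
  proof -
    have "\<iota> z \<in> \<iota> ` P \<longleftrightarrow> \<iota> z \<in> \<iota> ` P'" if "\<iota> z \<in> fixed" for z
    proof -
      have "\<sigma> z = z" if s: "\<sigma> \<in> S" for \<sigma>
        using \<open>\<iota> z \<in> fixed\<close> s T[of \<sigma> z] by (auto simp: fixed_def eq_iff)
      then show ?thesis using same mem by blast
    qed
    then show ?thesis by (auto simp: fixed_def)
  qed
  then obtain \<sigma> where s: "\<sigma> \<in> S" "pull (T \<sigma>) (\<iota> ` P) = \<iota> ` P'"
    using val_rings_conjugate[of "\<iota> ` P" "\<iota> ` P'"] P P' by (auto simp: valuation_rings_iff)
  have "{z. \<sigma> z \<in> P} = P'"
  proof (rule Set.set_eqI)
    fix z
    have "z \<in> P' \<longleftrightarrow> \<iota> z \<in> pull (T \<sigma>) (\<iota> ` P)" by (simp add: s(2) mem)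
    then show "z \<in> {z. \<sigma> z \<in> P} \<longleftrightarrow> z \<in> P'" by (simp add: pull_def T mem)
  qed
  then show ?thesis using s(1) by blast
qed

end

section \<open>Automorphisms and quotients of curves\<close>

lemma rs_isoD:
  assumes "rs_iso S T g"
  shows "homeomorphic_map (pts S) (pts T) (fst g)"
    "openin (pts T) V \<Longrightarrow> snd g V \<in> ring_iso (sect T V) (sect S (preim S (fst g) V))"
    "openin (pts T) V \<Longrightarrow> snd g V (const T V c) = const S (preim S (fst g) V) c"
    "openin (pts T) V \<Longrightarrow> openin (pts T) W \<Longrightarrow> W \<subseteq> V \<Longrightarrow> s \<in> carrier (sect T V) \<Longrightarrow>
      snd g W (restr T V W s) = restr S (preim S (fst g) V) (preim S (fst g) W) (snd g V s)"
  using assms unfolding rs_iso_def case_prod_beta by blast+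

lemma sect_curve_of: "V \<noteq> {} \<Longrightarrow> sect (curve_of K \<kappa>) V = K\<lparr>carrier := \<Inter>V\<rparr>"
  by (simp add: curve_of_def)

lemma const_curve_of: "V \<noteq> {} \<Longrightarrow> const (curve_of K \<kappa>) V = \<kappa>"
  by (simp add: curve_of_def fun_eq_iff)

lemma curve_of_simps:
  "sect (curve_of K \<kappa>) {} = K\<lparr>carrier := {\<zero>\<^bsub>K\<^esub>}, monoid.one := \<zero>\<^bsub>K\<^esub>\<rparr>"
  "restr (curve_of K \<kappa>) V W s = (if W = {} then \<zero>\<^bsub>K\<^esub> else s)"
  "const (curve_of K \<kappa>) V c = (if V = {} then \<zero>\<^bsub>K\<^esub> else \<kappa> c)"
  by (simp_all add: curve_of_def)

lemma restr_curve_of: "W \<noteq> {} \<Longrightarrow> restr (curve_of K \<kappa>) V W s = s"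
  by (simp add: curve_of_def)

lemma quotient_space_simps:
  "sect (quotient_space S G) V = (sect S (saturation S G V))\<lparr>carrier :=
     {s \<in> carrier (sect S (saturation S G V)). \<forall>g\<in>G. snd g (saturation S G V) s = s}\<rparr>"
  "restr (quotient_space S G) V W = restr S (saturation S G V) (saturation S G W)"
  "const (quotient_space S G) V = const S (saturation S G V)"
  by (simp_all add: quotient_space_def)

text \<open>The argument \<open>z\<close> is a section over the open set of all points where it is regular.\<close>

definition pullback :: "'r ring \<Rightarrow> ('k \<Rightarrow> 'r) \<Rightarrow> ('r set, 'r) auto \<Rightarrow> 'r \<Rightarrow> 'r" where
  "pullback K \<kappa> g z = snd g {P \<in> valuation_rings K \<kappa>. z \<in> P} z"

text \<open>Finiteness of poles makes \<open>reg z\<close> open, so every element of the field is a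
  section over a nonempty open set. An automorphism of the curve therefore induces a map on the
  whole field.\<close>

locale field_curve = embedded_field K \<iota> for K :: "'r ring" (structure) and \<iota> :: "'r \<Rightarrow> 'a::field" +
  fixes \<kappa> :: "'k \<Rightarrow> 'r"
  assumes finite_poles: "finite {P \<in> valuation_rings K \<kappa>. z \<notin> P}"
begin

definition pl :: "'r set set" where "pl = valuation_rings K \<kappa>"

definition reg :: "'r \<Rightarrow> 'r set set" where "reg z = {P \<in> pl. z \<in> P}"

abbreviation crv where "crv \<equiv> curve_of K \<kappa>"

abbreviation Aut where "Aut \<equiv> aut_group crv"

lemma UNIV_pl: "UNIV \<in> pl"
  by (simp add: pl_def UNIV_valuation_ring)

lemma topspace_crv: "topspace (pts crv) = pl"
  unfolding pl_def by (rule topspace_curve_of) (simp add: carrier UNIV_valuation_ring)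

lemma openin_crv: "openin (pts crv) V \<longleftrightarrow> V = {} \<or> (V \<subseteq> pl \<and> UNIV \<in> V \<and> finite (pl - V))"
  by (simp add: openin_curve_of pl_def carrier)

lemma open_reg: "openin (pts crv) (reg z)" "reg z \<noteq> {}" "z \<in> \<Inter>(reg z)"
proof -
  have "pl - reg z = {P \<in> valuation_rings K \<kappa>. z \<notin> P}" by (auto simp: reg_def pl_def)
  then show "openin (pts crv) (reg z)" using finite_poles UNIV_pl by (auto simp: openin_crv reg_def)
  show "reg z \<noteq> {}" using UNIV_pl by (auto simp: reg_def)
  show "z \<in> \<Inter>(reg z)" by (auto simp: reg_def)
qed

lemma open_subset: "openin (pts crv) V \<Longrightarrow> V \<subseteq> pl"
  by (auto simp: openin_crv)

lemma open_Int: "openin (pts crv) V \<Longrightarrow> openin (pts crv) W \<Longrightarrow> V \<noteq> {} \<Longrightarrow> W \<noteq> {} \<Longrightarrow>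
    openin (pts crv) (V \<inter> W) \<and> V \<inter> W \<noteq> {}"
  using openin_Int[of "pts crv" V W] by (auto simp: openin_crv)

context
  fixes g assumes g: "rs_iso crv crv g"
begin

lemma aut_homeo: "homeomorphic_map (pts crv) (pts crv) (fst g)"
  using g by (rule rs_isoD)

lemma aut_bij: "bij_betw (fst g) pl pl"
  using aut_homeo by (simp add: homeomorphic_map_def quotient_map_def bij_betw_def topspace_crv)

lemma aut_preim:
  assumes "openin (pts crv) V" "V \<noteq> {}"
  shows "openin (pts crv) (preim crv (fst g) V)" "preim crv (fst g) V \<noteq> {}"
proof -
  show "openin (pts crv) (preim crv (fst g) V)"
    unfolding preim_def
    using homeomorphic_imp_continuous_map[OF aut_homeo] assms(1) by (rule openin_continuous_map_preimage)
  obtain P where "P \<in> V" "P \<in> pl" using assms open_subset by blast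
  then have "P \<in> fst g ` pl" using aut_bij by (simp add: bij_betw_def)
  then obtain P' where "P' \<in> pl" "fst g P' = P" by blast
  then show "preim crv (fst g) V \<noteq> {}"
    using \<open>P \<in> V\<close> by (auto simp: preim_def topspace_crv)
qed

lemma aut_ring_iso:
  assumes "openin (pts crv) V" "V \<noteq> {}"
  shows "snd g V \<in> ring_iso (K\<lparr>carrier := \<Inter>V\<rparr>) (K\<lparr>carrier := \<Inter>(preim crv (fst g) V)\<rparr>)"
  using rs_isoD(2)[OF g assms(1)] by (simp only: sect_curve_of[OF assms(2)] sect_curve_of[OF aut_preim(2)[OF assms]])

lemma aut_restr:
  assumes "openin (pts crv) V" "openin (pts crv) W" "W \<noteq> {}" "W \<subseteq> V" "s \<in> \<Inter>V"
  shows "snd g W s = snd g V s"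
proof -
  have V: "V \<noteq> {}" using assms by blast
  have "s \<in> carrier (sect crv V)" using assms(5) by (simp add: sect_curve_of[OF V])
  then show ?thesis
    using rs_isoD(4)[OF g assms(1,2,4)] by (simp only: restr_curve_of[OF assms(3)] restr_curve_of[OF aut_preim(2)[OF assms(2,3)]])
qed

lemma aut_pullback:
  assumes "openin (pts crv) V" "V \<noteq> {}" "s \<in> \<Inter>V"
  shows "snd g V s = pullback K \<kappa> g s"
proof -
  have "V \<subseteq> reg s" using assms open_subset by (auto simp: reg_def)
  then show ?thesis using aut_restr[OF open_reg(1) assms(1,2) _ open_reg(3)]
    by (simp add: pullback_def reg_def pl_def)
qed

lemma pullback_hom:
  "pullback K \<kappa> g (x \<oplus> y) = pullback K \<kappa> g x \<oplus> pullback K \<kappa> g y"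
  "pullback K \<kappa> g (x \<otimes> y) = pullback K \<kappa> g x \<otimes> pullback K \<kappa> g y"
  "pullback K \<kappa> g \<one> = \<one>"
  "pullback K \<kappa> g (\<kappa> c) = \<kappa> c"
proof -
  define V where "V = reg x \<inter> reg y"
  have V: "openin (pts crv) V" "V \<noteq> {}" using open_Int[OF open_reg(1,1,2,2)] by (simp_all add: V_def)
  have xy: "x \<in> \<Inter>V" "y \<in> \<Inter>V" by (auto simp: V_def reg_def)
  have sub: "subring P K" if "P \<in> V" for P using that by (auto simp: V_def reg_def pl_def valuation_rings_def)
  have mem: "x \<oplus> y \<in> \<Inter>V" "x \<otimes> y \<in> \<Inter>V" "\<one> \<in> \<Inter>V"
    using xy subringE(3,6,7)[OF sub] by auto
  have h: "snd g V \<in> ring_hom (K\<lparr>carrier := \<Inter>V\<rparr>) (K\<lparr>carrier := \<Inter>(preim crv (fst g) V)\<rparr>)"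
    using aut_ring_iso[OF V] by (simp add: ring_iso_def)
  note p = aut_pullback[OF V xy(1)] aut_pullback[OF V xy(2)] aut_pullback[OF V mem(1)]
    aut_pullback[OF V mem(2)] aut_pullback[OF V mem(3)]
  show "pullback K \<kappa> g (x \<oplus> y) = pullback K \<kappa> g x \<oplus> pullback K \<kappa> g y"
    using ring_hom_add[OF h, of x y] xy by (simp add: p)
  show "pullback K \<kappa> g (x \<otimes> y) = pullback K \<kappa> g x \<otimes> pullback K \<kappa> g y"
    using ring_hom_mult[OF h, of x y] xy by (simp add: p)
  show "pullback K \<kappa> g \<one> = \<one>"
    using ring_hom_one[OF h] by (simp add: p)
  have k: "\<kappa> c \<in> \<Inter>V" by (auto simp: V_def reg_def pl_def valuation_rings_def)
  have "snd g V (const crv V c) = const crv (preim crv (fst g) V) c"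
    using rs_isoD(3)[OF g V(1)] .
  then show "pullback K \<kappa> g (\<kappa> c) = \<kappa> c"
    by (simp only: const_curve_of[OF V(2)] const_curve_of[OF aut_preim(2)[OF V]] aut_pullback[OF V k])
qed

lemma pullback_inj: "inj (pullback K \<kappa> g)"
proof (rule injI)
  fix x y assume e: "pullback K \<kappa> g x = pullback K \<kappa> g y"
  define V where "V = reg x \<inter> reg y"
  have V: "openin (pts crv) V" "V \<noteq> {}" using open_Int[OF open_reg(1,1,2,2)] by (simp_all add: V_def)
  have xy: "x \<in> \<Inter>V" "y \<in> \<Inter>V" by (auto simp: V_def reg_def)
  have "inj_on (snd g V) (\<Inter>V)" using aut_ring_iso[OF V] by (simp add: ring_iso_def bij_betw_def)
  then show "x = y" using e xy by (auto simp: inj_on_def simp flip: aut_pullback[OF V])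
qed

text \<open>The comorphism preserves regularity, which gives one inclusion. For the other, if
  \<open>t\<close>, the pullback of \<open>z\<close>, is regular at \<open>P\<close>, then
  surjectivity over the open image of \<open>reg t\<close> yields a section \<open>s\<close> with
  pullback \<open>t\<close>, and injectivity gives \<open>s = z\<close>.\<close>

lemma aut_point:
  assumes P: "P \<in> pl" shows "fst g P = {z. pullback K \<kappa> g z \<in> P}"
proof (intro equalityI subsetI)
  have gP: "fst g P \<in> pl" using aut_bij P by (auto simp: bij_betw_def)
  fix z assume z: "z \<in> fst g P"
  then have "P \<in> preim crv (fst g) (reg z)" using P gP by (simp add: preim_def topspace_crv reg_def)
  moreover have "snd g (reg z) z \<in> \<Inter>(preim crv (fst g) (reg z))"
    using aut_ring_iso[OF open_reg(1,2)] open_reg(3)[of z] by (auto simp: ring_iso_def ring_hom_def Pi_def)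
  ultimately show "z \<in> {z. pullback K \<kappa> g z \<in> P}" using aut_pullback[OF open_reg, of z] by auto
next
  fix z assume "z \<in> {z. pullback K \<kappa> g z \<in> P}"
  define t where "t = pullback K \<kappa> g z"
  have t: "t \<in> P" using \<open>z \<in> _\<close> by (simp add: t_def)
  define V where "V = fst g ` reg t"
  have pV: "preim crv (fst g) V = reg t"
    using aut_bij by (auto simp: preim_def topspace_crv V_def reg_def bij_betw_def inj_on_def)
  have "openin (pts crv) V"
    using homeomorphic_map_openness[OF aut_homeo, of "reg t"] open_subset[OF open_reg(1)] open_reg(1)
    by (simp add: V_def topspace_crv)
  moreover have "V \<noteq> {}" using open_reg(2) by (simp add: V_def)
  ultimately have V: "openin (pts crv) V" "V \<noteq> {}" by auto
  have "snd g V ` (\<Inter>V) = \<Inter>(reg t)" using aut_ring_iso[OF V] by (simp add: ring_iso_def bij_betw_def pV)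
  then obtain s where s: "s \<in> \<Inter>V" "snd g V s = t" using open_reg(3)[of t] by (metis imageE)
  then have "s = z" using pullback_inj by (auto simp: aut_pullback[OF V] t_def inj_def)
  moreover have "fst g P \<in> V" using P t by (auto simp: V_def reg_def)
  ultimately show "z \<in> fst g P" using s by auto
qed

lemma pulls_back_pullback: "pulls_back crv g s t \<Longrightarrow> pullback K \<kappa> g s = t"
proof -
  assume "pulls_back crv g s t"
  then obtain V where V: "openin (pts crv) V" "V \<noteq> {}" "s \<in> carrier (sect crv V)" "snd g V s = t"
    unfolding pulls_back_def by blast
  then have "s \<in> \<Inter>V" by (simp add: sect_curve_of[OF V(2)])
  then show ?thesis using aut_pullback[OF V(1,2)] V(4) by simp
qed

end

lemma aut_groupD: "g \<in> carrier (Aut) \<Longrightarrow> rs_iso crv crv g"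
  by (auto simp: aut_group_def)

text \<open>By \<open>aut_point\<close> the pullback determines the map on points; the
  extensionality conditions in \<open>aut_group\<close> leave no freedom elsewhere.\<close>

lemma aut_eqI:
  assumes "g \<in> carrier (Aut)" "h \<in> carrier (Aut)" and eq: "pullback K \<kappa> g = pullback K \<kappa> h"
  shows "g = h"
proof -
  note gi = aut_groupD[OF assms(1)] and hi = aut_groupD[OF assms(2)]
  have "fst g = fst h"
  proof (rule extensionalityI[of _ pl])
    show "fst g \<in> extensional pl" "fst h \<in> extensional pl"
      using assms(1,2) by (auto simp: aut_group_def topspace_crv)
    show "fst g P = fst h P" if "P \<in> pl" for P
      using aut_point[OF gi that] aut_point[OF hi that] eq by simp
  qed
  moreover have "snd g V = snd h V" for V
  proof (cases "openin (pts crv) V")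
    case False
    then show ?thesis using assms(1,2) by (auto simp: aut_group_def split: prod.splits if_splits)
  next
    case True
    have e: "snd g V \<in> extensional (carrier (sect crv V))" "snd h V \<in> extensional (carrier (sect crv V))"
      using assms(1,2) True by (auto simp: aut_group_def split: prod.splits)
    show ?thesis
    proof (rule extensionalityI[OF e])
      fix s assume s: "s \<in> carrier (sect crv V)"
      show "snd g V s = snd h V s"
      proof (cases "V = {}")
        case False
        then show ?thesis using s aut_pullback[OF gi True False] aut_pullback[OF hi True False] eq
          by (simp add: sect_curve_of)
      next
        \<comment> \<open>Sections over the empty set form the zero ring, so both maps can only take
          the value zero.\<close>
        case V: True
        have "snd k V \<in> ring_iso (sect crv {}) (sect crv {})" if "rs_iso crv crv k" for k
          using rs_isoD(2)[OF that, of V] True V by (simp add: preim_def)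
        then have "snd k V s \<in> carrier (sect crv {})" if "rs_iso crv crv k" for k
          using that s V by (auto simp: ring_iso_def ring_hom_def Pi_def)
        then show ?thesis using gi hi by (simp add: curve_of_simps)
      qed
    qed
  qed
  ultimately show ?thesis by (auto simp: prod_eq_iff fun_eq_iff)
qed

lemma pullback_one: "pullback K \<kappa> \<one>\<^bsub>Aut\<^esub> = id"
proof
  fix z
  show "pullback K \<kappa> \<one>\<^bsub>Aut\<^esub> z = id z"
    using open_reg[of z] by (simp add: pullback_def aut_group_def sect_curve_of reg_def pl_def)
qed

lemma pullback_mult:
  assumes "rs_iso crv crv g" "rs_iso crv crv h"
  shows "pullback K \<kappa> (g \<otimes>\<^bsub>Aut\<^esub> h) = pullback K \<kappa> h \<circ> pullback K \<kappa> g"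
proof
  fix z
  let ?V = "preim crv (fst g) (reg z)"
  have V: "openin (pts crv) ?V" "?V \<noteq> {}" using aut_preim[OF assms(1) open_reg(1,2)] by auto
  have m: "snd g (reg z) z \<in> \<Inter>?V"
    using aut_ring_iso[OF assms(1) open_reg(1,2)] open_reg(3)[of z] by (auto simp: ring_iso_def ring_hom_def Pi_def)
  have "pullback K \<kappa> (g \<otimes>\<^bsub>Aut\<^esub> h) z = snd (g \<otimes>\<^bsub>Aut\<^esub> h) (reg z) z"
    by (simp add: pullback_def reg_def pl_def)
  also have "\<dots> = snd h ?V (snd g (reg z) z)"
    using open_reg[of z] by (simp add: aut_group_def sect_curve_of compose_eq split: prod.splits)
  also have "\<dots> = pullback K \<kappa> h (pullback K \<kappa> g z)"
    using aut_pullback[OF assms(2) V m] aut_pullback[OF assms(1) open_reg] by simp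
  finally show "pullback K \<kappa> (g \<otimes>\<^bsub>Aut\<^esub> h) z = (pullback K \<kappa> h \<circ> pullback K \<kappa> g) z" by simp
qed

text \<open>The orbit of \<open>P\<close> is sent to the trace of \<open>P\<close> on
  \<open>L\<close>. Extension of valuation rings makes this surjective, conjugacy makes it
  injective. Open sets correspond because they are cofinite and the fibres are finite; sections
  correspond because invariance means lying in \<open>range j\<close>.\<close>

theorem quotient_isomorphic:
  fixes L :: "'l ring" and j :: "'l \<Rightarrow> 'r" and \<kappa>' :: "'k \<Rightarrow> 'l"
  assumes G: "G \<subseteq> carrier (Aut)" "finite G" "\<one>\<^bsub>Aut\<^esub> \<in> G"
      "\<And>g h. g \<in> G \<Longrightarrow> h \<in> G \<Longrightarrow> g \<otimes>\<^bsub>Aut\<^esub> h \<in> G"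
    and L: "carrier L = UNIV" "inj j" "\<And>x y. j (x \<oplus>\<^bsub>L\<^esub> y) = j x \<oplus> j y" "\<And>x y. j (x \<otimes>\<^bsub>L\<^esub> y) = j x \<otimes> j y"
      "j \<one>\<^bsub>L\<^esub> = \<one>" "j \<zero>\<^bsub>L\<^esub> = \<zero>" "\<And>c. j (\<kappa>' c) = \<kappa> c"
    and range: "range j = {z. \<forall>g\<in>G. pullback K \<kappa> g z = z}"
  shows "isomorphic (quotient_space crv G) (curve_of L \<kappa>')"
proof -
  define S where "S = pullback K \<kappa> ` G"
  have Giso: "rs_iso crv crv g" if "g \<in> G" for g using that G(1) aut_groupD by blast
  have fin_S: "finite S" using G(2) by (simp add: S_def)
  have id_S: "id \<in> S" using G(3) pullback_one unfolding S_def by (metis imageI)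
  have comp_S: "\<sigma> \<circ> \<tau> \<in> S" if "\<sigma> \<in> S" "\<tau> \<in> S" for \<sigma> \<tau>
  proof -
    from that obtain g h where gh: "g \<in> G" "h \<in> G" "\<sigma> = pullback K \<kappa> h" "\<tau> = pullback K \<kappa> g"
      unfolding S_def by blast
    then have "\<sigma> \<circ> \<tau> = pullback K \<kappa> (g \<otimes>\<^bsub>Aut\<^esub> h)" using pullback_mult Giso by simp
    then show ?thesis using G(4) gh by (auto simp: S_def)
  qed
  have hom_S: "\<sigma> (x \<oplus> y) = \<sigma> x \<oplus> \<sigma> y" "\<sigma> (x \<otimes> y) = \<sigma> x \<otimes> \<sigma> y" "\<sigma> \<one> = \<one>" "\<sigma> (\<kappa> c) = \<kappa> c" "inj \<sigma>"
    if "\<sigma> \<in> S" for \<sigma> x y c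
    using that pullback_hom pullback_inj Giso by (auto simp: S_def)
  have range_j: "range j = {z. \<forall>\<sigma>\<in>S. \<sigma> z = z}" by (simp add: range S_def)
  have jS: "\<sigma> (j l) = j l" if "\<sigma> \<in> S" for \<sigma> l using range_j that by blast
  \<comment> \<open>Negatives and inverses are unique, so those of invariant elements are
    invariant.\<close>
  interpret L: embedded_field L "\<iota> \<circ> j"
  proof
    show "inj (\<iota> \<circ> j)" using inj L(2) by (rule inj_compose)
    fix x
    obtain y where y: "\<iota> y = - \<iota> (j x)" using ex_uminus by blast
    have jy: "j x \<oplus> y = \<zero>" by (simp add: eq_iff add zero y)
    have "\<sigma> y = y" if "\<sigma> \<in> S" for \<sigma>
    proof -
      have "\<sigma> \<zero> = \<zero>" using L(6) jS[OF that] by metis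
      then have "j x \<oplus> \<sigma> y = \<zero>" using hom_S(1)[OF that, of "j x" y] jS[OF that] jy by simp
      then show ?thesis using jy by (simp add: eq_iff add zero)  (metis add_left_cancel)
    qed
    then have "y \<in> range j" using range_j by blast
    then show "\<exists>y. (\<iota> \<circ> j) y = - (\<iota> \<circ> j) x" using y by auto
    obtain z where z: "\<iota> z = inverse (\<iota> (j x))" using ex_inverse by blast
    have "\<sigma> z = z" if s: "\<sigma> \<in> S" for \<sigma>
    proof (cases "\<iota> (j x) = 0")
      case True
      then have "z = j \<zero>\<^bsub>L\<^esub>" using z by (simp add: eq_iff L(6) zero)
      then show ?thesis using jS[OF s] by simp
    next
      case False
      then have jz: "j x \<otimes> z = \<one>" by (simp add: eq_iff mult one z)
      then have "j x \<otimes> \<sigma> z = \<one>" using hom_S(2,3)[OF s] jS[OF s] by metis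
      then have "\<iota> (j x) * \<iota> (\<sigma> z) = 1" by (metis mult one)
      then have "\<iota> (\<sigma> z) = \<iota> z" using False z by (simp add: inverse_unique)
      then show ?thesis by (simp add: eq_iff)
    qed
    then have "z \<in> range j" using range_j by blast
    then show "\<exists>y. (\<iota> \<circ> j) y = inverse ((\<iota> \<circ> j) x)" using z by auto
  qed (simp_all add: L add mult one zero)
  define pl' where "pl' = valuation_rings L \<kappa>'"
  have UNIV': "UNIV \<in> pl'" by (simp add: pl'_def L.UNIV_valuation_ring)
  have top': "topspace (pts (curve_of L \<kappa>')) = pl'"
    unfolding pl'_def by (rule topspace_curve_of) (simp add: L.carrier L.UNIV_valuation_ring)
  have open': "openin (pts (curve_of L \<kappa>')) V \<longleftrightarrow> V = {} \<or> (V \<subseteq> pl' \<and> UNIV \<in> V \<and> finite (pl' - V))" for V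
    by (simp add: openin_curve_of pl'_def L.carrier)
  have orb: "orbit_pt G P = (\<lambda>\<sigma>. {z. \<sigma> z \<in> P}) ` S" if "P \<in> pl" for P
    using aut_point[OF Giso that] by (auto simp: orbit_pt_def S_def image_image)
  have orb_pl: "orbit_pt G P \<subseteq> pl" if "P \<in> pl" for P
    using aut_bij[OF Giso] that by (auto simp: orbit_pt_def bij_betw_def)
  have self: "P \<in> orbit_pt G P" if "P \<in> pl" for P
    unfolding orb[OF that] by (rule image_eqI[OF _ id_S]) simp
  define q where "q = (\<lambda>P. {l. j l \<in> P})"
  \<comment> \<open>All points of an orbit have the same trace on \<open>L\<close>, as
    \<open>hq\<close> shows; the union over the orbit avoids choosing one.\<close>
  define h where "h = (\<lambda>O'. {l. \<exists>P\<in>O'. j l \<in> P})"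
  have hq: "h (orbit_pt G P) = q P" if "P \<in> pl" for P
  proof -
    have "(\<exists>\<sigma>\<in>S. \<sigma> (j l) \<in> P) \<longleftrightarrow> j l \<in> P" for l using jS id_S by metis
    then show ?thesis unfolding h_def q_def orb[OF that] by simp
  qed
  have rj: "subfield_set (range (\<iota> \<circ> j))" by (rule L.range_subfield)
  have jq: "(\<iota> \<circ> j) ` q P = \<iota> ` P \<inter> range (\<iota> \<circ> j)" for P
    by (auto simp: q_def simp flip: eq_iff)
  have q_pl: "q P \<in> pl'" if "P \<in> pl" for P
  proof -
    have "val_ring (range \<iota>) (\<iota> ` P)" "range \<kappa> \<subseteq> P" using that by (auto simp: pl_def valuation_rings_iff)
    then have "val_ring (range (\<iota> \<circ> j)) ((\<iota> \<circ> j) ` q P)" "range \<kappa>' \<subseteq> q P"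
      using val_ring_Int[OF _ rj, of "range \<iota>" "\<iota> ` P"] unfolding jq by (auto simp: q_def L(7))
    then show ?thesis by (simp add: pl'_def L.valuation_rings_iff)
  qed
  have q_surj: "\<exists>P\<in>pl. q P = Q" if Q: "Q \<in> pl'" for Q
  proof -
    have "val_ring (range (\<iota> \<circ> j)) ((\<iota> \<circ> j) ` Q)" "range \<kappa>' \<subseteq> Q" using Q by (auto simp: pl'_def L.valuation_rings_iff)
    then have "\<exists>P\<in>valuation_rings K \<kappa>. P \<inter> range j = j ` Q"
      using rj L(7)[symmetric] by (intro valuation_ring_extend) (auto simp: image_comp)
    then obtain P where P: "P \<in> pl" "P \<inter> range j = j ` Q" by (auto simp: pl_def)
    have "q P = Q" using P(2) L(2) unfolding q_def inj_def by blast
    then show ?thesis using P(1) by blast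
  qed
  have q_inj: "orbit_pt G P = orbit_pt G P'" if P: "P \<in> pl" "P' \<in> pl" and e: "q P = q P'" for P P'
  proof -
    have sub: "orbit_pt G P' \<subseteq> orbit_pt G P" if P: "P \<in> pl" "P' \<in> pl" and e: "q P = q P'" for P P'
    proof -
      have "\<exists>\<sigma>\<in>S. {z. \<sigma> z \<in> P} = P'"
      proof (rule valuation_rings_conjugate[where S = S and \<kappa> = \<kappa> and \<kappa>' = \<kappa>])
        show "P \<in> valuation_rings K \<kappa>" "P' \<in> valuation_rings K \<kappa>" using P by (simp_all add: pl_def)
        show "finite S" "id \<in> S" by (fact fin_S id_S)+
        show "\<sigma> \<circ> \<tau> \<in> S" if "\<sigma> \<in> S" "\<tau> \<in> S" for \<sigma> \<tau> using that by (rule comp_S)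
        show "\<sigma> (x \<oplus> y) = \<sigma> x \<oplus> \<sigma> y" "\<sigma> (x \<otimes> y) = \<sigma> x \<otimes> \<sigma> y" "\<sigma> \<one> = \<one>"
          if "\<sigma> \<in> S" for \<sigma> x y using hom_S[OF that] by auto
        fix z assume "\<And>\<sigma>. \<sigma> \<in> S \<Longrightarrow> \<sigma> z = z"
        then have "z \<in> range j" using range_j by blast
        then show "z \<in> P \<longleftrightarrow> z \<in> P'" using e by (auto simp: q_def)
      qed
      then obtain \<sigma> where s: "\<sigma> \<in> S" "P' = {z. \<sigma> z \<in> P}" by blast
      have "{z. \<tau> z \<in> P'} \<in> orbit_pt G P" if "\<tau> \<in> S" for \<tau>
        unfolding orb[OF P(1)] s(2) by (rule image_eqI[OF _ comp_S[OF s(1) that]]) simp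
      then show ?thesis unfolding orb[OF P(2)] by blast
    qed
    show ?thesis using sub[OF P e] sub[OF P(2,1) e[symmetric]] by blast
  qed
  let ?Q = "quotient_space crv G"
  have sat_top: "saturation crv G (orbit_pt G ` pl) = pl" by (auto simp: saturation_def topspace_crv)
  have top: "topspace (pts ?Q) = orbit_pt G ` pl"
  proof
    have "openin (pts ?Q) (orbit_pt G ` pl)"
      unfolding openin_quotient_space sat_top using UNIV_pl by (auto simp: topspace_crv openin_crv)
    then show "orbit_pt G ` pl \<subseteq> topspace (pts ?Q)" by (rule openin_subset)
    show "topspace (pts ?Q) \<subseteq> orbit_pt G ` pl"
      using openin_topspace[of "pts ?Q"] unfolding openin_quotient_space topspace_crv by blast
  qed
  have sat: "saturation crv G (preim ?Q h V) = {P \<in> pl. q P \<in> V}" for V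
    by (auto simp: saturation_def preim_def top topspace_crv hq)
  have q_UNIV: "q P = UNIV \<Longrightarrow> P \<in> pl \<Longrightarrow> P = UNIV" for P
    using q_inj[OF _ UNIV_pl, of P] self[of P] orb[OF UNIV_pl] id_S by (auto simp: q_def)
  have open_iff: "openin (pts crv) {P \<in> pl. q P \<in> V} \<longleftrightarrow> openin (pts (curve_of L \<kappa>')) V" if V: "V \<subseteq> pl'" for V
  proof -
    have e: "{P \<in> pl. q P \<in> V} = {} \<longleftrightarrow> V = {}" using q_surj V by blast
    have u: "UNIV \<in> {P \<in> pl. q P \<in> V} \<longleftrightarrow> UNIV \<in> V" using UNIV_pl by (simp add: q_def)
    have d: "pl - {P \<in> pl. q P \<in> V} = {P \<in> pl. q P \<in> pl' - V}" using q_pl by blast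
    have "finite {P \<in> pl. q P \<in> pl' - V} \<longleftrightarrow> finite (pl' - V)"
    proof
      assume "finite {P \<in> pl. q P \<in> pl' - V}"
      moreover have "pl' - V \<subseteq> q ` {P \<in> pl. q P \<in> pl' - V}" using q_surj by blast
      ultimately show "finite (pl' - V)" by (meson finite_imageI finite_subset)
    next
      assume f: "finite (pl' - V)"
      \<comment> \<open>A fibre of \<open>q\<close> is contained in one orbit of a finite
        group.\<close>
      have "finite {P \<in> pl. q P = Q}" for Q
      proof (cases "\<exists>P\<in>pl. q P = Q")
        case True
        then obtain P where P: "P \<in> pl" "q P = Q" by blast
        have "{P \<in> pl. q P = Q} \<subseteq> orbit_pt G P" using q_inj P self by blast
        moreover have "finite (orbit_pt G P)" unfolding orb[OF P(1)] using fin_S by (rule finite_imageI)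
        ultimately show ?thesis by (rule finite_subset)
      next
        case False
        then have "{P \<in> pl. q P = Q} = {}" by blast
        then show ?thesis by (metis finite.emptyI)
      qed
      then have "finite (\<Union>Q\<in>pl' - V. {P \<in> pl. q P = Q})" using f by blast
      then show "finite {P \<in> pl. q P \<in> pl' - V}" by (rule rev_finite_subset) blast
    qed
    then show ?thesis unfolding openin_crv open' e u d using V by auto
  qed
  have homeo: "homeomorphic_map (pts ?Q) (pts (curve_of L \<kappa>')) h"
    unfolding homeomorphic_map_def quotient_map_def
  proof (intro conjI allI impI)
    show "h ` topspace (pts ?Q) = topspace (pts (curve_of L \<kappa>'))"
    proof -
      have "h ` orbit_pt G ` pl = q ` pl" unfolding image_image by (rule image_cong) (simp_all add: hq)
      also have "\<dots> = pl'" using q_pl q_surj by blast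
      finally show ?thesis by (simp only: top top')
    qed
    show "inj_on h (topspace (pts ?Q))"
      unfolding top
    proof (rule inj_onI)
      fix O1 O2 assume "O1 \<in> orbit_pt G ` pl" "O2 \<in> orbit_pt G ` pl" and e: "h O1 = h O2"
      then obtain P1 P2 where "P1 \<in> pl" "O1 = orbit_pt G P1" "P2 \<in> pl" "O2 = orbit_pt G P2" by blast
      then show "O1 = O2" using q_inj[of P1 P2] e hq by simp
    qed
    fix V assume "V \<subseteq> topspace (pts (curve_of L \<kappa>'))"
    then have V: "V \<subseteq> pl'" by (simp add: top')
    have "openin (pts ?Q) (preim ?Q h V) \<longleftrightarrow> openin (pts crv) {P \<in> pl. q P \<in> V}"
      unfolding openin_quotient_space sat by (auto simp: preim_def top topspace_crv)
    then show "openin (pts ?Q) {x \<in> topspace (pts ?Q). h x \<in> V} \<longleftrightarrow> openin (pts (curve_of L \<kappa>')) V"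
      using open_iff[OF V] by (simp add: preim_def)
  qed
  \<comment> \<open>Restrictions between nonempty open sets are inclusions, so \<open>j\<close>
    serves as comorphism over every \<open>V\<close>; the empty set with its zero ring is checked
    separately.\<close>
  have "rs_iso ?Q (curve_of L \<kappa>') (h, \<lambda>V. j)"
    unfolding rs_iso_def prod.case
  proof (intro conjI allI impI ballI homeo)
    fix V assume V: "openin (pts (curve_of L \<kappa>')) V"
    let ?W = "{P \<in> pl. q P \<in> V}"
    have Vpl: "V \<subseteq> pl'" using V open' by auto
    have W: "openin (pts crv) ?W" using open_iff[OF Vpl] V by simp
    have We: "?W = {} \<longleftrightarrow> V = {}" using q_surj Vpl by blast
    show "j \<in> ring_iso (sect (curve_of L \<kappa>') V) (sect ?Q (preim ?Q h V))"
    proof (cases "V = {}")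
      case True
      have "snd g {} \<zero> = \<zero>" if "g \<in> G" for g
      proof -
        have "preim crv (fst g) {} = {}" by (simp add: preim_def)
        moreover have "openin (pts crv) {}" by simp
        ultimately have "snd g {} \<in> ring_iso (sect crv {}) (sect crv {})"
          using rs_isoD(2)[OF Giso[OF that], of "{}"] by simp
        then show ?thesis by (auto simp: ring_iso_def ring_hom_def Pi_def curve_of_simps)
      qed
      then have "{s \<in> {\<zero>}. \<forall>g\<in>G. snd g {} s = s} = {\<zero>}" by blast
      moreover have "?W = {}" using True by simp
      ultimately have Q: "sect ?Q (preim ?Q h V) = K\<lparr>carrier := {\<zero>}, monoid.one := \<zero>\<rparr>"
        unfolding quotient_space_simps sat by (simp only: curve_of_simps) simp
      have "\<zero> \<oplus> \<zero> = \<zero>" "\<zero> \<otimes> \<zero> = \<zero>" by (simp_all add: eq_iff add mult zero)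
      moreover have "\<zero>\<^bsub>L\<^esub> \<oplus>\<^bsub>L\<^esub> \<zero>\<^bsub>L\<^esub> = \<zero>\<^bsub>L\<^esub>" "\<zero>\<^bsub>L\<^esub> \<otimes>\<^bsub>L\<^esub> \<zero>\<^bsub>L\<^esub> = \<zero>\<^bsub>L\<^esub>"
        by (simp_all add: L.eq_iff L(3,4,6) add mult zero)
      ultimately show ?thesis
        unfolding Q unfolding True curve_of_simps by (simp add: ring_iso_def ring_hom_def bij_betw_def L(6))
    next
      case False
      then have W0: "?W \<noteq> {}" using We by blast
      have Q: "sect ?Q (preim ?Q h V) = K\<lparr>carrier := {s \<in> \<Inter>?W. \<forall>g\<in>G. snd g ?W s = s}\<rparr>"
        by (simp only: quotient_space_simps sat sect_curve_of[OF W0]) simp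
      have "{s \<in> \<Inter>?W. \<forall>g\<in>G. snd g ?W s = s} = {s \<in> \<Inter>?W. \<forall>g\<in>G. pullback K \<kappa> g s = s}"
        using aut_pullback[OF Giso W W0] by auto
      also have "\<dots> = \<Inter>?W \<inter> range j" unfolding range by blast
      also have "\<dots> = j ` \<Inter>V"
      proof -
        have "j l \<in> \<Inter>?W \<longleftrightarrow> l \<in> \<Inter>V" for l
        proof -
          have "j l \<in> \<Inter>?W \<longleftrightarrow> (\<forall>P\<in>pl. q P \<in> V \<longrightarrow> l \<in> q P)" by (auto simp: q_def)
          also have "\<dots> \<longleftrightarrow> l \<in> \<Inter>V" using q_surj Vpl by blast
          finally show ?thesis .
        qed
        then show ?thesis by blast
      qed
      finally have Q': "sect ?Q (preim ?Q h V) = K\<lparr>carrier := j ` \<Inter>V\<rparr>" using Q by simp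
      have "inj_on j (\<Inter>V)" using L(2) by (rule inj_on_subset) simp
      then show ?thesis unfolding Q' sect_curve_of[OF False]
        by (auto simp: ring_iso_def ring_hom_def bij_betw_def L)
    qed
    fix c show "j (const (curve_of L \<kappa>') V c) = const ?Q (preim ?Q h V) c"
      using We L(6,7) by (simp add: quotient_space_simps sat curve_of_simps)
  next
    fix V W s
    assume V: "openin (pts (curve_of L \<kappa>')) V" and W: "openin (pts (curve_of L \<kappa>')) W" and "W \<subseteq> V"
    have "{P \<in> pl. q P \<in> W} = {} \<longleftrightarrow> W = {}" using q_surj W open' by blast
    then show "j (restr (curve_of L \<kappa>') V W s) = restr ?Q (preim ?Q h V) (preim ?Q h W) (j s)"
      using L(6) by (simp add: quotient_space_simps sat curve_of_simps)
  qed
  then show ?thesis unfolding isomorphic_def by blast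
qed

end

section \<open>Substitution in rational functions\<close>

text \<open>A description is used because the library has no reduced fractions of polynomials over an
  arbitrary field; the value is junk if \<open>p\<close> is constant.\<close>

definition frac_comp :: "'k::field poly fract \<Rightarrow> 'k poly \<Rightarrow> 'k poly fract" where
  "frac_comp a p = (THE c. \<exists>u v. v \<noteq> 0 \<and> a = to_fract u / to_fract v \<and>
     c = to_fract (pcompose u p) / to_fract (pcompose v p))"

lemma fract_quotE:
  obtains u v where "v \<noteq> 0" "a = to_fract u / to_fract v"
  by (cases a) (auto simp: Fract_conv_to_fract)

lemma to_fract_quot_eq_iff:
  assumes "v \<noteq> 0" "v' \<noteq> 0"
  shows "to_fract u / to_fract v = to_fract u' / to_fract v' \<longleftrightarrow> u * v' = u' * v"
  using assms by (simp add: frac_eq_eq flip: to_fract_mult)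

lemma pcompose_nonzero:
  fixes p v :: "'a::idom poly"
  shows "degree p > 0 \<Longrightarrow> v \<noteq> 0 \<Longrightarrow> pcompose v p \<noteq> 0"
  using pcompose_eq_0 by blast

lemma frac_comp_quot:
  assumes p: "degree p > 0" and v: "v \<noteq> 0"
  shows "frac_comp (to_fract u / to_fract v) p = to_fract (pcompose u p) / to_fract (pcompose v p)"
  unfolding frac_comp_def
proof (rule the_equality)
  fix c assume "\<exists>u' v'. v' \<noteq> 0 \<and> to_fract u / to_fract v = to_fract u' / to_fract v' \<and>
     c = to_fract (pcompose u' p) / to_fract (pcompose v' p)"
  then obtain u' v' where *: "v' \<noteq> 0" "to_fract u / to_fract v = to_fract u' / to_fract v'"
    "c = to_fract (pcompose u' p) / to_fract (pcompose v' p)" by blast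
  then have "u * v' = u' * v" using v by (simp add: to_fract_quot_eq_iff)
  then have "pcompose u' p * pcompose v p = pcompose u p * pcompose v' p" by (metis pcompose_mult)
  then show "c = to_fract (pcompose u p) / to_fract (pcompose v p)"
    using * v p by (simp add: to_fract_quot_eq_iff pcompose_nonzero)
qed (use v in blast)

context
  fixes p :: "'k::field poly" assumes p: "degree p > 0"
begin

lemma frac_comp_to_fract: "frac_comp (to_fract u) p = to_fract (pcompose u p)"
  using frac_comp_quot[OF p, of 1 u] by (simp add: pcompose_1)

lemma frac_comp_0: "frac_comp 0 p = 0" and frac_comp_1: "frac_comp 1 p = 1"
  using frac_comp_to_fract[of 0] frac_comp_to_fract[of 1] by (simp_all add: pcompose_1)

lemma frac_comp_add: "frac_comp (a + b) p = frac_comp a p + frac_comp b p"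
proof -
  obtain u v where a: "v \<noteq> 0" "a = to_fract u / to_fract v" by (rule fract_quotE)
  obtain s t where b: "t \<noteq> 0" "b = to_fract s / to_fract t" by (rule fract_quotE)
  have "a + b = to_fract (u * t + s * v) / to_fract (v * t)" using a b by (simp add: add_frac_eq)
  then show ?thesis using a b p pcompose_nonzero[OF p]
    by (simp add: frac_comp_quot pcompose_add pcompose_mult add_frac_eq del: to_fract_add to_fract_mult)
       (simp add: add_frac_eq)
qed

lemma frac_comp_mult: "frac_comp (a * b) p = frac_comp a p * frac_comp b p"
proof -
  obtain u v where a: "v \<noteq> 0" "a = to_fract u / to_fract v" by (rule fract_quotE)
  obtain s t where b: "t \<noteq> 0" "b = to_fract s / to_fract t" by (rule fract_quotE)
  have "a * b = to_fract (u * s) / to_fract (v * t)" using a b by simp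
  then show ?thesis using a b p by (simp add: frac_comp_quot pcompose_mult del: to_fract_mult) simp
qed

lemma inj_frac_comp: "inj (\<lambda>a. frac_comp a p)"
proof (rule injI)
  fix a b assume e: "frac_comp a p = frac_comp b p"
  obtain u v where a: "v \<noteq> 0" "a = to_fract u / to_fract v" by (rule fract_quotE)
  obtain s t where b: "t \<noteq> 0" "b = to_fract s / to_fract t" by (rule fract_quotE)
  have "pcompose u p * pcompose t p = pcompose s p * pcompose v p"
    using e a b p by (simp add: frac_comp_quot to_fract_quot_eq_iff pcompose_nonzero)
  then have "u * t = s * v" using pcompose_cancel[OF p] by (simp flip: pcompose_mult)
  then show "a = b" using a b by (simp add: to_fract_quot_eq_iff)
qed

end

lemma frac_comp_assoc:
  assumes "degree p > 0" "degree q > 0"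
  shows "frac_comp (frac_comp a p) q = frac_comp a (pcompose p q)"
proof -
  obtain u v where a: "v \<noteq> 0" "a = to_fract u / to_fract v" by (rule fract_quotE)
  show ?thesis using assms a
    by (simp add: frac_comp_quot pcompose_nonzero degree_pcompose pcompose_assoc)
qed

lemma (in affine_group) degree_aff_pos: "g \<in> H \<Longrightarrow> degree (aff_poly g) > 0"
  using degree_aff_poly[OF nz] by simp

lemma (in affine_group) degree_xpoly_pos: "degree xpoly > 0"
  using degree_xpoly card_pos by simp

text \<open>The fraction is expanded until its denominator is the norm of \<open>v\<close>. This is
  invariant, hence so is the new numerator, and both are polynomials in
  \<open>xpoly\<close>.\<close>

lemma (in affine_group) frac_invariant_iff:
  "(\<forall>g\<in>H. frac_comp a (aff_poly g) = a) \<longleftrightarrow> a \<in> range (\<lambda>b. frac_comp b xpoly)"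
proof
  assume inv: "\<forall>g\<in>H. frac_comp a (aff_poly g) = a"
  obtain u v where a: "v \<noteq> 0" "a = to_fract u / to_fract v" by (rule fract_quotE)
  define d where "d = (\<Prod>g\<in>H. pcompose v (aff_poly g))"
  define n where "n = u * (\<Prod>g\<in>H - {(1, 0)}. pcompose v (aff_poly g))"
  have v1: "pcompose v (aff_poly (1, 0)) = v" by (simp add: aff_poly_def)
  have dv: "d = v * (\<Prod>g\<in>H - {(1, 0)}. pcompose v (aff_poly g))"
    unfolding d_def using fin one v1 by (subst prod.remove[of H "(1, 0)"]) auto
  have d0: "d \<noteq> 0" unfolding d_def using a(1) fin pcompose_nonzero[OF degree_aff_pos] by auto
  have and': "a = to_fract n / to_fract d"
    using a(1) d0 by (simp add: a(2) to_fract_quot_eq_iff n_def dv)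
  have d_inv: "pcompose d (aff_poly g) = d" if g: "g \<in> H" for g
  proof -
    have "pcompose d (aff_poly g) = (\<Prod>h\<in>H. pcompose v (aff_poly (aff_mult h g)))"
      by (simp add: d_def pcompose_prod pcompose_aff_poly flip: pcompose_assoc)
    also have "\<dots> = d" unfolding d_def
      using prod.reindex_bij_betw[OF right_bij[OF g], of "\<lambda>h. pcompose v (aff_poly h)"] .
    finally show ?thesis .
  qed
  have n_inv: "pcompose n (aff_poly g) = n" if g: "g \<in> H" for g
    using bspec[OF inv g] d0 d_inv[OF g] by (simp add: and' frac_comp_quot[OF degree_aff_pos[OF g]])
  obtain n' d' where n': "n = pcompose n' xpoly" and d': "d = pcompose d' xpoly"
    using invariant_imp_pcompose[OF n_inv] invariant_imp_pcompose[OF d_inv] by blast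
  have "d' \<noteq> 0" using d0 d' by auto
  then have "a = frac_comp (to_fract n' / to_fract d') xpoly"
    using degree_xpoly_pos by (simp add: frac_comp_quot and' n' d')
  then show "a \<in> range (\<lambda>b. frac_comp b xpoly)" by blast
next
  assume "a \<in> range (\<lambda>b. frac_comp b xpoly)"
  then show "\<forall>g\<in>H. frac_comp a (aff_poly g) = a"
    using degree_xpoly_pos degree_aff_pos by (auto simp: frac_comp_assoc xpoly_invariant)
qed

section \<open>The function field of a hyperelliptic curve\<close>

lemma hyp_field_simps [simp]:
  "carrier (hyp_field f) = UNIV"
  "z \<otimes>\<^bsub>hyp_field f\<^esub> w = (fst z * fst w + snd z * snd w * to_fract f, fst z * snd w + snd z * fst w)"
  "z \<oplus>\<^bsub>hyp_field f\<^esub> w = (fst z + fst w, snd z + snd w)"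
  "\<one>\<^bsub>hyp_field f\<^esub> = (1, 0)" "\<zero>\<^bsub>hyp_field f\<^esub> = (0, 0)"
  by (simp_all add: hyp_field_def case_prod_beta)

text \<open>The element \<open>y\<close>, a square root of \<open>f\<close> in the closure of
  \<open>k(X)\<close>, places the function field inside a field type.\<close>

locale hyp_equation =
  fixes f :: "'k::field poly" and R :: "'k alg_closure set" and c :: 'k and y :: "'k poly fract alg_closure"
  assumes two: "(2::'k) \<noteq> 0" and deg: "degree f \<ge> 1"
    and R: "finite R" "map_poly to_ac f = smult (to_ac c) (\<Prod>r\<in>R. [:- r, 1:])"
    and y: "y * y = to_ac (to_fract f)"
begin

lemma f_nonzero: "f \<noteq> 0"
  using deg by auto

lemma two_fract: "(2 :: 'k poly fract) \<noteq> 0"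
proof -
  have "to_fract [:2::'k:] \<noteq> 0" using two by simp
  moreover have "to_fract [:2::'k:] = 2"
  proof -
    have "[:2::'k:] = 1 + 1" by (simp add: one_pCons)
    then have "to_fract [:2::'k:] = to_fract (1 + 1)" by (rule arg_cong)
    also have "\<dots> = 2" unfolding to_fract_add to_fract_1 by (rule one_add_one)
    finally show ?thesis .
  qed
  ultimately show ?thesis by simp
qed

text \<open>Over the closure \<open>f\<close> has a simple root \<open>r\<close>. After clearing
  denominators, the order at \<open>r\<close> is even on one side and odd on the other.\<close>

lemma not_square:
  assumes "a * a = b * b * to_fract f" shows "b = 0"
proof (rule ccontr)
  assume "b \<noteq> 0"
  obtain u v where a: "v \<noteq> 0" "a = to_fract u / to_fract v" by (rule fract_quotE)
  obtain s t where b: "t \<noteq> 0" "b = to_fract s / to_fract t" by (rule fract_quotE)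
  have s: "s \<noteq> 0" using \<open>b \<noteq> 0\<close> b by auto
  have "to_fract (u * t) * to_fract (u * t) = to_fract (s * v) * to_fract (s * v) * to_fract f"
    using assms a b by (simp add: field_simps)
  then have e: "(u * t) * (u * t) = (s * v) * (s * v) * f" by (simp flip: to_fract_mult)
  define P Q where "P = map_poly to_ac (u * t)" and "Q = map_poly to_ac (s * v)"
  have e': "P * P = Q * Q * map_poly to_ac f" unfolding P_def Q_def by (metis e map_poly_to_ac_mult)
  have Q0: "Q \<noteq> 0" using s a(1) map_poly_to_ac_eq_iff[of "s * v" 0] by (auto simp: Q_def)
  have F0: "map_poly to_ac f \<noteq> 0" using f_nonzero map_poly_to_ac_eq_iff[of f 0] by auto
  have P0: "P \<noteq> 0" using e' Q0 F0 by auto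
  have "R \<noteq> {}"
  proof
    assume "R = {}"
    then have "map_poly to_ac f = map_poly to_ac [:c:]" using R(2) by (simp add: map_poly_pCons)
    then show False using deg by (auto simp: map_poly_to_ac_eq_iff)
  qed
  then obtain r where r: "r \<in> R" by blast
  have c0: "to_ac c \<noteq> 0" using R(2) F0 by auto
  have "map_poly to_ac f = smult (to_ac c) ([:- r, 1:] * (\<Prod>s\<in>R - {r}. [:- s, 1:]))"
    unfolding R(2) using prod.remove[OF R(1) r, of "\<lambda>s. [:- s, 1:]"] by simp
  moreover have "order r (\<Prod>s\<in>R - {r}. [:- s, 1:]) = 0"
    using R(1) by (intro order_0I) (auto simp: poly_prod)
  moreover have "order r [:- r, 1:] = 1" using order_power_n_n[of r 1] by simp
  moreover have "[:- r, 1:] * (\<Prod>s\<in>R - {r}. [:- s, 1:]) \<noteq> 0"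
    using R(1) by (simp only: mult_eq_0_iff) auto
  ultimately have "order r (map_poly to_ac f) = 1"
    by (metis order_smult[OF c0] order_mult add.right_neutral)
  then have "2 * order r P = 2 * order r Q + 1"
    using arg_cong[OF e', of "order r"] P0 Q0 F0 by (simp add: order_mult)
  then show False by presburger
qed

definition emb :: "'k ffield \<Rightarrow> 'k poly fract alg_closure" where
  "emb z = to_ac (fst z) + to_ac (snd z) * y"

lemma emb_eq_0: "emb z = 0 \<Longrightarrow> z = (0, 0)"
proof -
  assume e: "emb z = 0"
  then have "to_ac (fst z) = - (to_ac (snd z) * y)" by (simp add: emb_def eq_neg_iff_add_eq_0)
  then have "to_ac (fst z) * to_ac (fst z) = to_ac (snd z) * to_ac (snd z) * (y * y)" by simp
  then have "to_ac (fst z * fst z) = to_ac (snd z * snd z * to_fract f)" by (simp add: y)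
  then have "snd z = 0" using not_square by (simp only: to_ac_eq_iff)
  then show ?thesis using e by (simp add: emb_def prod_eq_iff)
qed

sublocale embedded_field "hyp_field f" emb
proof
  show "inj emb"
  proof (rule injI)
    fix z w assume "emb z = emb w"
    then have "emb (fst z - fst w, snd z - snd w) = 0" by (simp add: emb_def algebra_simps)
    then show "z = w" using emb_eq_0 by (fastforce simp: prod_eq_iff)
  qed
  fix z w
  show "emb (z \<otimes>\<^bsub>hyp_field f\<^esub> w) = emb z * emb w"
  proof -
    have "emb z * emb w = to_ac (fst z * fst w) + to_ac (snd z * snd w) * (y * y) + to_ac (fst z * snd w + snd z * fst w) * y"
      by (simp add: emb_def algebra_simps)
    then show ?thesis by (simp add: y emb_def)
  qed
  show "\<exists>w. emb w = - emb z" by (intro exI[of _ "(- fst z, - snd z)"]) (simp add: emb_def)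
  show "\<exists>w. emb w = inverse (emb z)"
  proof (cases "z = (0, 0)")
    case True
    then show ?thesis by (intro exI[of _ z]) (simp add: emb_def)
  next
    case False
    \<comment> \<open>The norm of \<open>z\<close>; the inverse is the conjugate divided by
      it.\<close>
    define n where "n = fst z * fst z - snd z * snd z * to_fract f"
    have "n \<noteq> 0"
    proof
      assume "n = 0"
      then have *: "fst z * fst z = snd z * snd z * to_fract f" by (simp add: n_def)
      then show False using not_square[OF *] False by (auto simp: prod_eq_iff)
    qed
    have "emb z * emb (fst z / n, - snd z / n) = (to_ac (fst z) * to_ac (fst z) - to_ac (snd z) * to_ac (snd z) * (y * y)) / to_ac n"
      by (simp add: emb_def algebra_simps add_divide_distrib diff_divide_distrib)
    also have "\<dots> = to_ac n / to_ac n" unfolding y by (simp add: n_def)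
    also have "\<dots> = 1" using \<open>n \<noteq> 0\<close> by simp
    finally have "inverse (emb z) = emb (fst z / n, - snd z / n)" by (rule inverse_unique)
    then show ?thesis by metis
  qed
qed (simp_all add: emb_def algebra_simps)

section \<open>Places of the function field and finiteness of poles\<close>

abbreviation \<kappa> :: "'k \<Rightarrow> 'k ffield" where "\<kappa> \<equiv> \<lambda>a. (to_fract [:a:], 0)"

definition e :: "'k poly \<Rightarrow> 'k poly fract alg_closure" where "e p = to_ac (to_fract p)"

lemma e_simps: "e (p + q) = e p + e q" "e (p * q) = e p * e q" "e (p - q) = e p - e q" "e 0 = 0" "e 1 = 1"
    "e p = 0 \<longleftrightarrow> p = 0" "e (pCons a p) = e [:a:] + e [:0, 1:] * e p"
proof -
  have "pCons a p = [:a:] + [:0, 1:] * p" by simp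
  then show "e (pCons a p) = e [:a:] + e [:0, 1:] * e p" unfolding e_def by (metis to_fract_add to_fract_mult to_ac_add to_ac_mult)
qed (simp_all add: e_def)

lemma emb_quot: "v \<noteq> 0 \<Longrightarrow> emb (to_fract u / to_fract v, 0) = e u / e v"
  by (simp add: emb_def e_def)

definition places :: "'k ffield set set" where "places = valuation_rings (hyp_field f) \<kappa>"

lemma placesD:
  assumes "P \<in> places"
  shows "val_ring (range emb) (emb ` P)" "e [:a:] \<in> emb ` P"
proof -
  have "P \<in> valuation_rings (hyp_field f) \<kappa>" using assms by (simp add: places_def)
  then have *: "val_ring (range emb) (emb ` P)" "range \<kappa> \<subseteq> P" unfolding valuation_rings_iff by blast+
  show "val_ring (range emb) (emb ` P)" by fact
  have "e [:a:] = emb (\<kappa> a)" by (simp add: emb_def e_def)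
  then show "e [:a:] \<in> emb ` P" using *(2) by blast
qed

lemma e_range: "e p \<in> range emb"
proof -
  have "e p = emb (to_fract p, 0)" by (simp add: emb_def e_def)
  then show ?thesis by blast
qed

lemma const_unit:
  assumes "P \<in> places" "a \<noteq> 0" shows "e [:a:] \<in> emb ` P" "e [:a:] \<notin> nonunits (emb ` P)"
proof -
  show "e [:a:] \<in> emb ` P" using placesD[OF assms(1)] by blast
  have "[:inverse a:] * [:a:] = 1" using assms(2) by simp
  then have "e [:inverse a:] * e [:a:] = 1" by (metis e_simps(2,5))
  then show "e [:a:] \<notin> nonunits (emb ` P)"
    using nonunits_mult[OF val_ring_subring[OF placesD(1)[OF assms(1)]] placesD(2)[OF assms(1), of "inverse a"]]
      one_not_nonunit[OF subring_setD(1)[OF val_ring_subring[OF placesD(1)[OF assms(1)]]]] by metis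
qed

text \<open>The fibres of the places over those of \<open>k(X)\<close> are orbits of \<open>Y \<mapsto> -Y\<close>.\<close>

lemma finite_places_agree:
  assumes "A \<subseteq> places" and "\<And>P P' a. P \<in> A \<Longrightarrow> P' \<in> A \<Longrightarrow> (a, 0) \<in> P \<longleftrightarrow> (a, 0) \<in> P'"
  shows "finite A"
proof (cases "A = {}")
  case False
  then obtain P where P: "P \<in> A" by blast
  define cj :: "'k ffield \<Rightarrow> 'k ffield" where "cj = (\<lambda>z. (fst z, - snd z))"
  define S where "S = {id, cj}"
  have "A \<subseteq> (\<lambda>\<sigma>. {z. \<sigma> z \<in> P}) ` S"
  proof
    fix P' assume P': "P' \<in> A"
    have "\<exists>\<sigma>\<in>S. {z. \<sigma> z \<in> P} = P'"
    proof (rule valuation_rings_conjugate[where S = S and \<kappa> = \<kappa> and \<kappa>' = \<kappa>])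
      show "P \<in> valuation_rings (hyp_field f) \<kappa>" "P' \<in> valuation_rings (hyp_field f) \<kappa>"
        using P P' assms(1) by (auto simp: places_def)
      show "finite S" "id \<in> S" by (simp_all add: S_def)
      show "\<sigma> \<circ> \<tau> \<in> S" if "\<sigma> \<in> S" "\<tau> \<in> S" for \<sigma> \<tau>
      proof -
        have "cj \<circ> cj = id" by (auto simp: cj_def)
        then show ?thesis using that by (auto simp: S_def)
      qed
      show "\<sigma> (z \<oplus>\<^bsub>hyp_field f\<^esub> w) = \<sigma> z \<oplus>\<^bsub>hyp_field f\<^esub> \<sigma> w" "\<sigma> (z \<otimes>\<^bsub>hyp_field f\<^esub> w) = \<sigma> z \<otimes>\<^bsub>hyp_field f\<^esub> \<sigma> w"
        "\<sigma> \<one>\<^bsub>hyp_field f\<^esub> = \<one>\<^bsub>hyp_field f\<^esub>" if "\<sigma> \<in> S" for \<sigma> z w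
        using that by (auto simp: S_def cj_def)
      fix z assume "\<And>\<sigma>. \<sigma> \<in> S \<Longrightarrow> \<sigma> z = z"
      \<comment> \<open>Invariance under \<open>cj\<close> means \<open>2 * snd z = 0\<close>. As 2
        is nonzero, \<open>z\<close> lies in \<open>k(X)\<close>, where the places agree by
        assumption.\<close>
      then have "cj z = z" by (simp add: S_def)
      then have "- snd z = snd z" unfolding cj_def by (metis snd_conv)
      then have "snd z + snd z = 0" by (metis add.left_inverse)
      then have "2 * snd z = 0" by (simp only: mult_2)
      then have "snd z = 0" using two_fract by (simp only: mult_eq_0_iff) blast
      then have "z = (fst z, 0)" by (metis prod.collapse)
      then show "z \<in> P \<longleftrightarrow> z \<in> P'" using assms(2)[OF P P'] by metis
    qed
    then show "P' \<in> (\<lambda>\<sigma>. {z. \<sigma> z \<in> P}) ` S" by blast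
  qed
  then show ?thesis by (rule finite_subset) (simp add: S_def)
qed simp

lemma poly_in_place:
  assumes P: "P \<in> places" and x: "e [:0, 1:] \<in> emb ` P" shows "e p \<in> emb ` P"
proof (induction p)
  case 0
  then show ?case using subring_setD(2)[OF val_ring_subring[OF placesD(1)[OF P]]] by (simp add: e_simps)
next
  case (pCons a p)
  note D = subring_setD[OF val_ring_subring[OF placesD(1)[OF P]]]
  show ?case unfolding e_simps(7)[of a p] by (rule D(5)[OF placesD(2)[OF P] D(6)[OF x pCons.IH]])
qed

text \<open>A rational function is regular at such a place iff it has a denominator not divisible by \<open>d\<close>, so the
  places agree on \<open>k(X)\<close>.\<close>

lemma finite_places_irreducible:
  assumes d: "irreducible d"
  shows "finite {P \<in> places. e [:0, 1:] \<in> emb ` P \<and> e d \<in> nonunits (emb ` P)}" (is "finite ?A")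
proof (rule finite_places_agree)
  have d0: "d \<noteq> 0" "\<not> is_unit d" using d by (auto simp: irreducible_def)
  have dvd: "d dvd p" if P: "P \<in> ?A" and p: "e p \<in> nonunits (emb ` P)" for P p
  proof -
    have P': "P \<in> places" "e [:0, 1:] \<in> emb ` P" "e d \<in> nonunits (emb ` P)" using P by auto
    have sV: "subring_set (emb ` P)" using val_ring_subring[OF placesD(1)[OF P'(1)]] .
    \<comment> \<open>By division with remainder, a polynomial of least degree vanishing at the
      place divides all the others; \<open>d\<close>, being irreducible, is associated to
      it.\<close>
    define \<pi> where "\<pi> = (ARG_MIN degree q. q \<noteq> 0 \<and> e q \<in> nonunits (emb ` P))"
    have \<pi>: "\<pi> \<noteq> 0" "e \<pi> \<in> nonunits (emb ` P)"
      and min: "\<And>q. q \<noteq> 0 \<Longrightarrow> e q \<in> nonunits (emb ` P) \<Longrightarrow> degree \<pi> \<le> degree q"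
      using arg_min_natI[of "\<lambda>q. q \<noteq> 0 \<and> e q \<in> nonunits (emb ` P)" d degree]
        arg_min_nat_le[of "\<lambda>q. q \<noteq> 0 \<and> e q \<in> nonunits (emb ` P)" _ degree] d0 P'(3)
      unfolding \<pi>_def by blast+
    have \<pi>_dvd: "\<pi> dvd q" if q: "e q \<in> nonunits (emb ` P)" for q
    proof (rule ccontr)
      assume n: "\<not> \<pi> dvd q"
      have "e (q mod \<pi>) = e q + e (- (q div \<pi>)) * e \<pi>"
        by (simp flip: e_simps(1,2) add: minus_div_mult_eq_mod flip: diff_conv_add_uminus)
      also have "\<dots> \<in> nonunits (emb ` P)"
        using q nonunits_mult[OF sV poly_in_place[OF P'(1,2)] \<pi>(2)]
        by (intro nonunits_add[OF placesD(1)[OF P'(1)] range_subfield])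
      finally have "degree \<pi> \<le> degree (q mod \<pi>)" using min n by (simp add: mod_eq_0_iff_dvd)
      then show False using degree_mod_less[OF \<pi>(1), of q] n by (auto simp: mod_eq_0_iff_dvd)
    qed
    obtain q where q: "d = \<pi> * q" using \<pi>_dvd[OF P'(3)] by blast
    have "\<not> is_unit \<pi>"
    proof
      assume "is_unit \<pi>"
      then obtain a where "\<pi> = [:a:]" by (metis is_unit_iff_degree \<pi>(1) degree_eq_zeroE)
      then show False using const_unit(2)[OF P'(1), of a] \<pi> by auto
    qed
    then have "is_unit q" using d q by (auto simp: irreducible_def)
    then have "d dvd \<pi>" using q by (simp add: mult_unit_dvd_iff)
    then show ?thesis using \<pi>_dvd[OF p] by (rule dvd_trans)
  qed
  have iff: "(a, 0) \<in> P \<longleftrightarrow> (\<exists>u v. v \<noteq> 0 \<and> a = to_fract u / to_fract v \<and> \<not> d dvd v)" if P: "P \<in> ?A" for P a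
  proof
    have P': "P \<in> places" "e [:0, 1:] \<in> emb ` P" "e d \<in> nonunits (emb ` P)" using P by auto
    have sV: "subring_set (emb ` P)" using val_ring_subring[OF placesD(1)[OF P'(1)]] .
    {
      assume "\<exists>u v. v \<noteq> 0 \<and> a = to_fract u / to_fract v \<and> \<not> d dvd v"
      then obtain u v where uv: "v \<noteq> 0" "a = to_fract u / to_fract v" "\<not> d dvd v" by blast
      then have "e v \<notin> nonunits (emb ` P)" using dvd[OF P] by blast
      then have "inverse (e v) \<in> emb ` P" using not_nonunit poly_in_place[OF P'(1,2)] by blast
      then have "e u * inverse (e v) \<in> emb ` P"
        using poly_in_place[OF P'(1,2), of u] subring_setD(6)[OF sV] by blast
      moreover have "emb (a, 0) = e u * inverse (e v)"
        using emb_quot[OF uv(1), of u] unfolding uv(2)[symmetric] by (simp only: divide_inverse)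
      ultimately have "emb (a, 0) \<in> emb ` P" by (simp only:)
      then show "(a, 0) \<in> P" by (simp only: mem_image_iff)
    next
      assume "(a, 0) \<in> P"
      then have aP: "emb (a, 0) \<in> emb ` P" by blast
      \<comment> \<open>A denominator of least degree is not divisible by \<open>d\<close>: the
        numerator would vanish at the place too, and \<open>d\<close> could be cancelled.\<close>
      have "\<exists>v u. v \<noteq> 0 \<and> a = to_fract u / to_fract v" by (metis fract_quotE)
      then obtain v where v: "\<exists>u. v \<noteq> 0 \<and> a = to_fract u / to_fract v"
        and min: "\<And>w. \<exists>u. w \<noteq> 0 \<and> a = to_fract u / to_fract w \<Longrightarrow> degree v \<le> degree w"
        using ex_has_least_nat[of "\<lambda>v. \<exists>u. v \<noteq> 0 \<and> a = to_fract u / to_fract v" _ degree] by blast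
      obtain u where uv: "v \<noteq> 0" "a = to_fract u / to_fract v" using v by blast
      have "\<not> d dvd v"
      proof
        assume dv: "d dvd v"
        then obtain w where w: "v = d * w" by blast
        have "e w \<in> emb ` P" using poly_in_place[OF P'(1,2)] .
        then have "e w * e d \<in> nonunits (emb ` P)" using nonunits_mult[OF sV _ P'(3)] by blast
        then have "emb (a, 0) * (e w * e d) \<in> nonunits (emb ` P)" by (rule nonunits_mult[OF sV aP])
        also have "e w * e d = e v" by (simp only: w e_simps(2) mult.commute)
        finally have "emb (a, 0) * e v \<in> nonunits (emb ` P)" .
        then have "e u \<in> nonunits (emb ` P)" using uv by (simp add: emb_quot e_simps)
        then obtain u' where u': "u = d * u'" using dvd[OF P] by blast
        have w0: "w \<noteq> 0" using uv w by auto
        then have "a = to_fract u' / to_fract w" using uv d0 by (simp add: u' w)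
        then have "degree v \<le> degree w" using min w0 by blast
        moreover have "degree d > 0" using d0 by (auto simp: is_unit_iff_degree)
        ultimately show False using w w0 d0 by (simp add: degree_mult_eq)
      qed
      then show "\<exists>u v. v \<noteq> 0 \<and> a = to_fract u / to_fract v \<and> \<not> d dvd v" using uv by blast
    }
  qed
  show "(a, 0) \<in> P \<longleftrightarrow> (a, 0) \<in> P'" if "P \<in> ?A" "P' \<in> ?A" for P P' a
    using iff[OF that(1)] iff[OF that(2)] by blast
qed blast

text \<open>Where a product vanishes one of its factors does, so induction on the degree reduces to
  irreducible polynomials.\<close>

lemma finite_places_zero:
  assumes "d \<noteq> 0"
  shows "finite {P \<in> places. e [:0, 1:] \<in> emb ` P \<and> e d \<in> nonunits (emb ` P)}"
  using assms
proof (induction "degree d" arbitrary: d rule: less_induct)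
  case less
  show ?case
  proof (cases "irreducible d")
    case True
    then show ?thesis by (rule finite_places_irreducible)
  next
    case False
    show ?thesis
    proof (cases "is_unit d")
      case True
      then obtain a where a: "d = [:a:]" "a \<noteq> 0" using less.prems by (metis is_unit_iff_degree degree_eq_zeroE pCons_eq_0_iff)
      then have "{P \<in> places. e [:0, 1:] \<in> emb ` P \<and> e d \<in> nonunits (emb ` P)} = {}"
        using const_unit(2) by blast
      then show ?thesis by (simp only: finite.emptyI)
    next
      case nu: False
      then obtain p q where pq: "d = p * q" "\<not> is_unit p" "\<not> is_unit q"
        using False less.prems by (auto simp: irreducible_def)
      then have 0: "p \<noteq> 0" "q \<noteq> 0" using less.prems by auto
      then have "degree p < degree d" "degree q < degree d"
        using pq by (auto simp: degree_mult_eq is_unit_iff_degree)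
      then have fin: "finite {P \<in> places. e [:0, 1:] \<in> emb ` P \<and> e p \<in> nonunits (emb ` P)}"
        "finite {P \<in> places. e [:0, 1:] \<in> emb ` P \<and> e q \<in> nonunits (emb ` P)}"
        using less.hyps 0 by auto
      have "e p \<in> nonunits (emb ` P) \<or> e q \<in> nonunits (emb ` P)"
        if "P \<in> places" "e [:0, 1:] \<in> emb ` P" "e d \<in> nonunits (emb ` P)" for P
        using nonunits_prime[OF val_ring_subring[OF placesD(1)[OF that(1)]] poly_in_place[OF that(1,2)] poly_in_place[OF that(1,2)], of p q]
          that(3) by (simp only: pq(1) e_simps(2))
      then show ?thesis by (intro finite_subset[OF _ finite_UnI[OF fin]]) blast
    qed
  qed
qed

text \<open>At a pole of X the element 1/X is a nonunit, so \<open>p\<close> divided by X to its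
  degree is the leading coefficient, a unit, plus a nonunit.\<close>

lemma poly_at_infinity:
  assumes P: "P \<in> places" and x: "e [:0, 1:] \<notin> emb ` P" and "p \<noteq> 0"
  shows "e p * inverse (e [:0, 1:]) ^ degree p \<in> emb ` P - nonunits (emb ` P)"
  using assms(3)
proof (induction p)
  case (pCons a p)
  let ?V = "emb ` P" let ?x = "e [:0, 1:]" let ?w = "inverse (e [:0, 1:])"
  note V = placesD(1)[OF P]
  note sV = val_ring_subring[OF V]
  note D = subring_setD[OF sV]
  have x0: "?x \<noteq> 0" and w: "?w \<in> nonunits ?V" using outside_val_ring[OF V e_range x] by auto
  have wV: "?w \<in> ?V" using w nonunits_subset by blast
  show ?case
  proof (cases "p = 0")
    case True
    then show ?thesis using const_unit[OF P, of a] pCons by simp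
  next
    case False
    let ?n = "degree p"
    define t where "t = e p * ?w ^ ?n"
    have t: "t \<in> ?V" "t \<notin> nonunits ?V" using pCons.IH[OF False] by (auto simp: t_def)
    define r where "r = e [:a:] * ?w ^ Suc ?n"
    have r: "r \<in> nonunits ?V"
      using nonunits_mult[OF sV D(6)[OF placesD(2)[OF P, of a] D(7)[OF wV, of ?n]] w] by (simp add: r_def mult_ac)
    have rV: "r \<in> ?V" using r nonunits_subset by blast
    have eq: "e (pCons a p) * ?w ^ degree (pCons a p) = r + t"
      unfolding e_simps(7)[of a p] using False x0 by (simp add: r_def t_def algebra_simps)
    have "r + t \<notin> nonunits ?V"
    proof
      assume "r + t \<in> nonunits ?V"
      moreover have "- r \<in> nonunits ?V" using nonunits_mult[OF sV D(4)[OF D(1)] r] by simp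
      ultimately have "r + t + - r \<in> nonunits ?V" by (rule nonunits_add[OF V range_subfield])
      then show False using t by simp
    qed
    then show ?thesis unfolding eq using D(5)[OF rV t(1)] by blast
  qed
qed simp

text \<open>By \<open>poly_at_infinity\<close>, regularity of a nonzero fraction at such a place is
  decided by comparing degrees, so all these places agree on \<open>k(X)\<close>.\<close>

lemma finite_places_infinity: "finite {P \<in> places. e [:0, 1:] \<notin> emb ` P}" (is "finite ?A")
proof (rule finite_places_agree)
  have iff: "(to_fract u / to_fract v, 0) \<in> P \<longleftrightarrow> u = 0 \<or> degree u \<le> degree v"
    if P: "P \<in> ?A" and v: "v \<noteq> 0" for P u v
  proof (cases "u = 0")
    case True
    have "emb (0, 0) \<in> emb ` P"
      using subring_setD(2)[OF val_ring_subring[OF placesD(1)]] P by (simp add: emb_def)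
    then show ?thesis using True by (simp add: mem_image_iff)
  next
    case u: False
    let ?V = "emb ` P" let ?w = "inverse (e [:0, 1:])"
    have P': "P \<in> places" "e [:0, 1:] \<notin> ?V" using P by auto
    note V = placesD(1)[OF P'(1)]
    note sV = val_ring_subring[OF V]
    note D = subring_setD[OF sV]
    have x0: "e [:0, 1:] \<noteq> 0" and w: "?w \<in> nonunits ?V" using outside_val_ring[OF V e_range P'(2)] by auto
    have wV: "?w \<in> ?V" using w nonunits_subset by blast
    have uv0: "e u \<noteq> 0" "e v \<noteq> 0" using u v by (simp_all only: e_simps(6) not_False_eq_True)
    define s t where "s = e u * ?w ^ degree u" and "t = e v * ?w ^ degree v"
    have s: "s \<in> ?V" "s \<noteq> 0" "inverse s \<in> ?V"
      using poly_at_infinity[OF P' u] not_nonunit[of s ?V] unfolding s_def by blast+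
    have t: "t \<in> ?V" "t \<noteq> 0" "inverse t \<in> ?V"
      using poly_at_infinity[OF P' v] not_nonunit[of t ?V] unfolding t_def by blast+
    show ?thesis
    proof (cases "degree u \<le> degree v")
      case True
      then obtain k where k: "degree v = degree u + k" using le_Suc_ex by blast
      have "emb (to_fract u / to_fract v, 0) = s * inverse t * ?w ^ k"
        unfolding emb_quot[OF v] s_def t_def k using uv0 x0 by (simp add: field_simps power_add)
      also have "\<dots> \<in> ?V" using D(6)[OF D(6)[OF s(1) t(3)] D(7)[OF wV]] .
      finally show ?thesis using True by (simp only: mem_image_iff simp_thms)
    next
      case False
      then obtain k where k: "degree u = Suc (degree v + k)" by (metis less_imp_Suc_add not_le)
      have "inverse (emb (to_fract u / to_fract v, 0)) = (t * inverse s * ?w ^ k) * ?w"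
        unfolding emb_quot[OF v] s_def t_def k using uv0 x0 by (simp add: field_simps power_add)
      also have "\<dots> \<in> nonunits ?V" using nonunits_mult[OF sV D(6)[OF D(6)[OF t(1) s(3)] D(7)[OF wV]] w] .
      finally have n: "inverse (emb (to_fract u / to_fract v, 0)) \<in> nonunits ?V" .
      moreover have "emb (to_fract u / to_fract v, 0) \<noteq> 0" using uv0 by (simp add: emb_quot[OF v])
      ultimately have "emb (to_fract u / to_fract v, 0) \<notin> ?V" by (auto simp: nonunits_def)
      then show ?thesis using u False by (simp only: mem_image_iff simp_thms)
    qed
  qed
  show "(a, 0) \<in> P \<longleftrightarrow> (a, 0) \<in> P'" if "P \<in> ?A" "P' \<in> ?A" for P P' a
  proof -
    obtain u v where uv: "v \<noteq> 0" "a = to_fract u / to_fract v" by (rule fract_quotE)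
    show ?thesis unfolding uv(2) using iff[OF that(1) uv(1)] iff[OF that(2) uv(1)] by blast
  qed
qed blast

text \<open>\<open>y\<close> is integral over \<open>k[X]\<close>: if it had a pole,
  \<open>inverse y * f = y\<close> would be regular.\<close>

lemma y_in_place:
  assumes P: "P \<in> places" and x: "e [:0, 1:] \<in> emb ` P" shows "y \<in> emb ` P"
proof (rule ccontr)
  assume n: "y \<notin> emb ` P"
  have "y = emb (0, 1)" by (simp add: emb_def)
  then have yr: "y \<in> range emb" by blast
  have "y \<noteq> 0" "inverse y \<in> emb ` P"
    using outside_val_ring[OF placesD(1)[OF P] yr n] nonunits_subset by auto
  then have "inverse y * (y * y) \<in> emb ` P"
    using poly_in_place[OF P x, of f] subring_setD(6)[OF val_ring_subring[OF placesD(1)[OF P]]] by (simp only: y e_def)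
  then show False using \<open>y \<noteq> 0\<close> n by (simp flip: mult.assoc)
qed

text \<open>A pole of \<open>u/v + (s/t) Y\<close> is a pole of X or a zero of \<open>v * t\<close>;
  both sets are finite.\<close>

sublocale field_curve "hyp_field f" emb \<kappa>
proof
  fix z :: "'k ffield"
  obtain u v where a: "v \<noteq> 0" "fst z = to_fract u / to_fract v" by (rule fract_quotE)
  obtain s t where b: "t \<noteq> 0" "snd z = to_fract s / to_fract t" by (rule fract_quotE)
  have "e (v * t) \<in> nonunits (emb ` P)" if P: "P \<in> places" "z \<notin> P" and x: "e [:0, 1:] \<in> emb ` P" for P
  proof (rule ccontr)
    note D = subring_setD[OF val_ring_subring[OF placesD(1)[OF P(1)]]]
    note pP = poly_in_place[OF P(1) x]
    assume "e (v * t) \<notin> nonunits (emb ` P)"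
    then have i: "inverse (e (v * t)) \<in> emb ` P" using not_nonunit pP by blast
    have "emb z = e u / e v + e s / e t * y" by (simp add: emb_def e_def a b)
    also have "\<dots> = (e u * e t + e s * e v * y) * inverse (e (v * t))"
      using a(1) b(1) e_simps(6)[of v] e_simps(6)[of t] unfolding e_simps(2) by (simp add: field_simps)
    also have "\<dots> \<in> emb ` P"
      by (intro D(6)[OF _ i] D(5) D(6) pP y_in_place[OF P(1) x])
    finally show False using P(2) by (simp only: mem_image_iff)
  qed
  then have "{P \<in> places. z \<notin> P} \<subseteq> {P \<in> places. e [:0, 1:] \<notin> emb ` P} \<union>
    {P \<in> places. e [:0, 1:] \<in> emb ` P \<and> e (v * t) \<in> nonunits (emb ` P)}" by blast
  moreover have "finite \<dots>" using finite_places_infinity finite_places_zero[of "v * t"] a b by simp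
  ultimately show "finite {P \<in> valuation_rings (hyp_field f) \<kappa>. z \<notin> P}"
    unfolding places_def by (rule finite_subset)
qed

end

section \<open>Affine groups of automorphisms\<close>

locale affine_automorphisms = hyp_equation f R c y
  for f :: "'k::field poly" and R c y +
  fixes G :: "('k ffield set, 'k ffield) auto set" and \<alpha> \<beta> \<gamma> :: "('k ffield set, 'k ffield) auto \<Rightarrow> 'k"
  assumes G: "subgroup G (aut_group (hyp_curve f))" "finite G"
    and aff: "\<And>g. g \<in> G \<Longrightarrow> acts_affinely f g (\<alpha> g) (\<beta> g) (\<gamma> g)"
begin

lemma hyp_curve_eq: "hyp_curve f = crv"
  by (simp add: hyp_curve_def)

definition pull :: "('k ffield set, 'k ffield) auto \<Rightarrow> 'k ffield \<Rightarrow> 'k ffield" where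
  "pull = pullback (hyp_field f) \<kappa>"

definition pair :: "('k ffield set, 'k ffield) auto \<Rightarrow> 'k \<times> 'k" where
  "pair g = (\<alpha> g, \<beta> g)"

definition H :: "('k \<times> 'k) set" where "H = pair ` G"

lemma G_aut: "g \<in> G \<Longrightarrow> g \<in> carrier (Aut)"
  using subgroup.mem_carrier[OF G(1)] by (simp add: hyp_curve_eq)

lemma G_iso: "g \<in> G \<Longrightarrow> rs_iso crv crv g"
  using G_aut aut_groupD by blast

lemma G_one: "\<one>\<^bsub>Aut\<^esub> \<in> G"
  using subgroup.one_closed[OF G(1)] by (simp add: hyp_curve_eq)

lemma G_mult: "g \<in> G \<Longrightarrow> h \<in> G \<Longrightarrow> g \<otimes>\<^bsub>Aut\<^esub> h \<in> G"
  using subgroup.m_closed[OF G(1)] by (simp add: hyp_curve_eq)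

lemma pull_affinely:
  assumes "g \<in> G" "acts_affinely f g a b d"
  shows "pull g (to_fract [:0, 1:], 0) = (to_fract [:b, a:], 0)" "pull g (0, 1) = (0, to_fract [:d:])"
  using assms(2) pulls_back_pullback[OF G_iso[OF assms(1)]]
  by (auto simp: acts_affinely_def pull_def hyp_curve_eq)

lemmas pull_gen = pull_affinely[OF _ aff]

lemma pull_hom:
  assumes "g \<in> G"
  shows "pull g (a + a', b + b') = (fst (pull g (a, b)) + fst (pull g (a', b')), snd (pull g (a, b)) + snd (pull g (a', b')))"
    "pull g (z \<otimes>\<^bsub>hyp_field f\<^esub> w) = pull g z \<otimes>\<^bsub>hyp_field f\<^esub> pull g w"
    "pull g (to_fract [:d:], 0) = (to_fract [:d:], 0)" "inj (pull g)"
  using pullback_hom[OF G_iso[OF assms]] pullback_inj[OF G_iso[OF assms]]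
    pullback_hom(1)[OF G_iso[OF assms], of "(a, b)" "(a', b')"]
  by (simp_all add: pull_def del: hyp_field_simps(2))

lemma \<alpha>_nz: "g \<in> G \<Longrightarrow> \<alpha> g \<noteq> 0"
proof
  assume g: "g \<in> G" and "\<alpha> g = 0"
  then have "pull g (to_fract [:0, 1:], 0) = pull g (to_fract [:\<beta> g:], 0)"
    using pull_gen(1)[OF g g] pull_hom(3)[OF g, of "\<beta> g"] by simp
  from injD[OF pull_hom(4)[OF g] this] show False by simp
qed

lemma \<gamma>_nz: "g \<in> G \<Longrightarrow> \<gamma> g \<noteq> 0"
proof
  assume g: "g \<in> G" and "\<gamma> g = 0"
  then have "pull g (0, 1) = pull g (0, 0)"
    using pull_gen(2)[OF g g] pull_hom(3)[OF g, of 0] by simp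
  from injD[OF pull_hom(4)[OF g] this] show False by simp
qed

lemma degree_pair: "g \<in> G \<Longrightarrow> degree (aff_poly (pair g)) > 0"
  using \<alpha>_nz by (simp add: pair_def aff_poly_def)

lemma pull_poly: "g \<in> G \<Longrightarrow> pull g (to_fract p, 0) = (to_fract (pcompose p (aff_poly (pair g))), 0)"
proof (induction p)
  case 0
  then show ?case using pull_hom(3)[of g 0] by simp
next
  case (pCons a p)
  have "pCons a p = [:a:] + [:0, 1:] * p" by simp
  then have "(to_fract (pCons a p), 0) = (to_fract [:a:] + to_fract [:0, 1:] * to_fract p, 0::'k poly fract)"
    by (metis to_fract_add to_fract_mult)
  then have "pull g (to_fract (pCons a p), 0) = pull g (to_fract [:a:] + to_fract [:0, 1:] * to_fract p, 0 + 0)" by simp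
  also have "\<dots> = (to_fract [:a:] + fst (pull g ((to_fract [:0, 1:], 0) \<otimes>\<^bsub>hyp_field f\<^esub> (to_fract p, 0))),
      snd (pull g ((to_fract [:0, 1:], 0) \<otimes>\<^bsub>hyp_field f\<^esub> (to_fract p, 0))))"
    unfolding pull_hom(1)[OF pCons.prems] by (simp add: pull_hom(3)[OF pCons.prems])
  also have "\<dots> = (to_fract [:a:] + to_fract (aff_poly (pair g)) * to_fract (pcompose p (aff_poly (pair g))), 0)"
    unfolding pull_hom(2)[OF pCons.prems] pull_gen(1)[OF pCons.prems pCons.prems] pCons.IH[OF pCons.prems]
    by (simp add: aff_poly_def pair_def)
  finally show ?case by (simp only: pcompose_pCons to_fract_add to_fract_mult)
qed

lemma pull_fract: "g \<in> G \<Longrightarrow> pull g (a, 0) = (frac_comp a (aff_poly (pair g)), 0)"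
proof -
  assume g: "g \<in> G"
  obtain u v where a: "v \<noteq> 0" "a = to_fract u / to_fract v" by (rule fract_quotE)
  let ?p = "aff_poly (pair g)"
  have v0: "pcompose v ?p \<noteq> 0" using pcompose_nonzero[OF degree_pair[OF g] a(1)] .
  have "(a, 0) \<otimes>\<^bsub>hyp_field f\<^esub> (to_fract v, 0) = (to_fract u, 0)" using a by simp
  then have "pull g (a, 0) \<otimes>\<^bsub>hyp_field f\<^esub> (to_fract (pcompose v ?p), 0) = (to_fract (pcompose u ?p), 0)"
    using pull_hom(2)[OF g, of "(a, 0)" "(to_fract v, 0)"] by (simp only: pull_poly[OF g])
  then show ?thesis using v0
    unfolding a(2) frac_comp_quot[OF degree_pair[OF g] a(1)] by (simp add: prod_eq_iff field_simps)
qed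

lemma pull_eq:
  "g \<in> G \<Longrightarrow> pull g (a, b) = (frac_comp a (aff_poly (pair g)), frac_comp b (aff_poly (pair g)) * to_fract [:\<gamma> g:])"
proof -
  assume g: "g \<in> G"
  have "(a, b) = (a + 0, 0 + b)" by simp
  also have "pull g \<dots> = (fst (pull g (a, 0)) + fst (pull g (0, b)), snd (pull g (a, 0)) + snd (pull g (0, b)))"
    by (rule pull_hom(1)[OF g])
  also have "(0, b) = (b, 0) \<otimes>\<^bsub>hyp_field f\<^esub> (0, 1)" by simp
  also have "pull g \<dots> = (0, frac_comp b (aff_poly (pair g)) * to_fract [:\<gamma> g:])"
    unfolding pull_hom(2)[OF g] pull_fract[OF g] pull_gen(2)[OF g g] by simp
  finally show ?thesis by (simp add: pull_fract[OF g])
qed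

lemma pull_inj:
  assumes "g \<in> G" "h \<in> G" "pair g = pair h" "\<gamma> g = \<gamma> h" shows "g = h"
proof -
  have "pull g = pull h" by (rule ext) (metis pull_eq assms prod.collapse)
  then show ?thesis unfolding pull_def by (rule aut_eqI[OF G_aut[OF assms(1)] G_aut[OF assms(2)]])
qed

lemma params_one: "pair \<one>\<^bsub>Aut\<^esub> = (1, 0)" "\<gamma> \<one>\<^bsub>Aut\<^esub> = 1"
proof -
  have id: "pull \<one>\<^bsub>Aut\<^esub> = id" by (simp add: pull_def pullback_one)
  show "pair \<one>\<^bsub>Aut\<^esub> = (1, 0)"
    using pull_gen(1)[OF G_one G_one] by (simp add: id pair_def)
  have "to_fract [:\<gamma> \<one>\<^bsub>Aut\<^esub>:] = to_fract 1"
    using pull_gen(2)[OF G_one G_one] by (simp add: id)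
  then show "\<gamma> \<one>\<^bsub>Aut\<^esub> = 1" by (simp only: to_fract_eq_iff) (simp add: one_pCons)
qed

text \<open>Pullback reverses products, and so does substitution: the pullback by \<open>h\<close>
  of \<open>g(X)\<close> is \<open>g(h(X))\<close>. The two reversals cancel.\<close>

lemma params_mult:
  assumes g: "g \<in> G" and h: "h \<in> G"
  shows "pair (g \<otimes>\<^bsub>Aut\<^esub> h) = aff_mult (pair g) (pair h)"
    "\<gamma> (g \<otimes>\<^bsub>Aut\<^esub> h) = \<gamma> g * \<gamma> h"
proof -
  let ?k = "g \<otimes>\<^bsub>Aut\<^esub> h"
  have k: "?k \<in> G" using G_mult[OF g h] .
  have p: "pull ?k z = pull h (pull g z)" for z
    using pullback_mult[OF G_iso[OF g] G_iso[OF h]] by (simp add: pull_def)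
  have "(to_fract (aff_poly (pair ?k)), 0) = pull h (to_fract (aff_poly (pair g)), 0::'k poly fract)"
    using p[of "(to_fract [:0, 1:], 0)"] pull_gen(1)[OF k k] pull_gen(1)[OF g g]
    by (simp add: aff_poly_def pair_def)
  then have "aff_poly (pair ?k) = aff_poly (aff_mult (pair g) (pair h))"
    by (simp add: pull_poly[OF h] pcompose_aff_poly)
  then show "pair ?k = aff_mult (pair g) (pair h)" by (simp add: aff_poly_def prod_eq_iff)
  have "to_fract [:\<gamma> ?k:] = to_fract [:\<gamma> g:] * to_fract [:\<gamma> h:]"
    using p[of "(0, 1)"] pull_gen(2)[OF k k] pull_gen(2)[OF g g]
    by (simp add: pull_eq[OF h] frac_comp_to_fract[OF degree_pair[OF h]])
  then show "\<gamma> ?k = \<gamma> g * \<gamma> h" by (simp flip: to_fract_mult)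
qed

text \<open>Apply \<open>g\<close> to \<open>Y^2 = f(X)\<close>.\<close>

lemma f_semi: "g \<in> G \<Longrightarrow> pcompose f (aff_poly (pair g)) = smult (\<gamma> g ^ 2) f"
proof -
  assume g: "g \<in> G"
  have "(0, 1) \<otimes>\<^bsub>hyp_field f\<^esub> (0, 1) = (to_fract f, 0)" by simp
  then have "pull g (0, 1) \<otimes>\<^bsub>hyp_field f\<^esub> pull g (0, 1) = pull g (to_fract f, 0)"
    by (simp only: flip: pull_hom(2)[OF g])
  then have "to_fract ([:\<gamma> g:] * [:\<gamma> g:] * f) = to_fract (pcompose f (aff_poly (pair g)))"
    by (simp add: pull_gen(2)[OF g g] pull_poly[OF g] to_fract_mult del: mult_pCons_left mult_pCons_right)
  then have "[:\<gamma> g:] * [:\<gamma> g:] * f = pcompose f (aff_poly (pair g))" by (simp only: to_fract_eq_iff)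
  then show ?thesis by (simp add: power2_eq_square)
qed

sublocale aff: affine_group H
proof
  show "finite H" using G(2) by (simp add: H_def)
  show "(1, 0) \<in> H" using imageI[OF G_one, of pair] by (simp only: H_def params_one)
  show "aff_mult g h \<in> H" if "g \<in> H" "h \<in> H" for g h
    using that G_mult params_mult(1) by (auto simp: H_def simp flip: params_mult(1))
  show "fst g \<noteq> 0" if "g \<in> H" for g using that \<alpha>_nz by (auto simp: H_def pair_def)
qed

lemma quotient_isomorphic_crv:
  fixes L :: "'l ring" and j :: "'l \<Rightarrow> 'k ffield" and \<kappa>' :: "'k \<Rightarrow> 'l"
  assumes "carrier L = UNIV" "inj j" "\<And>a b. j (a \<oplus>\<^bsub>L\<^esub> b) = j a \<oplus>\<^bsub>hyp_field f\<^esub> j b"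
      "\<And>a b. j (a \<otimes>\<^bsub>L\<^esub> b) = j a \<otimes>\<^bsub>hyp_field f\<^esub> j b"
      "j \<one>\<^bsub>L\<^esub> = (1, 0)" "j \<zero>\<^bsub>L\<^esub> = (0, 0)" "\<And>a. j (\<kappa>' a) = \<kappa> a"
    and "range j = {z. \<forall>g\<in>G. pull g z = z}"
  shows "isomorphic (quotient_space (hyp_curve f) G) (curve_of L \<kappa>')"
  unfolding hyp_curve_eq
  by (rule quotient_isomorphic[of G L j \<kappa>']) (use assms G(2) G_aut G_one G_mult in \<open>auto simp: pull_def\<close>)

section \<open>The invariant fields and the quotient curves\<close>

lemma involution_quotient:
  assumes "g \<in> G" "is_hyp_involution f g"
  shows "isomorphic (quotient_space (hyp_curve f) G) proj_line"
proof -
  have inv: "pull g (a, b) = (a, - b)" for a b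
  proof -
    \<comment> \<open>Two affine descriptions of \<open>g\<close> give the same pullbacks of X and
      Y, so their parameters coincide.\<close>
    have "\<alpha> g = 1" "\<beta> g = 0" "\<gamma> g = -1"
      using pull_gen[OF assms(1) assms(1)] pull_affinely[OF assms(1), of 1 0 "-1"] assms(2)
      by (auto simp: is_hyp_involution_def)
    moreover have "[:- 1::'k:] = - 1" by (simp add: one_pCons)
    ultimately have "pair g = (1, 0)" "to_fract [:\<gamma> g:] = -1"
      by (simp_all only: pair_def to_fract_uminus to_fract_1)
    moreover have "frac_comp a (aff_poly (1, 0)) = a" for a :: "'k poly fract"
      by (rule fract_quotE[of a]) (simp add: aff_poly_def frac_comp_quot)
    ultimately show ?thesis by (simp add: pull_eq[OF assms(1)])
  qed
  have fixed: "range (\<lambda>a. (frac_comp a aff.xpoly, 0)) = {z. \<forall>g\<in>G. pull g z = z}"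
  proof (intro equalityI subsetI)
    fix z assume "z \<in> range (\<lambda>a. (frac_comp a aff.xpoly, 0::'k poly fract))"
    then obtain a where a: "z = (a, 0)" "a \<in> range (\<lambda>a. frac_comp a aff.xpoly)" by blast
    then have "\<forall>h\<in>H. frac_comp a (aff_poly h) = a" by (simp add: aff.frac_invariant_iff)
    then show "z \<in> {z. \<forall>g\<in>G. pull g z = z}" by (simp add: a(1) pull_fract H_def)
  next
    fix z assume z: "z \<in> {z. \<forall>g\<in>G. pull g z = z}"
    obtain a b where ab: "z = (a, b)" by (cases z)
    have "- b = b" using z assms(1) inv ab by auto
    then have "b + b = 0" by (metis add.left_inverse)
    then have "2 * b = 0" by (simp only: mult_2)
    then have b: "b = 0" using two_fract by (simp only: mult_eq_0_iff) blast
    then have "\<forall>h\<in>H. frac_comp a (aff_poly h) = a" using z by (simp add: ab pull_fract H_def)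
    then have "a \<in> range (\<lambda>a. frac_comp a aff.xpoly)" by (simp add: aff.frac_invariant_iff)
    then show "z \<in> range (\<lambda>a. (frac_comp a aff.xpoly, 0))" using ab b by blast
  qed
  note x = aff.degree_xpoly_pos
  show ?thesis unfolding proj_line_def
    by (rule quotient_isomorphic_crv[OF _ _ _ _ _ _ _ fixed])
       (use inj_frac_comp[OF x] in \<open>auto simp: ring_of_type_algebra_def inj_def frac_comp_add[OF x]
         frac_comp_mult[OF x] frac_comp_0[OF x] frac_comp_1[OF x] frac_comp_to_fract[OF x]\<close>)
qed

text \<open>The embedding \<open>j\<close> sends X to \<open>xpoly\<close> and Y to
  \<open>s Y\<close>. It is multiplicative because \<open>(s Y)^2 = s^2 f = h(xpoly)\<close>, and
  its image consists of all invariants because \<open>s Y\<close> is itself invariant.\<close>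

lemma semi_invariant_quotient:
  assumes s: "s \<noteq> 0" "\<And>g. g \<in> G \<Longrightarrow> smult (\<gamma> g) (pcompose s (aff_poly (pair g))) = s"
    and h: "f * s ^ 2 = pcompose h aff.xpoly"
  shows "isomorphic (quotient_space (hyp_curve f) G) (hyp_curve h)"
proof -
  note x = aff.degree_xpoly_pos
  define t where "t = to_fract s"
  have t0: "t \<noteq> 0" using s(1) by (simp add: t_def)
  define j :: "'k ffield \<Rightarrow> 'k ffield" where "j = (\<lambda>z. (frac_comp (fst z) aff.xpoly, frac_comp (snd z) aff.xpoly * t))"
  have ht: "frac_comp (to_fract h) aff.xpoly = to_fract f * t * t"
    unfolding frac_comp_to_fract[OF x] h[symmetric] by (simp add: t_def power2_eq_square mult_ac)
  have tg: "frac_comp t (aff_poly (pair g)) * to_fract [:\<gamma> g:] = t" if g: "g \<in> G" for g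
  proof -
    have "pcompose s (aff_poly (pair g)) * [:\<gamma> g:] = s" using s(2)[OF g] by (simp add: mult.commute)
    then show ?thesis unfolding t_def frac_comp_to_fract[OF degree_pair[OF g]] by (metis to_fract_mult)
  qed
  have fixed: "range j = {z. \<forall>g\<in>G. pull g z = z}"
  proof (intro equalityI subsetI)
    fix z assume "z \<in> range j"
    then obtain a b where ab: "z = (a, b * t)" "a \<in> range (\<lambda>a. frac_comp a aff.xpoly)" "b \<in> range (\<lambda>a. frac_comp a aff.xpoly)"
      by (auto simp: j_def)
    have "\<forall>h\<in>H. frac_comp a (aff_poly h) = a" "\<forall>h\<in>H. frac_comp b (aff_poly h) = b"
      using ab(2,3) unfolding aff.frac_invariant_iff .
    then have "pull g z = z" if g: "g \<in> G" for g
      using tg[OF g] g by (simp add: ab(1) pull_eq H_def frac_comp_mult[OF degree_pair[OF g]] mult.assoc)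
    then show "z \<in> {z. \<forall>g\<in>G. pull g z = z}" by blast
  next
    fix z assume z: "z \<in> {z. \<forall>g\<in>G. pull g z = z}"
    \<comment> \<open>Dividing the coefficient of Y by \<open>s\<close> removes the factor \<gamma>,
      so both components become invariant rational functions of X.\<close>
    define a b where "a = fst z" and "b = snd z / t"
    have zab: "z = (a, b * t)" using t0 by (simp add: a_def b_def)
    have "frac_comp a (aff_poly (pair g)) = a \<and> frac_comp b (aff_poly (pair g)) = b" if g: "g \<in> G" for g
    proof -
      have "pull g (a, b * t) = (a, b * t)" using z g zab by blast
      then have e: "frac_comp a (aff_poly (pair g)) = a"
        "frac_comp b (aff_poly (pair g)) * (frac_comp t (aff_poly (pair g)) * to_fract [:\<gamma> g:]) = b * t"
        by (simp_all add: pull_eq[OF g] frac_comp_mult[OF degree_pair[OF g]] mult.assoc)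
      then show ?thesis unfolding tg[OF g] using t0 by simp
    qed
    then have "\<forall>h\<in>H. frac_comp a (aff_poly h) = a" "\<forall>h\<in>H. frac_comp b (aff_poly h) = b"
      by (auto simp: H_def)
    then obtain a' b' where "a = frac_comp a' aff.xpoly" "b = frac_comp b' aff.xpoly"
      unfolding aff.frac_invariant_iff by blast
    then have "z = j (a', b')" by (simp add: zab j_def)
    then show "z \<in> range j" by blast
  qed
  show ?thesis unfolding hyp_curve_def[of h]
  proof (rule quotient_isomorphic_crv[OF _ _ _ _ _ _ _ fixed])
    show "inj j" using injD[OF inj_frac_comp[OF x]] t0 by (auto simp: inj_def j_def)
    show "j (a \<otimes>\<^bsub>hyp_field h\<^esub> b) = j a \<otimes>\<^bsub>hyp_field f\<^esub> j b" for a b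
      by (simp add: j_def frac_comp_add[OF x] frac_comp_mult[OF x] ht algebra_simps)
  qed (simp_all add: j_def frac_comp_add[OF x] frac_comp_0[OF x] frac_comp_1[OF x] frac_comp_to_fract[OF x] algebra_simps)
qed

text \<open>If \<open>g\<close> and \<open>h\<close> act alike on X, then \<open>t\<close>, the
  product of \<open>g\<close> and the inverse of \<open>h\<close>, fixes X, so
  \<open>\<gamma> t ^ 2 = 1\<close> by \<open>f_semi\<close>. The value -1 would make
  \<open>t\<close> the involution.\<close>

lemma pair_inj:
  assumes noinv: "\<not> (\<exists>g\<in>G. is_hyp_involution f g)"
  shows "g \<in> G \<Longrightarrow> h \<in> G \<Longrightarrow> pair g = pair h \<Longrightarrow> g = h"
proof -
  assume g: "g \<in> G" and h: "h \<in> G" and e: "pair g = pair h"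
  have "inj_on (\<lambda>k. h \<otimes>\<^bsub>Aut\<^esub> k) G"
  proof (rule inj_onI)
    fix k l assume k: "k \<in> G" and l: "l \<in> G" and "h \<otimes>\<^bsub>Aut\<^esub> k = h \<otimes>\<^bsub>Aut\<^esub> l"
    then have "aff_mult (pair h) (pair k) = aff_mult (pair h) (pair l)" "\<gamma> h * \<gamma> k = \<gamma> h * \<gamma> l"
      by (metis params_mult(1)[OF h], metis params_mult(2)[OF h])
    then show "k = l" using \<alpha>_nz[OF h] \<gamma>_nz[OF h] by (intro pull_inj k l) (auto simp: aff_mult_def pair_def)
  qed
  then have "(\<lambda>k. h \<otimes>\<^bsub>Aut\<^esub> k) ` G = G"
    using G_mult[OF h] by (intro endo_inj_surj[OF G(2)] image_subsetI)
  then obtain k where k: "k \<in> G" "h \<otimes>\<^bsub>Aut\<^esub> k = \<one>\<^bsub>Aut\<^esub>"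
  proof -
    have "\<one>\<^bsub>Aut\<^esub> \<in> (\<lambda>k. h \<otimes>\<^bsub>Aut\<^esub> k) ` G" using \<open>_ = G\<close> G_one by simp
    then obtain l where "\<one>\<^bsub>Aut\<^esub> = h \<otimes>\<^bsub>Aut\<^esub> l" "l \<in> G" by (rule imageE)
    then show ?thesis using that[of l] by simp
  qed
  let ?t = "g \<otimes>\<^bsub>Aut\<^esub> k"
  have t: "?t \<in> G" using G_mult[OF g k(1)] .
  have pt: "pair ?t = (1, 0)" using params_mult(1)[OF g k(1)] params_mult(1)[OF h k(1)] k(2) params_one e by simp
  have "smult (\<gamma> ?t ^ 2 - 1) f = 0" using f_semi[OF t] by (simp add: pt aff_poly_def smult_diff_left)
  then have "\<gamma> ?t ^ 2 = 1" using f_nonzero by simp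
  moreover have "\<gamma> ?t \<noteq> -1"
  proof
    assume "\<gamma> ?t = -1"
    then have "acts_affinely f ?t 1 0 (-1)" using aff[OF t] pt by (simp add: pair_def)
    then have "is_hyp_involution f ?t" using G_aut[OF t] by (simp add: is_hyp_involution_def hyp_curve_eq)
    then show False using noinv t by blast
  qed
  ultimately have "\<gamma> ?t = 1" by (simp add: power2_eq_1_iff)
  then have "\<gamma> g * \<gamma> k = \<gamma> h * \<gamma> k" using params_mult(2)[OF g k(1)] params_mult(2)[OF h k(1)] k(2) params_one by simp
  then show "g = h" using \<gamma>_nz[OF k(1)] e by (intro pull_inj g h) auto
qed

end

theorem theorem1p1:
  fixes f :: "'k::field poly"
    and c :: 'k
    and R :: "'k alg_closure set"
    and G :: "('k ffield set, 'k ffield) auto set"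
    and \<alpha> \<beta> \<gamma> :: "('k ffield set, 'k ffield) auto \<Rightarrow> 'k"
  defines "orbits \<equiv> (\<lambda>r. (\<lambda>g. to_ac (\<alpha> g) * r + to_ac (\<beta> g)) ` G) ` R"
    and "U \<equiv> {a. \<exists>g\<in>G. g \<noteq> \<one>\<^bsub>aut_group (hyp_curve f)\<^esub> \<and> \<alpha> g * a + \<beta> g = a}"
  defines "m \<equiv> card G div card U"
  defines "\<mu> \<equiv> \<Prod>a\<in>U. a ^ m"
  assumes char: "CHAR('k) \<noteq> 2"
    and sqf: "squarefree f" and deg: "Polynomial.degree f \<ge> 1"
    and R: "finite R" "map_poly to_ac f = Polynomial.smult (to_ac c) (\<Prod>r\<in>R. [:- r, 1:])"
    and G: "subgroup G (aut_group (hyp_curve f))" "finite G"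
    and aff: "\<And>g. g \<in> G \<Longrightarrow> acts_affinely f g (\<alpha> g) (\<beta> g) (\<gamma> g)"
  shows
    "((\<exists>g\<in>G. is_hyp_involution f g) \<longrightarrow> isomorphic (quotient_space (hyp_curve f) G) proj_line) \<and>
     ((\<forall>g\<in>G. \<gamma> g = 1) \<longrightarrow>
        (\<exists>h. map_poly to_ac h =
               Polynomial.smult (to_ac c * (-1) ^ (card R - card orbits)) (\<Prod>Q\<in>orbits. [:- (\<Prod>r\<in>Q. r), 1:]) \<and>
             isomorphic (quotient_space (hyp_curve f) G) (hyp_curve h))) \<and>
     (\<not> (\<exists>g\<in>G. is_hyp_involution f g) \<and> \<not> (\<forall>g\<in>G. \<gamma> g = 1) \<longrightarrow>
        (\<exists>h. map_poly to_ac h =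
               Polynomial.smult (to_ac c * (-1) ^ ((m - 1) * (card orbits - 1)))
                 ([:- to_ac \<mu>, 1:] * (\<Prod>Q\<in>orbits - {to_ac ` U}. [:- (\<Prod>r\<in>Q. r), 1:])) \<and>
             isomorphic (quotient_space (hyp_curve f) G) (hyp_curve h)))"
proof -
  \<comment> \<open>If 2 vanished, the characteristic would divide 2, and characteristic 1 is
    impossible in a field.\<close>
  have two: "(2::'k) \<noteq> 0"
  proof
    assume "(2::'k) = 0"
    then have "of_nat 2 = (0::'k)" by simp
    then have "CHAR('k) dvd 2" by (simp only: of_nat_eq_0_iff_char_dvd)
    moreover have "CHAR('k) \<noteq> 1" using of_nat_eq_0_iff_char_dvd[of 1, where ?'a = 'k] by auto
    ultimately show False using char prime_nat_iff two_is_prime_nat by blast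
  qed
  obtain y where y: "y * y = to_ac (to_fract f)"
  proof -
    obtain y where "poly [:- to_ac (to_fract f), 0, 1:] y = 0"
      using alg_closed_imp_poly_has_root[of "[:- to_ac (to_fract f), 0, 1:]"] by auto
    then show ?thesis using that by simp
  qed
  interpret affine_automorphisms f R c y G \<alpha> \<beta> \<gamma>
    by (intro affine_automorphisms.intro hyp_equation.intro affine_automorphisms_axioms.intro)
      (fact two deg R y G aff)+
  have "affine_group H" by unfold_locales
  then interpret ac: affine_group "ac_pair ` H" by (rule affine_group_ac_pair)
  have orbits: "orbits = ac.orbit ` R"
  proof -
    have "ac.orbit r = (\<lambda>g. to_ac (\<alpha> g) * r + to_ac (\<beta> g)) ` G" for r
      unfolding ac.orbit_def by (simp add: H_def image_image aff_app_def ac_pair_def pair_def)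
    then show ?thesis unfolding orbits_def by (intro image_cong) simp_all
  qed
  have semi: "semi_invariant H f \<delta> R c" if \<delta>: "\<And>g. g \<in> G \<Longrightarrow> \<delta> (pair g) = \<gamma> g" for \<delta>
  proof
    show "\<delta> g \<noteq> 0" if "g \<in> H" for g using that \<delta> \<gamma>_nz by (auto simp: H_def)
    show "pcompose f (aff_poly g) = smult (\<delta> g ^ 2) f" if "g \<in> H" for g
      using that \<delta> f_semi by (auto simp: H_def)
    show "\<delta> (aff_mult g h) = \<delta> g * \<delta> h" if "g \<in> H" "h \<in> H" for g h
    proof -
      from that obtain g' h' where gh: "g' \<in> G" "h' \<in> G" "g = pair g'" "h = pair h'" unfolding H_def by blast
      then show ?thesis
        using \<delta>[OF G_mult[OF gh(1,2)]] \<delta> by (simp add: params_mult)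
    qed
  qed (fact two sqf deg R)+
  show ?thesis
  proof (intro conjI impI)
    assume "\<exists>g\<in>G. is_hyp_involution f g"
    then show "isomorphic (quotient_space (hyp_curve f) G) proj_line" using involution_quotient by blast
  next
    assume triv: "\<forall>g\<in>G. \<gamma> g = 1"
    \<comment> \<open>The constant character serves here, so \<gamma> need not be transferred along
      \<open>pair\<close>.\<close>
    interpret S: semi_invariant H f "\<lambda>_. 1" R c using triv by (intro semi) simp
    obtain h where h: "map_poly to_ac h = smult (to_ac c * (-1) ^ (card R - card orbits))
      (\<Prod>Q\<in>orbits. [:- (\<Prod>r\<in>Q. r), 1:])" "f = pcompose h aff.xpoly"
      using S.trivial_character unfolding orbits by blast
    then have "isomorphic (quotient_space (hyp_curve f) G) (hyp_curve h)"
      using triv by (intro semi_invariant_quotient[of 1]) (simp_all add: pcompose_1)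
    then show "\<exists>h. map_poly to_ac h =
               smult (to_ac c * (-1) ^ (card R - card orbits)) (\<Prod>Q\<in>orbits. [:- (\<Prod>r\<in>Q. r), 1:]) \<and>
             isomorphic (quotient_space (hyp_curve f) G) (hyp_curve h)" using h(1) by blast
  next
    assume "\<not> (\<exists>g\<in>G. is_hyp_involution f g) \<and> \<not> (\<forall>g\<in>G. \<gamma> g = 1)"
    then obtain g\<^sub>0 where noinv: "\<not> (\<exists>g\<in>G. is_hyp_involution f g)" and g0: "g\<^sub>0 \<in> G" "\<gamma> g\<^sub>0 \<noteq> 1" by blast
    have inj: "inj_on pair G" using pair_inj[OF noinv] by (auto intro: inj_onI)
    \<comment> \<open>Without the involution \<open>pair\<close> is injective, so \<gamma> becomes a
      character of \<open>H\<close>.\<close>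
    define \<delta> where "\<delta> = (\<lambda>g. \<gamma> (inv_into G pair g))"
    have \<delta>: "\<delta> (pair g) = \<gamma> g" if "g \<in> G" for g using that inj by (simp add: \<delta>_def)
    interpret S: nontrivial_character H f \<delta> R c "pair g\<^sub>0"
      using semi[OF \<delta>] g0 \<delta> by (auto simp: nontrivial_character_def nontrivial_character_axioms_def H_def)
    \<comment> \<open>By the same injectivity nontrivial automorphisms have nontrivial affine maps,
      so \<open>U\<close> and \<open>m\<close> agree with their counterparts for
      \<open>H\<close>.\<close>
    have one_iff: "pair g \<noteq> (1, 0) \<longleftrightarrow> g \<noteq> \<one>\<^bsub>aut_group (hyp_curve f)\<^esub>" if "g \<in> G" for g
      using that inj G_one params_one(1) unfolding hyp_curve_eq inj_on_def by metis
    have U: "U = S.U"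
      unfolding U_def S.U_def unfolding H_def using one_iff by (auto simp: aff_app_def pair_def)
    have m: "m = S.m"
      unfolding m_def S.m_def U unfolding H_def by (simp only: card_image[OF inj])
    have \<mu>: "\<mu> = S.\<mu>" by (simp add: \<mu>_def S.\<mu>_def U m)
    obtain h s where h: "map_poly to_ac h = smult (to_ac c * (-1) ^ ((m - 1) * (card orbits - 1)))
        ([:- to_ac \<mu>, 1:] * (\<Prod>Q\<in>orbits - {to_ac ` U}. [:- (\<Prod>r\<in>Q. r), 1:]))"
      "f * s ^ 2 = pcompose h aff.xpoly" "s \<noteq> 0" "\<forall>g\<in>H. smult (\<delta> g) (pcompose s (aff_poly g)) = s"
      using S.nontrivial_character unfolding U m \<mu> orbits by blast
    have "isomorphic (quotient_space (hyp_curve f) G) (hyp_curve h)"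
      using h(2-4) \<delta> by (intro semi_invariant_quotient[of s]) (auto simp: H_def)
    then show "\<exists>h. map_poly to_ac h =
               smult (to_ac c * (-1) ^ ((m - 1) * (card orbits - 1)))
                 ([:- to_ac \<mu>, 1:] * (\<Prod>Q\<in>orbits - {to_ac ` U}. [:- (\<Prod>r\<in>Q. r), 1:])) \<and>
             isomorphic (quotient_space (hyp_curve f) G) (hyp_curve h)" using h(1) by blast
  qed
qed

end
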